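(* Let $\varphi$ be a regular reflection solution (as defined in the context). Then $\varphi$ cannot be $C^2$ across the sonic arc $\Gamma_{sonic}$.
   Context: **Equation.** Fix $\gamma>1$, $\rho_1>\rho_0>0$, $u_1>0$ and a wedge angle $\theta_w\in(0,\pi/2)$. In the self-similar variables $(\xi,\eta)\in\mathbb R^2$, with $D=(\partial_\xi,\partial_\eta)$, the potential flow equation for the pseudo-potential $\varphi$ is $$\operatorname{div}\big(\rho(|D\varphi|^2,\varphi)D\varphi\big)+2\rho(|D\varphi|^2,\varphi)=0,\qquad \rho(|D\varphi|^2,\varphi)=\big(\rho_0^{\gamma-1}-(\gamma-1)(\varphi+\tfrac12|D\varphi|^2)\big)^{\frac1{\gamma-1}}.\qquad(\ast)$$ With $c^2=\rho_0^{\gamma-1}-(\gamma-1)(\tfrac12|D\varphi|^2+\varphi)$, it is elliptic where $|D\varphi|<c$ (subsonic) and hyperbolic where $|D\varphi|>c$ (supersonic). Solutions are understood weakly: $\varphi$ is locally Lipschitz, and across a $C^1$ curve $S$ (shock) on which $D\varphi$ jumps, the Rankine–Hugoniot condition $[\rho(|D\varphi|^2,\varphi)D\varphi\cdot\nu]_S=0$ holds ($\nu$ normal to $S$). **States (0), (1).** Let $\xi_0=\rho_1\sqrt{\frac{2(\rho_1^{\gamma-1}-\rho_0^{\gamma-1})}{(\gamma-1)(\rho_1^2-\rho_0^2)}}=\frac{\rho_1u_1}{\rho_1-\rho_0}>0$ (so $u_1$ is determined by $\rho_0,\rho_1,\gamma$), and $$\varphi_0=-\tfrac12(\xi^2+\eta^2),\qquad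 \varphi_1=-\tfrac12(\xi^2+\eta^2)+u_1(\xi-\xi_0).$$ The incident shock is $S=\{\xi=\xi_0\}$; it hits the wedge at $P_0=(\xi_0,\xi_0\tan\theta_w)$. **Problem 2.** Let $\Lambda=\{\xi<0,\eta>0\}\cup\{\eta>\xi\tan\theta_w,\ \xi>0\}$ (the upper half-plane outside the half-wedge). Find a solution $\varphi$ of $(\ast)$ in $\Lambda$ with $D\varphi\cdot\nu=0$ on $\partial\Lambda$ and $\lim_{R\to\infty}\|\varphi-\bar\varphi\|_{C(\Lambda\setminus B_R(0))}=0$, where $\bar\varphi=\varphi_0$ for $\xi>\xi_0,\ \eta>\xi\tan\theta_w$ and $\bar\varphi=\varphi_1$ for $\xi<\xi_0,\ \eta>0$. **State (2) and geometry.** State (2) is of the form $\varphi_2=-\frac12(\xi^2+\eta^2)+u_2(\xi-\xi_0)+(\eta-\xi_0\tan\theta_w)u_2\tan\theta_w$ with a constant $u_2$; its density is the constant $\rho_2=\rho(|D\varphi_2|^2,\varphi_2)$, its sonic speed is $c_2=\rho_2^{(\gamma-1)/2}$, and its sonic circle is the circle of center $(u_2,u_2\tan\theta_w)$ and radius $c_2$. $S_1:=\{\varphi_1=\varphi_2\}$ is a line through $P_0$; $P_1$ is a point of intersection of $S_1$ with the sonic circle; $P_4$ is the point where the sonic circle meets the wedge boundary between $P_0$ and the wedge vertex $P_3=(0,0)$; the reflected shock is the curve $P_0P_1P_2$, consisting of the straight segment $P_0P_1\subset S_1$ and a curve $P_1P_2$ ending at a point $P_2$ on $\{\eta=0,\xi<0\}$.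 $\Omega=P_1P_2P_3P_4$ is the domain bounded by the shock $P_1P_2$, the segment $P_2P_3\subset\{\eta=0\}$, the wedge segment $P_3P_4$ and the arc $P_1P_4$ of the sonic circle; $P_0P_1P_4$ is the region bounded by segments $P_0P_1$, $P_0P_4$ and arc $P_1P_4$. Notation: $\Gamma_{sonic}=\partial\Omega\cap\partial B_{c_2}((u_2,u_2\tan\theta_w))=P_1P_4$ (arc), $\Gamma_{shock}=P_1P_2$, $\Gamma_{wedge}=\partial\Omega\cap\partial\Lambda\cap\{\eta=\xi\tan\theta_w\}=P_3P_4$. **Regular reflection solution.** $\varphi\in C^{0,1}(\Lambda)\cap C^2(\Omega)$ is a regular reflection solution if it is a solution of Problem 2 such that $\varphi\in C^{\infty}(\Omega)\cap C^{1,\alpha}(\bar\Omega)$ for some $\alpha\in(0,1)$; $\varphi=\varphi_0$ for $\xi>\xi_0$, $\eta>\xi\tan\theta_w$; $\varphi=\varphi_1$ for $\xi<\xi_0$ and above the reflected shock $P_0P_1P_2$; $\varphi=\varphi_2$ in $P_0P_1P_4$; and (a) there is a state (2) of the form $\varphi_2=-\frac12(\xi^2+\eta^2)+u_2(\xi-\xi_0)+(\eta-\xi_0\tan\theta_w)u_2\tan\theta_w$ with $u_2>0$, $\rho_2>\rho_1$, satisfying $(\rho_1D\varphi_1-\rho_2D\varphi_2)\cdot\nu=0$ along the line $S_1=\{\varphi_1=\varphi_2\}$, which contains $P_0$ and $P_1$, where $P_1\in\Lambda$ is on the sonic circle of state (2), and state (2) is supersonic along $P_0P_1$ (apart from the endpoint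 $P_1$, which is sonic); (b) equation $(\ast)$ is elliptic in $\Omega$; (c) $\varphi\ge\varphi_2$ on $\Gamma_{shock}$. "$\varphi$ is $C^2$ across $\Gamma_{sonic}$" means that $\varphi$ is twice continuously differentiable in a neighborhood of the relative interior of the arc $\Gamma_{sonic}$ (including both sides, i.e. the side in $\Omega$ and the side in $P_0P_1P_4$). *)

theory Defs
  imports "HOL-Analysis.Analysis"
begin

type_synonym plane = "real \<times> real"

section \<open>Calculus in the self-similar plane\<close>

definition Dxi :: "(plane \<Rightarrow> real) \<Rightarrow> plane \<Rightarrow> real" where
  "Dxi f p = frechet_derivative f (at p) (1, 0)"

definition Deta :: "(plane \<Rightarrow> real) \<Rightarrow> plane \<Rightarrow> real" where
  "Deta f p = frechet_derivative f (at p) (0, 1)"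

definition grad :: "(plane \<Rightarrow> real) \<Rightarrow> plane \<Rightarrow> plane" where
  "grad f p = (Dxi f p, Deta f p)"

text \<open>\<open>Ck k U f\<close>: \<open>f\<close> is of class \<open>C\<^sup>k\<close> on the open set \<open>U\<close>.\<close>

primrec Ck :: "nat \<Rightarrow> plane set \<Rightarrow> (plane \<Rightarrow> real) \<Rightarrow> bool" where
  "Ck 0 U f \<longleftrightarrow> continuous_on U f"
| "Ck (Suc k) U f \<longleftrightarrow> (\<forall>p\<in>U. f differentiable (at p)) \<and> Ck k U (Dxi f) \<and> Ck k U (Deta f)"

definition smooth_in :: "plane set \<Rightarrow> (plane \<Rightarrow> real) \<Rightarrow> bool" where
  "smooth_in U f \<longleftrightarrow> (\<forall>k. Ck k U f)"

text \<open>The space \<open>C\<^sup>1\<^sup>,\<^sup>\<alpha>\<close> on the closure of a bounded open set \<open>U\<close>, read off from the values in \<open>U\<close>: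
  uniform continuity, respectively Hoelder continuity, on \<open>U\<close> is what makes \<open>f\<close> and its gradient
  extend to the closure.\<close>

definition C1_holder_up_to_boundary :: "real \<Rightarrow> plane set \<Rightarrow> (plane \<Rightarrow> real) \<Rightarrow> bool" where
  "C1_holder_up_to_boundary \<alpha> U f \<longleftrightarrow>
     Ck 1 U f \<and> uniformly_continuous_on U f \<and>
     (\<exists>C. \<forall>p\<in>U. \<forall>q\<in>U. dist (grad f p) (grad f q) \<le> C * dist p q powr \<alpha>)"

definition test_function :: "plane set \<Rightarrow> (plane \<Rightarrow> real) \<Rightarrow> bool" where
  "test_function U \<zeta> \<longleftrightarrow> Ck 1 UNIV \<zeta> \<and> (\<exists>K. compact K \<and> K \<subseteq> U \<and> (\<forall>p. p \<notin> K \<longrightarrow> \<zeta> p = 0))"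

section \<open>The potential flow equation\<close>

text \<open>In \<open>sound_sq\<close> and \<open>rho\<close> the arguments \<open>s\<close> and \<open>z\<close> stand for \<open>|D\<phi>|\<^sup>2\<close> and \<open>\<phi>\<close>.\<close>

definition sound_sq :: "real \<Rightarrow> real \<Rightarrow> real \<Rightarrow> real \<Rightarrow> real" where
  "sound_sq \<gamma> \<rho>0 s z = \<rho>0 powr (\<gamma> - 1) - (\<gamma> - 1) * (z + s / 2)"

definition rho :: "real \<Rightarrow> real \<Rightarrow> real \<Rightarrow> real \<Rightarrow> real" where
  "rho \<gamma> \<rho>0 s z = sound_sq \<gamma> \<rho>0 s z powr (1 / (\<gamma> - 1))"

definition sound_sq_of :: "real \<Rightarrow> real \<Rightarrow> (plane \<Rightarrow> real) \<Rightarrow> plane \<Rightarrow> real" where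
  "sound_sq_of \<gamma> \<rho>0 \<phi> p = sound_sq \<gamma> \<rho>0 ((norm (grad \<phi> p))\<^sup>2) (\<phi> p)"

definition rho_of :: "real \<Rightarrow> real \<Rightarrow> (plane \<Rightarrow> real) \<Rightarrow> plane \<Rightarrow> real" where
  "rho_of \<gamma> \<rho>0 \<phi> p = rho \<gamma> \<rho>0 ((norm (grad \<phi> p))\<^sup>2) (\<phi> p)"

text \<open>The equation is elliptic at \<open>p\<close> if the flow is subsonic there: \<open>|D\<phi>| < c\<close>. (For a negative
  argument \<open>sqrt\<close> is negative, so that the condition also forces \<open>c\<^sup>2 > 0\<close>.)\<close>

definition elliptic_at :: "real \<Rightarrow> real \<Rightarrow> (plane \<Rightarrow> real) \<Rightarrow> plane \<Rightarrow> bool" where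
  "elliptic_at \<gamma> \<rho>0 \<phi> p \<longleftrightarrow> norm (grad \<phi> p) < sqrt (sound_sq_of \<gamma> \<rho>0 \<phi> p)"

text \<open>The \<open>C\<^sup>1\<close> curve is given near its point \<open>p\<close> as the zero set of a \<open>C\<^sup>1\<close> function \<open>g\<close> with
  nonvanishing gradient, the gradient being the normal direction. The condition is imposed wherever
  \<open>D\<phi>\<close> has limits \<open>V\<close> and \<open>W\<close> from the two sides.\<close>

definition rankine_hugoniot :: "real \<Rightarrow> real \<Rightarrow> plane set \<Rightarrow> (plane \<Rightarrow> real) \<Rightarrow> bool" where
  "rankine_hugoniot \<gamma> \<rho>0 U \<phi> \<longleftrightarrow>
     (\<forall>N g p V W. open N \<and> N \<subseteq> U \<and> p \<in> N \<and> Ck 1 N g \<and> (\<forall>q\<in>N. grad g q \<noteq> 0) \<and> g p = 0 \<and>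
        (\<forall>q\<in>N. g q \<noteq> 0 \<longrightarrow> \<phi> differentiable (at q)) \<and>
        (grad \<phi> \<longlongrightarrow> V) (at p within {q\<in>N. g q > 0}) \<and>
        (grad \<phi> \<longlongrightarrow> W) (at p within {q\<in>N. g q < 0}) \<longrightarrow>
        (rho \<gamma> \<rho>0 ((norm V)\<^sup>2) (\<phi> p) *\<^sub>R V - rho \<gamma> \<rho>0 ((norm W)\<^sup>2) (\<phi> p) *\<^sub>R W) \<bullet> grad g p = 0)"

text \<open>Weak solutions of \<open>div (\<rho> D\<phi>) + 2 \<rho> = 0\<close>. Lipschitz continuity is required on bounded subsets
  only, since already the quadratic potentials of the constant states are not globally Lipschitz;
  \<open>D\<phi>\<close> then exists almost everywhere. The second condition says that the density is well defined.\<close>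

definition weak_solution :: "real \<Rightarrow> real \<Rightarrow> plane set \<Rightarrow> (plane \<Rightarrow> real) \<Rightarrow> bool" where
  "weak_solution \<gamma> \<rho>0 U \<phi> \<longleftrightarrow>
     (\<forall>R. \<exists>L. L-lipschitz_on (U \<inter> ball 0 R) \<phi>) \<and>
     negligible {p\<in>U. sound_sq_of \<gamma> \<rho>0 \<phi> p < 0} \<and>
     (\<forall>\<zeta>. test_function U \<zeta> \<longrightarrow>
        (\<lambda>p. rho_of \<gamma> \<rho>0 \<phi> p * (grad \<phi> p \<bullet> grad \<zeta> p) - 2 * rho_of \<gamma> \<rho>0 \<phi> p * \<zeta> p)
          absolutely_integrable_on U \<and>
        integral U
          (\<lambda>p. rho_of \<gamma> \<rho>0 \<phi> p * (grad \<phi> p \<bullet> grad \<zeta> p) - 2 * rho_of \<gamma> \<rho>0 \<phi> p * \<zeta> p) = 0) \<and>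
     rankine_hugoniot \<gamma> \<rho>0 U \<phi>"

section \<open>The shock reflection problem\<close>

definition xi0 :: "real \<Rightarrow> real \<Rightarrow> real \<Rightarrow> real" where
  "xi0 \<gamma> \<rho>0 \<rho>1 =
     \<rho>1 * sqrt (2 * (\<rho>1 powr (\<gamma> - 1) - \<rho>0 powr (\<gamma> - 1)) / ((\<gamma> - 1) * (\<rho>1\<^sup>2 - \<rho>0\<^sup>2)))"

text \<open>Below, \<open>x0\<close> is the position of the incident shock, to be instantiated by \<open>xi0\<close>, and \<open>\<theta>\<close> is
  the wedge angle.\<close>

definition phi0 :: "plane \<Rightarrow> real" where
  "phi0 p = - ((fst p)\<^sup>2 + (snd p)\<^sup>2) / 2"

definition phi1 :: "real \<Rightarrow> real \<Rightarrow> plane \<Rightarrow> real" where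
  "phi1 u1 x0 p = - ((fst p)\<^sup>2 + (snd p)\<^sup>2) / 2 + u1 * (fst p - x0)"

definition phi2 :: "real \<Rightarrow> real \<Rightarrow> real \<Rightarrow> plane \<Rightarrow> real" where
  "phi2 u2 x0 \<theta> p =
     - ((fst p)\<^sup>2 + (snd p)\<^sup>2) / 2 + u2 * (fst p - x0) + (snd p - x0 * tan \<theta>) * u2 * tan \<theta>"

text \<open>The upper half-plane outside the half-wedge, as a connected open set; it contains the positive
  \<open>\<eta>\<close>-axis. For \<open>\<xi> < 0\<close> the first condition implies the second one, for \<open>\<xi> > 0\<close> conversely.\<close>

definition Lam :: "real \<Rightarrow> plane set" where
  "Lam \<theta> = {p. snd p > 0 \<and> snd p > fst p * tan \<theta>}"

definition wall_normal :: "real \<Rightarrow> plane \<Rightarrow> plane" where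
  "wall_normal \<theta> p = (if fst p < 0 then (0, 1) else (- sin \<theta>, cos \<theta>))"

text \<open>\<open>D\<phi> \<cdot> \<nu> = 0\<close> at the boundary points other than the vertex, where there is no normal. As \<open>\<phi>\<close>
  lives on the open set \<open>Lam \<theta>\<close> and is only Lipschitz in general, \<open>D\<phi>\<close> at a boundary point is its
  limit from within; there is no such limit at the points where a shock meets the boundary.\<close>

definition slip_condition :: "real \<Rightarrow> (plane \<Rightarrow> real) \<Rightarrow> bool" where
  "slip_condition \<theta> \<phi> \<longleftrightarrow>
     (\<forall>p\<in>frontier (Lam \<theta>) - {0}. \<forall>V.
        eventually (\<lambda>q. \<phi> differentiable (at q)) (at p within Lam \<theta>) \<and>
        (grad \<phi> \<longlongrightarrow> V) (at p within Lam \<theta>) \<longrightarrow> V \<bullet> wall_normal \<theta> p = 0)"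

definition phi_bar :: "real \<Rightarrow> real \<Rightarrow> plane \<Rightarrow> real" where
  "phi_bar u1 x0 p = (if fst p > x0 then phi0 p else phi1 u1 x0 p)"

definition problem2_solution ::
    "real \<Rightarrow> real \<Rightarrow> real \<Rightarrow> real \<Rightarrow> real \<Rightarrow> (plane \<Rightarrow> real) \<Rightarrow> bool" where
  "problem2_solution \<gamma> \<rho>0 \<rho>1 u1 \<theta> \<phi> \<longleftrightarrow>
     weak_solution \<gamma> \<rho>0 (Lam \<theta>) \<phi> \<and>
     slip_condition \<theta> \<phi> \<and>
     (\<forall>\<epsilon>>0. \<forall>\<^sub>F R in at_top. \<forall>p\<in>Lam \<theta> - ball 0 R.
        \<bar>\<phi> p - phi_bar u1 (xi0 \<gamma> \<rho>0 \<rho>1) p\<bar> \<le> \<epsilon>)"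

section \<open>State (2) and the geometry of regular reflection\<close>

lemma has_derivative_phi2:
  "(phi2 u2 x0 \<theta> has_derivative
     (\<lambda>h. (u2 - fst p) * fst h + (u2 * tan \<theta> - snd p) * snd h)) (at p)"
  unfolding phi2_def
  by (auto intro!: derivative_eq_intros simp: field_simps fun_eq_iff)

lemma grad_phi2: "grad (phi2 u2 x0 \<theta>) p = (u2 - fst p, u2 * tan \<theta> - snd p)"
  unfolding grad_def Dxi_def Deta_def
    frechet_derivative_at[OF has_derivative_phi2, symmetric]
  by simp

lemma sound_sq_of_phi2_const:
  "sound_sq_of \<gamma> \<rho>0 (phi2 u2 x0 \<theta>) p = sound_sq_of \<gamma> \<rho>0 (phi2 u2 x0 \<theta>) q"
  unfolding sound_sq_of_def sound_sq_def grad_phi2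
  by (simp add: phi2_def norm_Pair) (simp add: field_simps power2_eq_square)

text \<open>The density of state (2) is constant, hence may be evaluated at the origin.\<close>

definition rho2 :: "real \<Rightarrow> real \<Rightarrow> real \<Rightarrow> real \<Rightarrow> real \<Rightarrow> real" where
  "rho2 \<gamma> \<rho>0 x0 \<theta> u2 = rho_of \<gamma> \<rho>0 (phi2 u2 x0 \<theta>) 0"

lemma rho_of_phi2: "rho_of \<gamma> \<rho>0 (phi2 u2 x0 \<theta>) p = rho2 \<gamma> \<rho>0 x0 \<theta> u2"
  using sound_sq_of_phi2_const[of \<gamma> \<rho>0 u2 x0 \<theta> p 0]
  unfolding rho2_def rho_of_def rho_def sound_sq_of_def by simp

definition c2 :: "real \<Rightarrow> real \<Rightarrow> real \<Rightarrow> real \<Rightarrow> real \<Rightarrow> real" where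
  "c2 \<gamma> \<rho>0 x0 \<theta> u2 = rho2 \<gamma> \<rho>0 x0 \<theta> u2 powr ((\<gamma> - 1) / 2)"

definition sonic_center :: "real \<Rightarrow> real \<Rightarrow> plane" where
  "sonic_center \<theta> u2 = (u2, u2 * tan \<theta>)"

definition P0 :: "real \<Rightarrow> real \<Rightarrow> plane" where
  "P0 x0 \<theta> = (x0, x0 * tan \<theta>)"

definition P3 :: plane where
  "P3 = (0, 0)"

text \<open>The center of the sonic circle lies on the wedge boundary, so the circle meets the line
  carrying it in two opposite points. \<open>P4\<close> is the one facing \<open>P0\<close>.\<close>

definition P4 :: "real \<Rightarrow> real \<Rightarrow> real \<Rightarrow> real \<Rightarrow> real \<Rightarrow> plane" where
  "P4 \<gamma> \<rho>0 x0 \<theta> u2 = sonic_center \<theta> u2 + c2 \<gamma> \<rho>0 x0 \<theta> u2 *\<^sub>R (cos \<theta>, sin \<theta>)"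

definition S1 :: "real \<Rightarrow> real \<Rightarrow> real \<Rightarrow> real \<Rightarrow> plane set" where
  "S1 x0 \<theta> u1 u2 = {p. phi1 u1 x0 p = phi2 u2 x0 \<theta> p}"

text \<open>The shorter arc between the points \<open>a\<close> and \<open>b\<close> of a circle: the part of the circle in the cone
  spanned by \<open>a\<close> and \<open>b\<close> at the center. As \<open>P1\<close> lies strictly above the wedge, the arc \<open>P1P4\<close> inside
  \<open>Lam \<theta>\<close> is the shorter one.\<close>

definition circle_arc :: "plane \<Rightarrow> real \<Rightarrow> plane \<Rightarrow> plane \<Rightarrow> plane set" where
  "circle_arc z r a b =
     {p \<in> sphere z r. \<exists>s\<ge>0. \<exists>t\<ge>0. p = z + s *\<^sub>R (a - z) + t *\<^sub>R (b - z)}"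

definition sonic_arc ::
    "real \<Rightarrow> real \<Rightarrow> real \<Rightarrow> real \<Rightarrow> real \<Rightarrow> plane \<Rightarrow> plane set" where
  "sonic_arc \<gamma> \<rho>0 x0 \<theta> u2 P1 =
     circle_arc (sonic_center \<theta> u2) (c2 \<gamma> \<rho>0 x0 \<theta> u2) P1 (P4 \<gamma> \<rho>0 x0 \<theta> u2)"

definition sonic_arc_interior ::
    "real \<Rightarrow> real \<Rightarrow> real \<Rightarrow> real \<Rightarrow> real \<Rightarrow> plane \<Rightarrow> plane set" where
  "sonic_arc_interior \<gamma> \<rho>0 x0 \<theta> u2 P1 =
     sonic_arc \<gamma> \<rho>0 x0 \<theta> u2 P1 - {P1, P4 \<gamma> \<rho>0 x0 \<theta> u2}"

text \<open>Condition (a). The vector \<open>D\<phi>\<^sub>1 - D\<phi>\<^sub>2\<close> is normal to the line \<open>S1\<close>; it does not vanish because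
  \<open>u2 tan \<theta> > 0\<close>. Positivity of \<open>sound_sq_of\<close> states that \<open>rho2\<close> is a power with positive base.\<close>

definition state2_admissible ::
    "real \<Rightarrow> real \<Rightarrow> real \<Rightarrow> real \<Rightarrow> real \<Rightarrow> real \<Rightarrow> real \<Rightarrow> plane \<Rightarrow> bool" where
  "state2_admissible \<gamma> \<rho>0 \<rho>1 u1 x0 \<theta> u2 P1 \<longleftrightarrow>
     u2 > 0 \<and>
     (\<forall>p. sound_sq_of \<gamma> \<rho>0 (phi2 u2 x0 \<theta>) p > 0) \<and>
     rho2 \<gamma> \<rho>0 x0 \<theta> u2 > \<rho>1 \<and>
     (\<forall>p\<in>S1 x0 \<theta> u1 u2.
        (\<rho>1 *\<^sub>R grad (phi1 u1 x0) p - rho2 \<gamma> \<rho>0 x0 \<theta> u2 *\<^sub>R grad (phi2 u2 x0 \<theta>) p)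
          \<bullet> (grad (phi1 u1 x0) p - grad (phi2 u2 x0 \<theta>) p) = 0) \<and>
     P0 x0 \<theta> \<in> S1 x0 \<theta> u1 u2 \<and> P1 \<in> S1 x0 \<theta> u1 u2 \<and>
     P1 \<in> Lam \<theta> \<and>
     P1 \<in> sphere (sonic_center \<theta> u2) (c2 \<gamma> \<rho>0 x0 \<theta> u2) \<and>
     (\<forall>p\<in>closed_segment (P0 x0 \<theta>) P1 - {P1}.
        norm (grad (phi2 u2 x0 \<theta>) p) > c2 \<gamma> \<rho>0 x0 \<theta> u2)"

text \<open>The path \<open>\<sigma>\<close> parametrizes the curve \<open>P1P2\<close>. The last two conditions say that the reflected shock
  \<open>P0P1P2\<close> and the closed curve bounding \<open>\<Omega>\<close> do not intersect themselves; all other intersections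
  are excluded by the remaining conditions.\<close>

definition shock_curve ::
    "real \<Rightarrow> real \<Rightarrow> real \<Rightarrow> real \<Rightarrow> real \<Rightarrow> plane \<Rightarrow> (real \<Rightarrow> plane) \<Rightarrow> bool" where
  "shock_curve \<gamma> \<rho>0 x0 \<theta> u2 P1 \<sigma> \<longleftrightarrow>
     arc \<sigma> \<and>
     \<sigma> C1_differentiable_on {0<..<1} \<and>
     (\<forall>t\<in>{0<..<1}. vector_derivative \<sigma> (at t) \<noteq> 0) \<and>
     pathstart \<sigma> = P1 \<and>
     fst (pathfinish \<sigma>) < 0 \<and> snd (pathfinish \<sigma>) = 0 \<and>
     (\<forall>t\<in>{0..<1}. \<sigma> t \<in> Lam \<theta>) \<and>
     path_image \<sigma> \<inter> closed_segment (P0 x0 \<theta>) P1 = {P1} \<and>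
     path_image \<sigma> \<inter> sonic_arc \<gamma> \<rho>0 x0 \<theta> u2 P1 = {P1}"

text \<open>The set \<open>Omega\<close> is the domain \<open>P1P2P3P4\<close>, and \<open>region2\<close> is the region \<open>P0P1P4\<close>.\<close>

definition Omega ::
    "real \<Rightarrow> real \<Rightarrow> real \<Rightarrow> real \<Rightarrow> real \<Rightarrow> plane \<Rightarrow> (real \<Rightarrow> plane) \<Rightarrow> plane set" where
  "Omega \<gamma> \<rho>0 x0 \<theta> u2 P1 \<sigma> =
     inside (path_image \<sigma> \<union> closed_segment (pathfinish \<sigma>) P3 \<union>
             closed_segment P3 (P4 \<gamma> \<rho>0 x0 \<theta> u2) \<union> sonic_arc \<gamma> \<rho>0 x0 \<theta> u2 P1)"

definition region2 ::
    "real \<Rightarrow> real \<Rightarrow> real \<Rightarrow> real \<Rightarrow> real \<Rightarrow> plane \<Rightarrow> plane set" where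
  "region2 \<gamma> \<rho>0 x0 \<theta> u2 P1 =
     inside (closed_segment (P0 x0 \<theta>) P1 \<union> closed_segment (P0 x0 \<theta>) (P4 \<gamma> \<rho>0 x0 \<theta> u2) \<union>
             sonic_arc \<gamma> \<rho>0 x0 \<theta> u2 P1)"

text \<open>Together with the reflected shock, \<open>Omega\<close> and \<open>region2\<close> (and the sonic arc between them) fill
  the part of \<open>Lam \<theta>\<close> on and below the reflected shock; what is left of \<open>Lam \<theta>\<close> is above it.\<close>

definition above_reflected_shock ::
    "real \<Rightarrow> real \<Rightarrow> real \<Rightarrow> real \<Rightarrow> real \<Rightarrow> plane \<Rightarrow> (real \<Rightarrow> plane) \<Rightarrow> plane set" where
  "above_reflected_shock \<gamma> \<rho>0 x0 \<theta> u2 P1 \<sigma> =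
     Lam \<theta> - closure (Omega \<gamma> \<rho>0 x0 \<theta> u2 P1 \<sigma>) - closure (region2 \<gamma> \<rho>0 x0 \<theta> u2 P1)"

text \<open>In the last condition the endpoint \<open>P2\<close> of the shock is left out only because it lies on the
  boundary of the domain \<open>Lam \<theta>\<close> of \<open>\<phi>\<close>.\<close>

definition regular_reflection_solution ::
    "real \<Rightarrow> real \<Rightarrow> real \<Rightarrow> real \<Rightarrow> real \<Rightarrow> real \<Rightarrow> plane \<Rightarrow> (real \<Rightarrow> plane) \<Rightarrow>
     (plane \<Rightarrow> real) \<Rightarrow> bool" where
  "regular_reflection_solution \<gamma> \<rho>0 \<rho>1 u1 \<theta> u2 P1 \<sigma> \<phi> \<longleftrightarrow>
     (let x0 = xi0 \<gamma> \<rho>0 \<rho>1;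
          \<Lambda> = Lam \<theta>;
          \<Omega> = Omega \<gamma> \<rho>0 x0 \<theta> u2 P1 \<sigma>
      in problem2_solution \<gamma> \<rho>0 \<rho>1 u1 \<theta> \<phi> \<and>
         state2_admissible \<gamma> \<rho>0 \<rho>1 u1 x0 \<theta> u2 P1 \<and>
         shock_curve \<gamma> \<rho>0 x0 \<theta> u2 P1 \<sigma> \<and>
         smooth_in \<Omega> \<phi> \<and>
         (\<exists>\<alpha>\<in>{0<..<1}. C1_holder_up_to_boundary \<alpha> \<Omega> \<phi>) \<and>
         (\<forall>p\<in>\<Lambda>. fst p > x0 \<longrightarrow> \<phi> p = phi0 p) \<and>
         (\<forall>p\<in>above_reflected_shock \<gamma> \<rho>0 x0 \<theta> u2 P1 \<sigma>. fst p < x0 \<longrightarrow> \<phi> p = phi1 u1 x0 p) \<and>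
         (\<forall>p\<in>region2 \<gamma> \<rho>0 x0 \<theta> u2 P1. \<phi> p = phi2 u2 x0 \<theta> p) \<and>
         (\<forall>p\<in>\<Omega>. elliptic_at \<gamma> \<rho>0 \<phi> p) \<and>
         (\<forall>p\<in>path_image \<sigma> \<inter> \<Lambda>. \<phi> p \<ge> phi2 u2 x0 \<theta> p))"

definition C2_across :: "plane set \<Rightarrow> plane set \<Rightarrow> (plane \<Rightarrow> real) \<Rightarrow> bool" where
  "C2_across \<Lambda> A f \<longleftrightarrow> (\<exists>U. open U \<and> A \<subseteq> U \<and> U \<subseteq> \<Lambda> \<and> Ck 2 U f)"

end

theory Submission
  imports Defs
begin

text \<open>Let \<open>\<psi> = \<phi> - \<phi>\<^sub>2\<close>. Inside \<open>\<Omega>\<close> the equation reads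
  \<open>c\<^sup>2 \<Delta>\<phi> - D\<^sup>2\<phi>(D\<phi>, D\<phi>) + 2 c\<^sup>2 - |D\<phi>|\<^sup>2 = 0\<close> (\<open>flow_equation\<close>). Since \<open>D\<^sup>2\<phi>\<^sub>2 = - I\<close>, it becomes
  \<open>c\<^sup>2 \<Delta>\<psi> - D\<^sup>2\<psi>(D\<phi>, D\<phi>) = 0\<close>: an elliptic equation for \<open>\<psi>\<close> without terms of lower order, whose
  ellipticity is lost on the sonic circle, in the radial direction.

  The proof has a global and a local part, which contradict each other.

  Globally, \<open>\<psi> > 0\<close> in \<open>\<Omega>\<close> (\<open>psi_nonneg\<close>, \<open>psi_pos\<close>). The function \<open>\<psi>\<close> vanishes on the sonic arc
  and is nonnegative on the shock. On the wedge its normal derivative vanishes, and on the axis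
  \<open>\<eta> = 0\<close> it decreases into \<open>\<Omega>\<close>, because there \<open>D\<phi>\<close> is tangential while \<open>D\<phi>\<^sub>2\<close> has the normal component
  \<open>u2 tan \<theta> > 0\<close>. Hence the weak minimum
  principle gives \<open>\<psi> \<ge> 0\<close>. By the strong one \<open>\<psi>\<close> is positive unless it vanishes identically, and
  this is excluded by the condition on the axis.

  Locally, let \<open>s = c\<^sub>2\<^sup>2 - |P|\<^sup>2\<close> with \<open>P\<close> the position relative to the sonic center, so that \<open>s\<close> is
  comparable to the distance to the sonic circle. If \<open>\<phi>\<close> were \<open>C\<^sup>2\<close> across the arc, then \<open>\<psi>\<close>,
  \<open>D\<psi>\<close> and \<open>D\<^sup>2\<psi>\<close> would vanish on it, since they vanish on the side of state (2); integrating along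
  radii, \<open>D\<psi> = o(s)\<close> and \<open>\<psi> = o(s\<^sup>2)\<close> near the arc (\<open>psi_flat\<close>). Therefore the coefficients of the
  equation agree with those of state (2) up to \<open>o(s)\<close>. With these coefficients, near a point \<open>p\<close> of
  the arc with unit tangent \<open>e\<close>, the function \<open>w = s (s - (P \<bullet> e)\<^sup>2)\<close> is a strict subsolution
  (\<open>sonic_barrier_positive\<close>): the term \<open>s\<^sup>2\<close> contributes \<open>4 c\<^sub>2\<^sup>2 s\<close>, of which the localizing term
  \<open>s (P \<bullet> e)\<^sup>2\<close> takes at most half to leading order. As \<open>w\<close> vanishes on the boundary of the lens
  \<open>(P \<bullet> e)\<^sup>2 \<le> s\<close>, which touches the arc only at \<open>p\<close>, comparison yields \<open>\<psi> \<ge> \<epsilon> w\<close> in the lens for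
  some \<open>\<epsilon> > 0\<close> (\<open>barrier_comparison\<close>). On the radius through \<open>p\<close> this says \<open>\<psi> \<ge> \<epsilon> s\<^sup>2\<close>,
  contrary to \<open>\<psi> = o(s\<^sup>2)\<close>.

  The topological input is that near an interior point of the arc the inner side of the sonic circle
  belongs to \<open>\<Omega>\<close> and the outer side to the region of state (2) (\<open>near_Arc_int\<close>). It follows from the
  Jordan curve theorem, once the curved triangle \<open>P\<^sub>0P\<^sub>1P\<^sub>4\<close> is joined to infinity through \<open>P\<^sub>0\<close> outside
  the curve that bounds \<open>\<Omega>\<close> (\<open>Tri_outside\<close>).\<close>

section \<open>Second derivatives along lines, and comparison\<close>

lemma Dxi_eqI: "(f has_derivative f') (at p) \<Longrightarrow> Dxi f p = f' (1, 0)"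
  unfolding Dxi_def by (metis frechet_derivative_at)

lemma Deta_eqI: "(f has_derivative f') (at p) \<Longrightarrow> Deta f p = f' (0, 1)"
  unfolding Deta_def by (metis frechet_derivative_at)

lemma has_derivative_Dxi_Deta:
  assumes "f differentiable (at p)"
  shows "(f has_derivative (\<lambda>h. Dxi f p * fst h + Deta f p * snd h)) (at p)"
proof -
  have D: "(f has_derivative frechet_derivative f (at p)) (at p)"
    using assms frechet_derivative_works by blast
  then interpret D: bounded_linear "frechet_derivative f (at p)"
    by (rule has_derivative_bounded_linear)
  have "frechet_derivative f (at p) h = Dxi f p * fst h + Deta f p * snd h" for h :: plane
  proof -
    have "h = fst h *\<^sub>R (1, 0) + snd h *\<^sub>R (0, 1)" by (cases h) simp
    then have "frechet_derivative f (at p) h =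
        fst h *\<^sub>R frechet_derivative f (at p) (1, 0) + snd h *\<^sub>R frechet_derivative f (at p) (0, 1)"
      by (metis D.add D.scaleR)
    then show ?thesis by (simp add: Dxi_def Deta_def mult.commute)
  qed
  then have "frechet_derivative f (at p) = (\<lambda>h. Dxi f p * fst h + Deta f p * snd h)" ..
  with D show ?thesis by simp
qed

lemma has_derivative_grad:
  assumes "f differentiable (at p)"
  shows "(f has_derivative (\<lambda>h. grad f p \<bullet> h)) (at p)"
  using has_derivative_Dxi_Deta[OF assms] by (simp add: grad_def inner_prod_def)

lemma Ck_1D:
  assumes "Ck 1 U f"
  shows "\<And>p. p \<in> U \<Longrightarrow> f differentiable (at p)" "continuous_on U f"
    "continuous_on U (Dxi f)" "continuous_on U (Deta f)"
proof -
  have "Ck (Suc 0) U f" using assms by simp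
  then show d: "\<And>p. p \<in> U \<Longrightarrow> f differentiable (at p)" and "continuous_on U (Dxi f)" "continuous_on U (Deta f)"
    by (simp_all only: Ck.simps)
  show "continuous_on U f"
    by (intro continuous_at_imp_continuous_on ballI differentiable_imp_continuous_within d)
qed

lemma Ck_2D:
  assumes "Ck 2 U f"
  shows "Ck 1 U f" "Ck 1 U (Dxi f)" "Ck 1 U (Deta f)"
proof -
  have "Ck (Suc (Suc 0)) U f" using assms by (simp add: numeral_2_eq_2)
  then have *: "\<And>p. p \<in> U \<Longrightarrow> f differentiable (at p)" "Ck (Suc 0) U (Dxi f)" "Ck (Suc 0) U (Deta f)"
    by auto
  then show 1: "Ck 1 U (Dxi f)" "Ck 1 U (Deta f)" by simp_all
  show "Ck 1 U f" using *(1) Ck_1D(2)[OF 1(1)] Ck_1D(2)[OF 1(2)] by simp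
qed

lemma continuous_on_grad: "Ck 1 U f \<Longrightarrow> continuous_on U (grad f)"
  unfolding grad_def by (intro continuous_on_Pair Ck_1D)

lemma has_real_derivative_along_line:
  assumes "f differentiable (at (p + t *\<^sub>R h))"
  shows "((\<lambda>t. f (p + t *\<^sub>R h)) has_real_derivative grad f (p + t *\<^sub>R h) \<bullet> h) (at t)"
proof -
  have "((\<lambda>t. p + t *\<^sub>R h) has_derivative (\<lambda>s. s *\<^sub>R h)) (at t)"
    by (auto intro!: derivative_eq_intros)
  then have "((\<lambda>t. f (p + t *\<^sub>R h)) has_derivative (\<lambda>s. grad f (p + t *\<^sub>R h) \<bullet> (s *\<^sub>R h))) (at t)"
    using has_derivative_grad[OF assms] by (rule has_derivative_compose)
  then show ?thesis
    by (simp add: has_field_derivative_def mult_commute_abs)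
qed

text \<open>The second derivative of \<open>f\<close> at \<open>p\<close> in direction \<open>h\<close>; the mixed derivatives enter through
  their sum.\<close>
definition hess :: "(plane \<Rightarrow> real) \<Rightarrow> plane \<Rightarrow> plane \<Rightarrow> real" where
  "hess f p h = Dxi (Dxi f) p * (fst h)\<^sup>2 + (Deta (Dxi f) p + Dxi (Deta f) p) * (fst h * snd h)
     + Deta (Deta f) p * (snd h)\<^sup>2"

definition quadratic_form :: "(plane \<Rightarrow> real) \<Rightarrow> bool" where
  "quadratic_form Q \<longleftrightarrow> (\<exists>a b d. \<forall>h. Q h = a * (fst h)\<^sup>2 + b * (fst h * snd h) + d * (snd h)\<^sup>2)"

text \<open>The number \<open>l\<close> is the second derivative of \<open>f\<close> at \<open>p\<close> along the line of direction \<open>h\<close>. For explicit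
  functions of \<open>|p - z|\<^sup>2\<close> and \<open>p \<bullet> e\<close> this is a computation with polynomials in one variable, while
  iterated partial derivatives would refer to a frame that the geometry does not single out.\<close>
definition second_along :: "(plane \<Rightarrow> real) \<Rightarrow> plane \<Rightarrow> plane \<Rightarrow> real \<Rightarrow> bool" where
  "second_along f p h l \<longleftrightarrow> (\<exists>g. (\<forall>\<^sub>F t in nhds 0. ((\<lambda>t. f (p + t *\<^sub>R h)) has_real_derivative g t) (at t)) \<and>
     (g has_real_derivative l) (at 0))"

lemma quadratic_form_hess: "quadratic_form (hess f p)"
  unfolding quadratic_form_def hess_def by blast

lemma quadratic_form_diff:
  assumes "quadratic_form Q" "quadratic_form R"
  shows "quadratic_form (\<lambda>h. Q h - e * R h)"
proof -
  from assms obtain a b d a' b' d' where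
    "\<And>h. Q h = a * (fst h)\<^sup>2 + b * (fst h * snd h) + d * (snd h)\<^sup>2"
    "\<And>h. R h = a' * (fst h)\<^sup>2 + b' * (fst h * snd h) + d' * (snd h)\<^sup>2"
    unfolding quadratic_form_def by auto
  then have "\<forall>h. Q h - e * R h = (a - e * a') * (fst h)\<^sup>2 + (b - e * b') * (fst h * snd h) + (d - e * d') * (snd h)\<^sup>2"
    by (simp add: algebra_simps)
  then show ?thesis unfolding quadratic_form_def by blast
qed

lemma second_along_hess:
  assumes U: "open U" "p \<in> U" and C: "Ck 2 U f"
  shows "second_along f p h (hess f p h)"
  unfolding second_along_def
proof (intro exI conjI)
  let ?g = "\<lambda>t. Dxi f (p + t *\<^sub>R h) * fst h + Deta f (p + t *\<^sub>R h) * snd h"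
  have "continuous (at 0) (\<lambda>t::real. p + t *\<^sub>R h)" by (intro continuous_intros)
  then have "((\<lambda>t::real. p + t *\<^sub>R h) \<longlongrightarrow> p) (nhds 0)"
    by (simp add: isCont_def tendsto_nhds_iff)
  then have "\<forall>\<^sub>F t::real in nhds 0. p + t *\<^sub>R h \<in> U"
    using U topological_tendstoD by blast
  then show "\<forall>\<^sub>F t in nhds 0. ((\<lambda>t. f (p + t *\<^sub>R h)) has_real_derivative ?g t) (at t)"
  proof eventually_elim
    case (elim t)
    show ?case
      using has_real_derivative_along_line[OF Ck_1D(1)[OF Ck_2D(1)[OF C] elim]]
      by (simp add: grad_def inner_prod_def)
  qed
  have 1: "Dxi f differentiable (at (p + 0 *\<^sub>R h))" "Deta f differentiable (at (p + 0 *\<^sub>R h))"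
    using Ck_1D(1)[OF Ck_2D(2)[OF C] U(2)] Ck_1D(1)[OF Ck_2D(3)[OF C] U(2)] by simp_all
  show "(?g has_real_derivative hess f p h) (at 0)"
    using has_real_derivative_along_line[OF 1(1)] has_real_derivative_along_line[OF 1(2)]
    by (auto intro!: derivative_eq_intros simp: grad_def inner_prod_def hess_def algebra_simps power2_eq_square)
qed

lemma second_along_diff:
  assumes "second_along f p h l" "second_along w p h m"
  shows "second_along (\<lambda>q. f q - e * w q) p h (l - e * m)"
proof -
  from assms obtain g k where
    g: "\<forall>\<^sub>F t in nhds 0. ((\<lambda>t. f (p + t *\<^sub>R h)) has_real_derivative g t) (at t)" "(g has_real_derivative l) (at 0)" and
    k: "\<forall>\<^sub>F t in nhds 0. ((\<lambda>t. w (p + t *\<^sub>R h)) has_real_derivative k t) (at t)" "(k has_real_derivative m) (at 0)"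
    unfolding second_along_def by blast
  have "\<forall>\<^sub>F t in nhds 0. ((\<lambda>t. f (p + t *\<^sub>R h) - e * w (p + t *\<^sub>R h)) has_real_derivative g t - e * k t) (at t)"
    using g(1) k(1) by eventually_elim (auto intro!: derivative_eq_intros)
  moreover have "((\<lambda>t. g t - e * k t) has_real_derivative l - e * m) (at 0)"
    using g(2) k(2) by (auto intro!: derivative_eq_intros)
  ultimately show ?thesis unfolding second_along_def by (intro exI conjI)
qed

text \<open>A negative second derivative would make the first derivative, which vanishes at the minimum, negative
  just to the right of it.\<close>
lemma second_along_local_min:
  assumes S: "second_along f p h l" and m: "\<forall>\<^sub>F q in nhds p. f p \<le> f q"
  shows "0 \<le> l"
proof (rule ccontr)
  assume "\<not> 0 \<le> l"
  then have l: "l < 0" by simp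
  let ?F = "\<lambda>t. f (p + t *\<^sub>R h)"
  from S obtain g where
    g: "\<forall>\<^sub>F t in nhds 0. (?F has_real_derivative g t) (at t)" and g2: "(g has_real_derivative l) (at 0)"
    unfolding second_along_def by blast
  have "continuous (at 0) (\<lambda>t::real. p + t *\<^sub>R h)" by (intro continuous_intros)
  then have "((\<lambda>t::real. p + t *\<^sub>R h) \<longlongrightarrow> p) (nhds 0)"
    by (simp add: isCont_def tendsto_nhds_iff)
  from eventually_compose_filterlim[OF m this] have m': "\<forall>\<^sub>F t in nhds 0. f p \<le> ?F t" .
  from eventually_conj[OF g m'] obtain d where d: "d > 0"
    "\<And>t. \<bar>t\<bar> < d \<Longrightarrow> (?F has_real_derivative g t) (at t)" "\<And>t. \<bar>t\<bar> < d \<Longrightarrow> f p \<le> ?F t"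
    unfolding eventually_nhds_metric by (auto simp: dist_real_def)
  have "g 0 = 0"
    by (rule DERIV_local_min[OF d(2)[of 0] d(1)]) (use d in auto)
  obtain e where e: "e > 0" "\<And>t. 0 < t \<Longrightarrow> t < e \<Longrightarrow> g t < g 0"
    using DERIV_neg_dec_right[OF g2 l] by auto
  define t where "t = min d e / 2"
  have t: "0 < t" "t < d" "t < e" using d e by (auto simp: t_def)
  obtain x where x: "0 < x" "x < t" "?F t - ?F 0 = (t - 0) * g x"
    using MVT2[of 0 t ?F g] t d(2) by force
  have "g x < 0" using e(2)[of x] x t \<open>g 0 = 0\<close> by auto
  then have "?F t < ?F 0" using x t mult_pos_neg[of t "g x"] by auto
  moreover have "?F 0 \<le> ?F t" using d(3)[of t] t by simp
  ultimately show False by simp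
qed

text \<open>The trace of the product of the matrix \<open>K I - v v\<^sup>T\<close> with the Hessian whose quadratic form is \<open>Q\<close>. For
  \<open>K = c\<^sup>2\<close> and \<open>v = D\<phi>\<close> it is the principal part of the potential flow equation, and
  \<open>|v|\<^sup>2 \<le> K\<close> says that the matrix is positive semidefinite.\<close>
definition flow_op :: "real \<Rightarrow> plane \<Rightarrow> (plane \<Rightarrow> real) \<Rightarrow> real" where
  "flow_op K v Q = K * (Q (1, 0) + Q (0, 1)) - Q v"

lemma norm_plane_sq: "(norm (v :: plane))\<^sup>2 = (fst v)\<^sup>2 + (snd v)\<^sup>2"
  unfolding power2_norm_eq_inner by (simp add: inner_prod_def power2_eq_square)

text \<open>Let \<open>v'\<close> be \<open>v\<close> rotated by a right angle. The trace of \<open>Q\<close> is the same in every orthogonal frame, so that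
  \<open>Q v \<le> Q v + Q v' = |v|\<^sup>2 tr Q \<le> K tr Q\<close>.\<close>
lemma flow_op_nonneg:
  assumes "quadratic_form Q" "\<And>h. 0 \<le> Q h" "(norm v)\<^sup>2 \<le> K"
  shows "0 \<le> flow_op K v Q"
proof -
  obtain a b d where Q: "\<And>h. Q h = a * (fst h)\<^sup>2 + b * (fst h * snd h) + d * (snd h)\<^sup>2"
    using assms(1) unfolding quadratic_form_def by auto
  have "Q v + Q (- snd v, fst v) = (norm v)\<^sup>2 * (Q (1, 0) + Q (0, 1))"
    unfolding norm_plane_sq by (simp add: Q algebra_simps power2_eq_square)
  moreover have "(norm v)\<^sup>2 * (Q (1, 0) + Q (0, 1)) \<le> K * (Q (1, 0) + Q (0, 1))"
    by (intro mult_right_mono assms add_nonneg_nonneg)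
  moreover have "0 \<le> Q (- snd v, fst v)" by (rule assms)
  ultimately show ?thesis unfolding flow_op_def by linarith
qed

lemma flow_op_diff: "flow_op K v (\<lambda>h. Q h - e * R h) = flow_op K v Q - e * flow_op K v R"
  by (simp add: flow_op_def algebra_simps)

text \<open>At \<open>p\<close> the function \<open>f\<close> is a supersolution and \<open>w\<close> a strict subsolution of one and the same
  (possibly degenerate) elliptic equation. The coefficients \<open>K\<close> and \<open>v\<close> are quantified for each point
  separately: the comparison arguments below only look at one point at a time, so the nonlinear equation
  may be read as a linear one with the coefficients of the given solution.\<close>
definition strictly_sub :: "(plane \<Rightarrow> real) \<Rightarrow> (plane \<Rightarrow> real) \<Rightarrow> plane \<Rightarrow> bool" where
  "strictly_sub f w p \<longleftrightarrow> (\<exists>Q R K v. quadratic_form Q \<and> quadratic_form R \<and>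
     (\<forall>h. second_along f p h (Q h)) \<and> (\<forall>h. second_along w p h (R h)) \<and>
     (norm v)\<^sup>2 \<le> K \<and> flow_op K v Q \<le> 0 \<and> 0 < flow_op K v R)"

lemma strictly_subI:
  assumes "quadratic_form Q" "quadratic_form R"
    and "\<And>h. second_along f p h (Q h)" "\<And>h. second_along w p h (R h)"
    and "(norm v)\<^sup>2 < K" "flow_op K v Q \<le> 0" "0 < flow_op K v R"
  shows "strictly_sub f w p"
  unfolding strictly_sub_def
  by (intro exI[of _ Q] exI[of _ R] exI[of _ K] exI[of _ v] conjI allI assms less_imp_le[OF assms(5)])

text \<open>At a local minimum of \<open>f - e w\<close> its Hessian is positive semidefinite, so the operator does not decrease
  from \<open>e w\<close> to \<open>f\<close>; but it is positive on \<open>w\<close> and nonpositive on \<open>f\<close>.\<close>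
lemma strictly_sub_no_local_min:
  assumes "strictly_sub f w p" and e: "0 < e"
  shows "\<not> (\<forall>\<^sub>F q in nhds p. f p - e * w p \<le> f q - e * w q)"
proof
  assume m: "\<forall>\<^sub>F q in nhds p. f p - e * w p \<le> f q - e * w q"
  obtain Q R K v where 1: "quadratic_form Q" "quadratic_form R" "(norm v)\<^sup>2 \<le> K"
    and 2: "\<And>h. second_along f p h (Q h)" "\<And>h. second_along w p h (R h)"
    and 3: "flow_op K v Q \<le> 0" "0 < flow_op K v R"
    using assms(1) unfolding strictly_sub_def by blast
  have "0 \<le> flow_op K v (\<lambda>h. Q h - e * R h)"
    by (intro flow_op_nonneg quadratic_form_diff 1 second_along_local_min[OF second_along_diff[OF 2] m])
  moreover have "0 < e * flow_op K v R" using 3(2) e by simp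
  ultimately show False using 3(1) unfolding flow_op_diff by linarith
qed

text \<open>Comparison near a point \<open>q\<close> at which \<open>f\<close> may vanish; it serves the Hopf lemma inside the domain and the
  degenerate boundary point on the sonic arc. On the sphere \<open>f\<close> has a positive lower bound, and \<open>e\<close> is chosen
  so small that \<open>e w\<close> does not exceed it. A negative minimum of \<open>f - e w\<close> can then lie neither on the
  sphere, nor where \<open>w \<le> 0\<close>, nor at an interior point of \<open>V\<close> where \<open>w\<close> is a strict subsolution.\<close>
lemma barrier_comparison:
  fixes f w :: "plane \<Rightarrow> real"
  assumes V: "closed V" and cf: "continuous_on (cball q k \<inter> V) f" and cw: "continuous_on (cball q k \<inter> V) w"
    and f0: "\<And>p. p \<in> cball q k \<inter> V \<Longrightarrow> 0 \<le> f p"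
    and fs: "\<And>p. p \<in> sphere q k \<inter> V \<Longrightarrow> 0 < f p"
    and L: "\<And>p. p \<in> ball q k \<inter> V \<Longrightarrow> 0 < w p \<Longrightarrow> p \<in> interior V \<and> strictly_sub f w p"
  obtains e where "e > 0" "\<And>p. p \<in> cball q k \<inter> V \<Longrightarrow> e * w p \<le> f p"
proof (cases "cball q k \<inter> V = {}")
  case True
  then show ?thesis by (intro that[of 1]) auto
next
  case ne: False
  have K: "compact (cball q k \<inter> V)" by (simp add: V compact_Int_closed)
  obtain W where W: "W > 0" "\<And>p. p \<in> cball q k \<inter> V \<Longrightarrow> w p \<le> W"
  proof -
    obtain x where "x \<in> cball q k \<inter> V" "\<forall>p\<in>cball q k \<inter> V. w p \<le> w x"
      using continuous_attains_sup[OF K ne cw] by blast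
    then show ?thesis by (intro that[of "max 1 (w x)"]) (auto simp: le_max_iff_disj)
  qed
  obtain m where m: "m > 0" "\<And>p. p \<in> sphere q k \<inter> V \<Longrightarrow> m \<le> f p"
  proof (cases "sphere q k \<inter> V = {}")
    case True
    then show ?thesis by (intro that[of 1]) auto
  next
    case False
    have "compact (sphere q k \<inter> V)" by (simp add: V compact_Int_closed)
    moreover have "continuous_on (sphere q k \<inter> V) f"
      by (rule continuous_on_subset[OF cf]) auto
    ultimately obtain x where "x \<in> sphere q k \<inter> V" "\<forall>p\<in>sphere q k \<inter> V. f x \<le> f p"
      using continuous_attains_inf[OF _ False] by blast
    then show ?thesis using fs by (intro that[of "f x"]) auto
  qed
  define e where "e = m / W"
  have e: "e > 0" using m W by (simp add: e_def)
  have "continuous_on (cball q k \<inter> V) (\<lambda>p. f p - e * w p)"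
    by (intro continuous_intros cf cw)
  then obtain p where p: "p \<in> cball q k \<inter> V" "\<And>x. x \<in> cball q k \<inter> V \<Longrightarrow> f p - e * w p \<le> f x - e * w x"
    using continuous_attains_inf[OF K ne] by blast
  have "0 \<le> f p - e * w p"
  proof (rule ccontr)
    assume n: "\<not> 0 \<le> f p - e * w p"
    then have "0 < e * w p" using f0[OF p(1)] by linarith
    then have wp: "0 < w p" using e zero_less_mult_pos by blast
    have "p \<notin> sphere q k"
    proof
      assume "p \<in> sphere q k"
      then have "m \<le> f p" using m p by auto
      moreover have "e * w p \<le> e * W" using W p e by (intro mult_left_mono) auto
      moreover have "e * W = m" using W by (simp add: e_def)
      ultimately show False using n by linarith
    qed
    then have pb: "p \<in> ball q k \<inter> V" using p by auto
    have "p \<in> interior V" and sub: "strictly_sub f w p"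
      using L[OF pb wp] by blast+
    have "open (ball q k \<inter> interior V)" "p \<in> ball q k \<inter> interior V"
      using pb \<open>p \<in> interior V\<close> by auto
    moreover have "f p - e * w p \<le> f x - e * w x" if "x \<in> ball q k \<inter> interior V" for x
      using p(2)[of x] that interior_subset by auto
    ultimately have "\<forall>\<^sub>F x in nhds p. f p - e * w p \<le> f x - e * w x"
      unfolding eventually_nhds by blast
    then show False using strictly_sub_no_local_min[OF sub e] by blast
  qed
  then have "e * w x \<le> f x" if "x \<in> cball q k \<inter> V" for x using p(2)[OF that] by linarith
  then show ?thesis using that e by blast
qed

section \<open>From the weak to the nondivergence form of the equation\<close>

text \<open>For \<open>r > 0\<close> a test function in one variable with support \<open>[a - r, a + r]\<close>; the outer square makes it
  \<open>C\<^sup>1\<close>.\<close>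
definition bump :: "real \<Rightarrow> real \<Rightarrow> real \<Rightarrow> real" where
  "bump r a t = (max 0 (r\<^sup>2 - (t - a)\<^sup>2))\<^sup>2"

definition bump' :: "real \<Rightarrow> real \<Rightarrow> real \<Rightarrow> real" where
  "bump' r a t = - 4 * (t - a) * max 0 (r\<^sup>2 - (t - a)\<^sup>2)"

lemma DERIV_max_0_sq: "((\<lambda>u::real. (max 0 u)\<^sup>2) has_real_derivative 2 * max 0 u) (at u)"
proof -
  consider "u > 0" | "u < 0" | "u = 0" by linarith
  then show ?thesis
  proof cases
    case 1
    have "((\<lambda>u::real. u\<^sup>2) has_real_derivative 2 * max 0 u) (at u)"
      using 1 by (auto intro!: derivative_eq_intros)
    then show ?thesis
      by (rule has_field_derivative_transform_within_open[where S = "{0<..}"]) (use 1 in auto)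
  next
    case 2
    have "((\<lambda>u::real. 0) has_real_derivative 2 * max 0 u) (at u)"
      using 2 by (auto intro!: derivative_eq_intros)
    then show ?thesis
      by (rule has_field_derivative_transform_within_open[where S = "{..<0}"]) (use 2 in auto)
  next
    case 3
    have "(\<lambda>h::real. max 0 h) \<midarrow>0\<rightarrow> max 0 0"
      by (intro tendsto_intros)
    moreover have "(\<lambda>h::real. ((max 0 (0 + h))\<^sup>2 - (max 0 0)\<^sup>2) / h) = (\<lambda>h. max 0 h)"
      by (auto simp: fun_eq_iff power2_eq_square max_def)
    ultimately show ?thesis using 3 by (simp add: DERIV_def)
  qed
qed

lemma DERIV_bump: "(bump r a has_real_derivative bump' r a t) (at t)"
proof -
  have "((\<lambda>t. r\<^sup>2 - (t - a)\<^sup>2) has_real_derivative - 2 * (t - a)) (at t)"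
    by (auto intro!: derivative_eq_intros)
  from DERIV_chain2[OF DERIV_max_0_sq this] show ?thesis
    unfolding bump_def[abs_def] bump'_def by (rule DERIV_cong) simp
qed

lemma continuous_on_bump [continuous_intros]:
  "continuous_on S f \<Longrightarrow> continuous_on S (\<lambda>x. bump r a (f x))"
  "continuous_on S f \<Longrightarrow> continuous_on S (\<lambda>x. bump' r a (f x))"
  unfolding bump_def bump'_def by (intro continuous_intros; assumption)+

lemma bump_nonneg: "0 \<le> bump r a t"
  by (simp add: bump_def)

lemma bump_outside: "r \<ge> 0 \<Longrightarrow> \<bar>t - a\<bar> \<ge> r \<Longrightarrow> bump r a t = 0" "r \<ge> 0 \<Longrightarrow> \<bar>t - a\<bar> \<ge> r \<Longrightarrow> bump' r a t = 0"
proof -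
  assume "r \<ge> 0" "\<bar>t - a\<bar> \<ge> r"
  then have "r\<^sup>2 \<le> (t - a)\<^sup>2" using power_mono[of r "\<bar>t - a\<bar>" 2] by simp
  then show "bump r a t = 0" "bump' r a t = 0" by (simp_all add: bump_def bump'_def)
qed

definition bump2 :: "real \<Rightarrow> plane \<Rightarrow> plane \<Rightarrow> real" where
  "bump2 r p q = bump r (fst p) (fst q) * bump r (snd p) (snd q)"

lemma has_derivative_bump2:
  "(bump2 r p has_derivative (\<lambda>h. bump' r (fst p) (fst q) * fst h * bump r (snd p) (snd q)
     + bump r (fst p) (fst q) * (bump' r (snd p) (snd q) * snd h))) (at q)"
proof -
  have 1: "((\<lambda>q::plane. bump r (fst p) (fst q)) has_derivative (\<lambda>h. bump' r (fst p) (fst q) * fst h)) (at q)"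
    by (rule has_derivative_compose[OF _ DERIV_bump[unfolded has_field_derivative_def]])
      (auto intro!: derivative_eq_intros)
  have 2: "((\<lambda>q::plane. bump r (snd p) (snd q)) has_derivative (\<lambda>h. bump' r (snd p) (snd q) * snd h)) (at q)"
    by (rule has_derivative_compose[OF _ DERIV_bump[unfolded has_field_derivative_def]])
      (auto intro!: derivative_eq_intros)
  show ?thesis unfolding bump2_def[abs_def]
    using has_derivative_mult[OF 1 2] by (simp add: add.commute)
qed

lemma Dxi_bump2: "Dxi (bump2 r p) = (\<lambda>q. bump' r (fst p) (fst q) * bump r (snd p) (snd q))"
  by (rule ext) (simp add: Dxi_eqI[OF has_derivative_bump2])

lemma Deta_bump2: "Deta (bump2 r p) = (\<lambda>q. bump r (fst p) (fst q) * bump' r (snd p) (snd q))"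
  by (rule ext) (simp add: Deta_eqI[OF has_derivative_bump2])

lemma bump2_outside:
  assumes "r \<ge> 0" "q \<notin> cbox (fst p - r, snd p - r) (fst p + r, snd p + r)"
  shows "bump2 r p q = 0" "Dxi (bump2 r p) q = 0" "Deta (bump2 r p) q = 0"
proof -
  have "\<bar>fst q - fst p\<bar> \<ge> r \<or> \<bar>snd q - snd p\<bar> \<ge> r"
    using assms(2) by (cases q) (auto simp: cbox_Pair_eq)
  then show "bump2 r p q = 0" "Dxi (bump2 r p) q = 0" "Deta (bump2 r p) q = 0"
    using assms(1) by (auto simp: Dxi_bump2 Deta_bump2 bump2_def bump_outside)
qed

lemma test_function_bump2:
  assumes "r \<ge> 0" "cbox (fst p - r, snd p - r) (fst p + r, snd p + r) \<subseteq> U"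
  shows "test_function U (bump2 r p)"
  unfolding test_function_def
proof
  have "bump2 r p differentiable (at q)" for q
    using has_derivative_bump2 unfolding differentiable_def by blast
  moreover have "continuous_on UNIV (Dxi (bump2 r p))" "continuous_on UNIV (Deta (bump2 r p))"
    unfolding Dxi_bump2 Deta_bump2 by (intro continuous_intros)+
  ultimately show "Ck 1 UNIV (bump2 r p)" by simp
  show "\<exists>K. compact K \<and> K \<subseteq> U \<and> (\<forall>q. q \<notin> K \<longrightarrow> bump2 r p q = 0)"
    using assms bump2_outside(1)[OF assms(1)] by (blast intro: compact_cbox)
qed

lemma integral_derivative_zero:
  fixes f f' :: "real \<Rightarrow> real"
  assumes "a \<le> b" "\<And>x. x \<in> {a..b} \<Longrightarrow> (f has_real_derivative f' x) (at x)" "f a = 0" "f b = 0"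
  shows "integral (cbox a b) f' = 0"
proof -
  have "(f' has_integral (f b - f a)) {a..b}"
    using assms by (intro fundamental_theorem_of_calculus)
      (auto simp: has_real_derivative_iff_has_vector_derivative intro: has_vector_derivative_at_within)
  then show ?thesis using assms by (simp add: integral_unique)
qed

text \<open>The fundamental lemma of the calculus of variations for a vector field \<open>(F, G)\<close>. If the expression were
  nonzero at \<open>p\<close>, it would keep its sign in a small square about \<open>p\<close>. Tested with a product bump supported
  there, integration by parts in each variable separately shows that its weighted integral
  vanishes, which contradicts the sign.\<close>
lemma divergence_form_pointwise:
  fixes F G g G1 G2 :: "plane \<Rightarrow> real"
  assumes \<Omega>: "open \<Omega>" "\<Omega> \<subseteq> U" "p \<in> \<Omega>"
    and F: "\<And>x y. (x, y) \<in> \<Omega> \<Longrightarrow> ((\<lambda>x. F (x, y)) has_real_derivative G1 (x, y)) (at x)"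
    and G: "\<And>x y. (x, y) \<in> \<Omega> \<Longrightarrow> ((\<lambda>y. G (x, y)) has_real_derivative G2 (x, y)) (at y)"
    and cont: "continuous_on \<Omega> F" "continuous_on \<Omega> G" "continuous_on \<Omega> g"
       "continuous_on \<Omega> G1" "continuous_on \<Omega> G2"
    and weak: "\<And>\<zeta>. test_function U \<zeta> \<Longrightarrow>
       integral U (\<lambda>q. F q * Dxi \<zeta> q + G q * Deta \<zeta> q - g q * \<zeta> q) = 0"
  shows "G1 p + G2 p + g p = 0"
proof (rule ccontr)
  let ?E = "\<lambda>q. G1 q + G2 q + g q"
  assume "?E p \<noteq> 0"
  define s where "s = sgn (?E p)"
  have sE: "s * ?E p > 0" using \<open>?E p \<noteq> 0\<close> unfolding s_def
    by (cases "?E p > 0") (auto simp: sgn_if)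
  have "open {q\<in>\<Omega>. 0 < s * ?E q}"
  proof -
    have "open (\<Omega> \<inter> (\<lambda>q. s * ?E q) -` {0<..})"
      by (intro continuous_open_preimage \<Omega>(1) open_greaterThan continuous_intros cont)
    then show ?thesis by (simp add: vimage_def Int_def)
  qed
  moreover have "p \<in> {q\<in>\<Omega>. 0 < s * ?E q}" using sE \<Omega> by simp
  ultimately obtain e where e: "e > 0" "ball p e \<subseteq> {q\<in>\<Omega>. 0 < s * ?E q}"
    using open_contains_ball by blast
  define r where "r = e / 3"
  have r: "r > 0" using e by (simp add: r_def)
  let ?B = "cbox (fst p - r, snd p - r) (fst p + r, snd p + r)"
  have B: "?B \<subseteq> {q\<in>\<Omega>. 0 < s * ?E q}"
  proof
    fix q assume "q \<in> ?B"
    then have "\<bar>fst (p - q)\<bar> \<le> r" "\<bar>snd (p - q)\<bar> \<le> r"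
      by (cases q; auto simp: cbox_Pair_eq)+
    then have "norm (p - q) \<le> r + r"
      using sqrt_sum_squares_le_sum_abs[of "fst (p - q)" "snd (p - q)"]
      by (simp add: norm_prod_def)
    then have "dist p q < e" using r unfolding dist_norm r_def by linarith
    then show "q \<in> {q\<in>\<Omega>. 0 < s * ?E q}" using e(2) by auto
  qed
  then have B\<Omega>: "?B \<subseteq> \<Omega>" and BU: "?B \<subseteq> U" using \<Omega> by auto
  let ?\<zeta> = "bump2 r p"
  let ?b1 = "bump r (fst p)" and ?b2 = "bump r (snd p)"
  let ?H1 = "\<lambda>q. G1 q * ?\<zeta> q + F q * Dxi ?\<zeta> q"
  let ?H2 = "\<lambda>q. G2 q * ?\<zeta> q + G q * Deta ?\<zeta> q"
  have z: "?b1 (fst p - r) = 0" "?b1 (fst p + r) = 0" "?b2 (snd p - r) = 0" "?b2 (snd p + r) = 0"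
    using r by (auto intro!: bump_outside)
  have c\<zeta>: "continuous_on ?B ?\<zeta>" "continuous_on ?B (Dxi ?\<zeta>)" "continuous_on ?B (Deta ?\<zeta>)"
    unfolding Dxi_bump2 Deta_bump2 by (simp_all only: bump2_def[abs_def]) (intro continuous_intros)+
  note cB = cont[THEN continuous_on_subset, OF B\<Omega>]
  have c1: "continuous_on ?B ?H1" and c2: "continuous_on ?B ?H2"
    by (intro continuous_intros cB c\<zeta>)+
  have I1: "integral ?B ?H1 = 0"
  proof -
    have "integral ?B ?H1 = integral (cbox (fst p - r) (fst p + r))
        (\<lambda>x. integral (cbox (snd p - r) (snd p + r)) (\<lambda>y. ?H1 (x, y)))"
      by (rule integral_prod_continuous[OF c1])
    also have "\<dots> = integral (cbox (snd p - r) (snd p + r))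
        (\<lambda>y. integral (cbox (fst p - r) (fst p + r)) (\<lambda>x. ?H1 (x, y)))"
      by (rule integral_swap_continuous) (use c1 in \<open>simp add: case_prod_unfold\<close>)
    also have "\<dots> = integral (cbox (snd p - r) (snd p + r)) (\<lambda>y. 0)"
    proof (rule integral_cong)
      fix y assume y: "y \<in> cbox (snd p - r) (snd p + r)"
      show "integral (cbox (fst p - r) (fst p + r)) (\<lambda>x. ?H1 (x, y)) = 0"
      proof (rule integral_derivative_zero[where f = "\<lambda>x. F (x, y) * (?b1 x * ?b2 y)"])
        fix x assume x: "x \<in> {fst p - r..fst p + r}"
        have "(x, y) \<in> \<Omega>" using B\<Omega> x y by (auto simp: cbox_Pair_eq)
        from F[OF this] show "((\<lambda>x. F (x, y) * (?b1 x * ?b2 y)) has_real_derivative ?H1 (x, y)) (at x)"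
          by (auto intro!: derivative_eq_intros DERIV_bump simp: bump2_def Dxi_bump2)
      qed (use r z in auto)
    qed
    finally show ?thesis by simp
  qed
  have I2: "integral ?B ?H2 = 0"
  proof -
    have "integral ?B ?H2 = integral (cbox (fst p - r) (fst p + r))
        (\<lambda>x. integral (cbox (snd p - r) (snd p + r)) (\<lambda>y. ?H2 (x, y)))"
      by (rule integral_prod_continuous[OF c2])
    also have "\<dots> = integral (cbox (fst p - r) (fst p + r)) (\<lambda>y. 0)"
    proof (rule integral_cong)
      fix x assume x: "x \<in> cbox (fst p - r) (fst p + r)"
      show "integral (cbox (snd p - r) (snd p + r)) (\<lambda>y. ?H2 (x, y)) = 0"
      proof (rule integral_derivative_zero[where f = "\<lambda>y. G (x, y) * (?b1 x * ?b2 y)"])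
        fix y assume y: "y \<in> {snd p - r..snd p + r}"
        have "(x, y) \<in> \<Omega>" using B\<Omega> x y by (auto simp: cbox_Pair_eq)
        from G[OF this] show "((\<lambda>y. G (x, y) * (?b1 x * ?b2 y)) has_real_derivative ?H2 (x, y)) (at y)"
          by (auto intro!: derivative_eq_intros DERIV_bump simp: bump2_def Deta_bump2)
      qed (use r z in auto)
    qed
    finally show ?thesis by simp
  qed
  let ?I = "\<lambda>q. F q * Dxi ?\<zeta> q + G q * Deta ?\<zeta> q - g q * ?\<zeta> q"
  have I3: "integral ?B ?I = 0"
  proof -
    have "integral ?B ?I = integral U (\<lambda>q. if q \<in> ?B then ?I q else 0)"
      using BU by (simp add: integral_restrict_Int Int_absorb2)
    also have "(\<lambda>q. if q \<in> ?B then ?I q else 0) = ?I"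
      using bump2_outside[of r _ p] r by (auto simp: fun_eq_iff)
    also have "integral U ?I = 0"
      using r BU by (intro weak test_function_bump2) auto
    finally show ?thesis .
  qed
  have cI: "continuous_on ?B ?I" by (intro continuous_intros cB c\<zeta>)
  \<comment> \<open>The integrands \<open>?H1\<close> and \<open>?H2\<close> are the derivatives of \<open>F \<zeta>\<close> and \<open>G \<zeta>\<close>, and \<open>?I\<close> is the weak form.\<close>
  have "integral ?B (\<lambda>q. s * ?E q * ?\<zeta> q) = integral ?B (\<lambda>q. s * (?H1 q + ?H2 q - ?I q))"
    by (rule arg_cong[where f = "integral ?B"]) (auto simp: algebra_simps)
  also have "\<dots> = s * (integral ?B ?H1 + integral ?B ?H2 - integral ?B ?I)"
    by (intro integral_unique has_integral_mult_right has_integral_add has_integral_diff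
        integrable_integral integrable_continuous c1 c2 cI)
  also have "\<dots> = 0" unfolding I1 I2 I3 by simp
  finally have 0: "integral ?B (\<lambda>q. s * ?E q * ?\<zeta> q) = 0" .
  have "\<forall>q\<in>?B. s * ?E q * ?\<zeta> q = 0"
  proof (rule integral_cbox_eq_0_iff[THEN iffD1, OF _ _ _ 0])
    show "continuous_on ?B (\<lambda>q. s * ?E q * ?\<zeta> q)" by (intro continuous_intros cB c\<zeta>)
    have "p \<in> box (fst p - r, snd p - r) (fst p + r, snd p + r)"
      using r by (cases p) (auto simp: mem_box Basis_prod_def)
    then show "box (fst p - r, snd p - r) (fst p + r, snd p + r) \<noteq> {}" by blast
    fix q assume "q \<in> ?B"
    then have "0 < s * ?E q" using B by auto
    moreover have "0 \<le> ?\<zeta> q" by (simp add: bump2_def bump_nonneg)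
    ultimately show "0 \<le> s * ?E q * ?\<zeta> q"
      by (rule mult_nonneg_nonneg[OF less_imp_le])
  qed
  moreover have "p \<in> ?B" using r by (cases p) (auto simp: cbox_Pair_eq)
  ultimately have "s * ?E p * ?\<zeta> p = 0" by blast
  moreover have "?\<zeta> p > 0" using r by (simp add: bump2_def bump_def)
  ultimately show False using sE by auto
qed

lemma has_real_derivative_fst_snd:
  assumes "f differentiable (at (x, y))"
  shows "((\<lambda>x. f (x, y)) has_real_derivative Dxi f (x, y)) (at x)"
    and "((\<lambda>y. f (x, y)) has_real_derivative Deta f (x, y)) (at y)"
proof -
  note D = has_derivative_Dxi_Deta[OF assms]
  have "((\<lambda>x. (x, y)) has_derivative (\<lambda>h. (h, 0))) (at x)"
    by (auto intro!: derivative_eq_intros)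
  from has_derivative_compose[OF this D]
  show "((\<lambda>x. f (x, y)) has_real_derivative Dxi f (x, y)) (at x)"
    by (simp add: has_field_derivative_def mult_commute_abs)
  have "((\<lambda>y. (x, y)) has_derivative (\<lambda>h. (0, h))) (at y)"
    by (auto intro!: derivative_eq_intros)
  from has_derivative_compose[OF this D]
  show "((\<lambda>y. f (x, y)) has_real_derivative Deta f (x, y)) (at y)"
    by (simp add: has_field_derivative_def mult_commute_abs)
qed

lemma sound_sq_of_alt:
  "sound_sq_of \<gamma> \<rho>0 \<phi> p = \<rho>0 powr (\<gamma> - 1) - (\<gamma> - 1) * (\<phi> p + ((Dxi \<phi> p)\<^sup>2 + (Deta \<phi> p)\<^sup>2) / 2)"
  by (simp add: sound_sq_of_def sound_sq_def norm_plane_sq grad_def)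

lemma elliptic_atD:
  assumes "elliptic_at \<gamma> \<rho>0 \<phi> p"
  shows "(norm (grad \<phi> p))\<^sup>2 < sound_sq_of \<gamma> \<rho>0 \<phi> p" "0 < sound_sq_of \<gamma> \<rho>0 \<phi> p"
proof -
  have lt: "norm (grad \<phi> p) < sqrt (sound_sq_of \<gamma> \<rho>0 \<phi> p)"
    using assms by (simp add: elliptic_at_def)
  then have "0 < sqrt (sound_sq_of \<gamma> \<rho>0 \<phi> p)" using norm_ge_zero le_less_trans by blast
  then show "0 < sound_sq_of \<gamma> \<rho>0 \<phi> p" by simp
  then show "(norm (grad \<phi> p))\<^sup>2 < sound_sq_of \<gamma> \<rho>0 \<phi> p"
    using power_strict_mono[OF lt, of 2] by simp
qed

text \<open>With \<open>S = c\<^sup>2\<close>, the density is \<open>S\<^sup>k\<close> with \<open>k = 1 / (\<gamma> - 1)\<close>, and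
  \<open>DS = - (\<gamma> - 1) (D\<phi> + D\<^sup>2\<phi> D\<phi>)\<close>. As \<open>k (\<gamma> - 1) = 1\<close>, the divergence form equals
  \<open>S\<^sup>k\<^sup>-\<^sup>1 (S (\<Delta>\<phi> + 2) - |D\<phi>|\<^sup>2 - D\<^sup>2\<phi>(D\<phi>, D\<phi>))\<close>. Adding \<open>|h|\<^sup>2\<close> to the Hessian of \<open>\<phi>\<close> absorbs
  the terms without second derivatives.\<close>
lemma flow_equation:
  assumes \<gamma>: "\<gamma> > 1" and w: "weak_solution \<gamma> \<rho>0 U \<phi>"
    and \<Omega>: "open \<Omega>" "\<Omega> \<subseteq> U" "p \<in> \<Omega>" and C: "Ck 2 \<Omega> \<phi>"
    and ell: "\<And>q. q \<in> \<Omega> \<Longrightarrow> elliptic_at \<gamma> \<rho>0 \<phi> q"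
  shows "flow_op (sound_sq_of \<gamma> \<rho>0 \<phi> p) (grad \<phi> p) (\<lambda>h. hess \<phi> p h + (norm h)\<^sup>2) = 0"
proof -
  let ?S = "sound_sq_of \<gamma> \<rho>0 \<phi>"
  define k where "k = 1 / (\<gamma> - 1)"
  have k: "k * (\<gamma> - 1) = 1" using \<gamma> by (simp add: k_def)
  let ?u = "Dxi \<phi>" and ?v = "Deta \<phi>"
  let ?Sx = "\<lambda>q. - (\<gamma> - 1) * (?u q + (?u q * Dxi ?u q + ?v q * Dxi ?v q))"
  let ?Sy = "\<lambda>q. - (\<gamma> - 1) * (?v q + (?u q * Deta ?u q + ?v q * Deta ?v q))"
  let ?\<rho> = "\<lambda>q. ?S q powr k"
  let ?G1 = "\<lambda>q. k * ?S q powr (k - 1) * ?Sx q * ?u q + ?\<rho> q * Dxi ?u q"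
  let ?G2 = "\<lambda>q. k * ?S q powr (k - 1) * ?Sy q * ?v q + ?\<rho> q * Deta ?v q"
  have pos: "?S q > 0" if "q \<in> \<Omega>" for q using elliptic_atD(2)[OF ell[OF that]] .
  note d = Ck_1D(1)[OF Ck_2D(1)[OF C]] Ck_1D(1)[OF Ck_2D(2)[OF C]] Ck_1D(1)[OF Ck_2D(3)[OF C]]
  note c = Ck_1D(2-4)[OF Ck_2D(1)[OF C]] Ck_1D(3,4)[OF Ck_2D(2)[OF C]] Ck_1D(3,4)[OF Ck_2D(3)[OF C]]
  have cS: "continuous_on \<Omega> ?S"
    unfolding sound_sq_of_alt by (intro continuous_intros c; simp)
  have rho: "rho_of \<gamma> \<rho>0 \<phi> = ?\<rho>"
    by (rule ext) (simp add: rho_of_def rho_def sound_sq_of_def k_def)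
  have E: "?G1 p + ?G2 p + 2 * ?\<rho> p = 0"
  proof (rule divergence_form_pointwise[OF \<Omega>, where F = "\<lambda>q. ?\<rho> q * ?u q" and G = "\<lambda>q. ?\<rho> q * ?v q"])
    fix x y assume xy: "(x, y) \<in> \<Omega>"
    note e = has_real_derivative_fst_snd[OF d(1)[OF xy]] has_real_derivative_fst_snd[OF d(2)[OF xy]]
      has_real_derivative_fst_snd[OF d(3)[OF xy]]
    have S1: "((\<lambda>x. ?S (x, y)) has_real_derivative ?Sx (x, y)) (at x)"
      unfolding sound_sq_of_alt
      by (auto intro!: derivative_eq_intros e simp: field_simps)
    have S2: "((\<lambda>y. ?S (x, y)) has_real_derivative ?Sy (x, y)) (at y)"
      unfolding sound_sq_of_alt
      by (auto intro!: derivative_eq_intros e simp: field_simps)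
    have \<rho>1: "((\<lambda>x. ?\<rho> (x, y)) has_real_derivative k * ?S (x, y) powr (k - 1) * ?Sx (x, y)) (at x)"
      using DERIV_fun_powr[OF S1 pos[OF xy], of k] by simp
    have \<rho>2: "((\<lambda>y. ?\<rho> (x, y)) has_real_derivative k * ?S (x, y) powr (k - 1) * ?Sy (x, y)) (at y)"
      using DERIV_fun_powr[OF S2 pos[OF xy], of k] by simp
    show "((\<lambda>x. ?\<rho> (x, y) * ?u (x, y)) has_real_derivative ?G1 (x, y)) (at x)"
      using DERIV_mult[OF \<rho>1 e(3)] by (simp add: algebra_simps)
    show "((\<lambda>y. ?\<rho> (x, y) * ?v (x, y)) has_real_derivative ?G2 (x, y)) (at y)"
      using DERIV_mult[OF \<rho>2 e(6)] by (simp add: algebra_simps)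
  next
    have S0: "\<forall>q\<in>\<Omega>. ?S q \<noteq> 0" using pos by force
    show "continuous_on \<Omega> (\<lambda>q. ?\<rho> q * ?u q)" "continuous_on \<Omega> (\<lambda>q. ?\<rho> q * ?v q)"
      "continuous_on \<Omega> (\<lambda>q. 2 * ?\<rho> q)" "continuous_on \<Omega> ?G1" "continuous_on \<Omega> ?G2"
      using S0 by (intro continuous_intros c cS; simp)+
  next
    fix \<zeta> assume "test_function U \<zeta>"
    then have "integral U
          (\<lambda>p. rho_of \<gamma> \<rho>0 \<phi> p * (grad \<phi> p \<bullet> grad \<zeta> p) - 2 * rho_of \<gamma> \<rho>0 \<phi> p * \<zeta> p) = 0"
      using w unfolding weak_solution_def by blast
    then show "integral U (\<lambda>q. ?\<rho> q * ?u q * Dxi \<zeta> q + ?\<rho> q * ?v q * Deta \<zeta> q - 2 * ?\<rho> q * \<zeta> q) = 0"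
      unfolding rho by (simp add: grad_def inner_prod_def algebra_simps)
  qed
  have r1: "?\<rho> p = ?S p powr (k - 1) * ?S p"
    using pos[OF \<Omega>(3)] by (simp add: powr_diff)
  have r2: "k * ?S p powr (k - 1) * ?Sx p = - (?S p powr (k - 1) * (?u p + (?u p * Dxi ?u p + ?v p * Dxi ?v p)))"
    "k * ?S p powr (k - 1) * ?Sy p = - (?S p powr (k - 1) * (?v p + (?u p * Deta ?u p + ?v p * Deta ?v p)))"
  proof -
    have "k * a * (- (\<gamma> - 1) * b) = - (k * (\<gamma> - 1)) * (a * b)" for a b by (simp add: algebra_simps)
    then show "k * ?S p powr (k - 1) * ?Sx p = - (?S p powr (k - 1) * (?u p + (?u p * Dxi ?u p + ?v p * Dxi ?v p)))"
      "k * ?S p powr (k - 1) * ?Sy p = - (?S p powr (k - 1) * (?v p + (?u p * Deta ?u p + ?v p * Deta ?v p)))"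
      unfolding k by simp_all
  qed
  have "?S p powr (k - 1) * flow_op (?S p) (grad \<phi> p) (\<lambda>h. hess \<phi> p h + (norm h)\<^sup>2) = 0"
    using E unfolding r2 unfolding r1
    unfolding flow_op_def hess_def norm_plane_sq grad_def by (simp add: algebra_simps power2_eq_square)
  then show ?thesis using pos[OF \<Omega>(3)] by simp
qed

section \<open>Barriers and minimum principles\<close>

text \<open>With \<open>s = c\<^sup>2 - |p - z|\<^sup>2\<close> and \<open>\<tau> = (p - z) \<bullet> e\<close> this is \<open>s (a + b s - k \<tau>\<^sup>2)\<close>. The choice
  \<open>a = 1\<close>, \<open>k = 0\<close> gives a Hopf barrier, with a large \<open>b\<close> in the role of the usual exponential; the choice
  \<open>a = 0\<close>, \<open>b = k = 1\<close> gives the barrier at the sonic arc.\<close>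
definition barrier :: "plane \<Rightarrow> real \<Rightarrow> plane \<Rightarrow> real \<Rightarrow> real \<Rightarrow> real \<Rightarrow> plane \<Rightarrow> real" where
  "barrier z c e a b k p = (c\<^sup>2 - (norm (p - z))\<^sup>2) * (a + b * (c\<^sup>2 - (norm (p - z))\<^sup>2) - k * ((p - z) \<bullet> e)\<^sup>2)"

definition barrier_hess :: "plane \<Rightarrow> real \<Rightarrow> plane \<Rightarrow> real \<Rightarrow> real \<Rightarrow> real \<Rightarrow> plane \<Rightarrow> plane \<Rightarrow> real" where
  "barrier_hess z c e a b k p h =
     8 * b * ((p - z) \<bullet> h)\<^sup>2
     - 2 * (norm h)\<^sup>2 * (a + 2 * b * (c\<^sup>2 - (norm (p - z))\<^sup>2) - k * ((p - z) \<bullet> e)\<^sup>2)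
     + 8 * k * ((p - z) \<bullet> e) * ((p - z) \<bullet> h) * (e \<bullet> h)
     - 2 * k * (c\<^sup>2 - (norm (p - z))\<^sup>2) * (e \<bullet> h)\<^sup>2"

lemma continuous_on_barrier: "continuous_on S (barrier z c e a b k)"
  unfolding barrier_def[abs_def] by (intro continuous_intros)

lemma norm_sq_along: "(norm (p + t *\<^sub>R h - z))\<^sup>2 = (norm (p - z))\<^sup>2 + 2 * t * ((p - z) \<bullet> h) + t\<^sup>2 * (norm (h :: plane))\<^sup>2"
proof -
  have *: "p + t *\<^sub>R h - z = (p - z) + t *\<^sub>R h" by simp
  define P where "P = p - z"
  show ?thesis
    unfolding power2_norm_eq_inner * P_def[symmetric] by (simp add: inner_add_left inner_add_right inner_commute power2_eq_square)
qed

text \<open>The derivative of the barrier along the line \<open>p + t h\<close>, as a polynomial in \<open>t\<close>.\<close>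
definition barrier_slope ::
    "plane \<Rightarrow> real \<Rightarrow> plane \<Rightarrow> real \<Rightarrow> real \<Rightarrow> real \<Rightarrow> plane \<Rightarrow> plane \<Rightarrow> real \<Rightarrow> real" where
  "barrier_slope z c e a b k p h t =
     - 2 * ((p - z) \<bullet> h + t * (norm h)\<^sup>2) *
       (a + 2 * b * (c\<^sup>2 - ((norm (p - z))\<^sup>2 + 2 * t * ((p - z) \<bullet> h) + t\<^sup>2 * (norm h)\<^sup>2))
        - k * ((p - z) \<bullet> e + t * (e \<bullet> h))\<^sup>2)
     - 2 * k * (c\<^sup>2 - ((norm (p - z))\<^sup>2 + 2 * t * ((p - z) \<bullet> h) + t\<^sup>2 * (norm h)\<^sup>2))
       * ((p - z) \<bullet> e + t * (e \<bullet> h)) * (e \<bullet> h)"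

lemma barrier_along:
  "((\<lambda>t. barrier z c e a b k (p + t *\<^sub>R h)) has_real_derivative barrier_slope z c e a b k p h t) (at t)"
proof -
  have i: "(p + t *\<^sub>R h - z) \<bullet> e = (p - z) \<bullet> e + t * (e \<bullet> h)" for t
    by (simp add: inner_diff_left inner_add_left inner_commute[of h])
  show ?thesis unfolding barrier_def barrier_slope_def norm_sq_along i
    by (rule derivative_eq_intros refl)+ (simp add: algebra_simps power2_eq_square)
qed

lemma second_along_barrier: "second_along (barrier z c e a b k) p h (barrier_hess z c e a b k p h)"
  unfolding second_along_def
proof (intro exI conjI always_eventually allI)
  show "((\<lambda>t. barrier z c e a b k (p + t *\<^sub>R h)) has_real_derivative barrier_slope z c e a b k p h t) (at t)" for t
    by (rule barrier_along)
  show "(barrier_slope z c e a b k p h has_real_derivative barrier_hess z c e a b k p h) (at 0)"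
    unfolding barrier_hess_def barrier_slope_def[abs_def]
    by (rule derivative_eq_intros refl)+ (simp add: algebra_simps power2_eq_square)
qed

lemma quadratic_form_barrier_hess: "quadratic_form (barrier_hess z c e a b k p)"
proof -
  obtain z1 z2 e1 e2 p1 p2 where [simp]: "z = (z1, z2)" "e = (e1, e2)" "p = (p1, p2)" by (metis surj_pair)
  let ?s = "c\<^sup>2 - (norm (p - z))\<^sup>2" and ?\<tau> = "(p - z) \<bullet> e"
  let ?A = "a + 2 * b * ?s - k * ?\<tau>\<^sup>2"
  have "\<forall>h. barrier_hess z c e a b k p h =
      (8 * b * (p1 - z1)\<^sup>2 - 2 * ?A + 8 * k * ?\<tau> * (p1 - z1) * e1 - 2 * k * ?s * e1\<^sup>2) * (fst h)\<^sup>2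
    + (16 * b * (p1 - z1) * (p2 - z2) + 8 * k * ?\<tau> * ((p1 - z1) * e2 + (p2 - z2) * e1) - 4 * k * ?s * e1 * e2) * (fst h * snd h)
    + (8 * b * (p2 - z2)\<^sup>2 - 2 * ?A + 8 * k * ?\<tau> * (p2 - z2) * e2 - 2 * k * ?s * e2\<^sup>2) * (snd h)\<^sup>2"
    unfolding barrier_hess_def norm_plane_sq[of "h" for h]
    by (simp add: inner_prod_def) (simp add: algebra_simps power2_eq_square)
  then show ?thesis unfolding quadratic_form_def by blast
qed

lemma flow_op_barrier_hess:
  "flow_op K v (barrier_hess z c e a b k p) =
     8 * b * (K * (norm (p - z))\<^sup>2 - ((p - z) \<bullet> v)\<^sup>2)
     - 2 * (2 * K - (norm v)\<^sup>2) * (a + 2 * b * (c\<^sup>2 - (norm (p - z))\<^sup>2) - k * ((p - z) \<bullet> e)\<^sup>2)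
     + 8 * k * ((p - z) \<bullet> e) * (K * ((p - z) \<bullet> e) - ((p - z) \<bullet> v) * (e \<bullet> v))
     - 2 * k * (c\<^sup>2 - (norm (p - z))\<^sup>2) * (K * (norm e)\<^sup>2 - (e \<bullet> v)\<^sup>2)"
proof -
  define P where "P = p - z"
  define s where "s = c\<^sup>2 - (norm P)\<^sup>2"
  define \<tau> where "\<tau> = P \<bullet> e"
  define A where "A = a + 2 * b * s - k * \<tau>\<^sup>2"
  have "flow_op K v (barrier_hess z c e a b k p) =
     8 * b * (K * ((fst P)\<^sup>2 + (snd P)\<^sup>2) - (P \<bullet> v)\<^sup>2) - 2 * (2 * K - (norm v)\<^sup>2) * A
     + 8 * k * \<tau> * (K * (fst P * fst e + snd P * snd e) - (P \<bullet> v) * (e \<bullet> v))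
     - 2 * k * s * (K * ((fst e)\<^sup>2 + (snd e)\<^sup>2) - (e \<bullet> v)\<^sup>2)"
    unfolding flow_op_def barrier_hess_def P_def[symmetric] s_def[symmetric] \<tau>_def[symmetric] A_def[symmetric]
    by (simp add: inner_prod_def[of _ "(1, 0)"] inner_prod_def[of _ "(0, 1)"]) (simp add: algebra_simps)
  also have "fst P * fst e + snd P * snd e = \<tau>" by (simp add: \<tau>_def inner_prod_def)
  finally show ?thesis
    unfolding norm_plane_sq[of P, symmetric] norm_plane_sq[of e, symmetric]
    by (simp only: A_def s_def \<tau>_def P_def)
qed

text \<open>The classical argument of Hopf. If the zero set \<open>Z\<close> is not open, there is a ball in which \<open>f > 0\<close> and
  whose boundary meets \<open>Z\<close>. Halving the ball leaves a single point \<open>q\<close> of contact. Comparison with the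
  barrier makes the derivative of \<open>f\<close> at \<open>q\<close> along the inner normal positive, although \<open>q\<close> is an
  interior minimum of \<open>f\<close>. Thus \<open>Z\<close> is open, and by connectedness it is empty.\<close>
lemma strong_minimum_principle:
  fixes f :: "plane \<Rightarrow> real" and K :: "plane \<Rightarrow> real" and v :: "plane \<Rightarrow> plane"
  assumes \<Omega>: "open \<Omega>" "connected \<Omega>"
    and K: "continuous_on \<Omega> K" and v: "continuous_on \<Omega> v"
    and ell: "\<And>p. p \<in> \<Omega> \<Longrightarrow> (norm (v p))\<^sup>2 < K p"
    and df: "\<And>p. p \<in> \<Omega> \<Longrightarrow> f differentiable (at p)"
    and Q: "\<And>p. p \<in> \<Omega> \<Longrightarrow> quadratic_form (Q p)" "\<And>p h. p \<in> \<Omega> \<Longrightarrow> second_along f p h (Q p h)"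
    and L: "\<And>p. p \<in> \<Omega> \<Longrightarrow> flow_op (K p) (v p) (Q p) \<le> 0"
    and f0: "\<And>p. p \<in> \<Omega> \<Longrightarrow> 0 \<le> f p"
    and y0: "y0 \<in> \<Omega>" "0 < f y0" and p: "p \<in> \<Omega>"
  shows "0 < f p"
proof -
  have cf: "continuous_on \<Omega> f"
    by (intro continuous_at_imp_continuous_on ballI differentiable_imp_continuous_within df)
  define Z where "Z = {p\<in>\<Omega>. f p = 0}"
  have ball: "\<exists>r>0. ball x r \<subseteq> Z" if x: "x \<in> Z" for x
  proof -
    obtain r where r: "r > 0" "cball x (2 * r) \<subseteq> \<Omega>"
    proof -
      obtain r' where "r' > 0" "cball x r' \<subseteq> \<Omega>" using \<Omega>(1) x unfolding Z_def open_contains_cball by blast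
      then show ?thesis by (intro that[of "r' / 2"]) auto
    qed
    have "ball x r \<subseteq> Z"
    proof (rule ccontr)
      assume "\<not> ball x r \<subseteq> Z"
      then obtain y where y: "y \<in> ball x r" "y \<notin> Z" by blast
      have sub: "ball x (2 * r) \<subseteq> \<Omega>" using r by force
      have "closed (Z \<inter> cball x (2 * r))"
      proof -
        have "closed {q \<in> cball x (2 * r). f q = 0}"
          using continuous_closed_preimage_constant[OF continuous_on_subset[OF cf r(2)] closed_cball] .
        moreover have "{q \<in> cball x (2 * r). f q = 0} = Z \<inter> cball x (2 * r)" using r(2) by (auto simp: Z_def)
        ultimately show ?thesis by simp
      qed
      moreover have "Z \<inter> cball x (2 * r) \<noteq> {}" using x r by auto
      ultimately obtain q where q: "q \<in> Z" "q \<in> cball x (2 * r)"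
        "\<And>q'. q' \<in> Z \<inter> cball x (2 * r) \<Longrightarrow> dist y q \<le> dist y q'"
        using distance_attains_inf[of "Z \<inter> cball x (2 * r)" y] by (metis IntE)
      have "dist y q \<le> dist y x" using q(3)[of x] x r by auto
      then have yq: "dist y q < r" using y(1) by (simp add: dist_commute)
      have pos: "0 < f u" if "dist y u < dist y q" for u
      proof -
        have "dist x u < 2 * r" using dist_triangle[of x u y] y(1) that yq by simp
        then have "u \<in> \<Omega>" "u \<in> cball x (2 * r)" using sub by auto
        moreover have "u \<notin> Z" using q(3)[of u] that \<open>u \<in> cball x (2 * r)\<close> by auto
        ultimately show ?thesis using f0[of u] by (auto simp: Z_def)
      qed
      have q\<Omega>: "q \<in> \<Omega>" "f q = 0" using q by (auto simp: Z_def)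
      \<comment> \<open>The ball of half the radius that touches the larger one from inside at \<open>q\<close>.\<close>
      define z where "z = midpoint y q"
      define c where "c = dist z q"
      have "y \<noteq> q" using y q by blast
      then have c: "c > 0" by (auto simp: c_def z_def midpoint_eq_endpoint)
      have qz: "q - z = z - y" by (simp add: z_def midpoint_def algebra_simps scaleR_2[symmetric])
      have nzq: "norm (z - y) = c" "norm (q - z) = c" by (simp_all add: c_def dist_norm norm_minus_commute qz[symmetric])
      have yq2: "dist y q = 2 * c"
        using dist_midpoint(4)[of y q] by (simp add: c_def z_def)
      have posV: "0 < f u" if "u \<in> cball z c" "u \<noteq> q" for u
      proof (rule pos, rule ccontr)
        assume "\<not> dist y u < dist y q"
        then have "2 * c \<le> dist y u" unfolding yq2 by simp
        then have 1: "2 * c \<le> norm (u - y)" by (simp add: dist_norm norm_minus_commute)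
        have par: "(norm ((u - z) + (z - y)))\<^sup>2 + (norm ((u - z) - (z - y)))\<^sup>2 = 2 * (norm (u - z))\<^sup>2 + 2 * (norm (z - y))\<^sup>2"
          by (simp add: power2_norm_eq_inner inner_diff inner_add inner_commute)
        have "(u - z) - (z - y) = u - q" unfolding qz[symmetric] by simp
        moreover have "(u - z) + (z - y) = u - y" by simp
        ultimately have "(norm (u - y))\<^sup>2 + (norm (u - q))\<^sup>2 = 2 * (norm (u - z))\<^sup>2 + 2 * c\<^sup>2"
          using par unfolding nzq by metis
        moreover have "(norm (u - z))\<^sup>2 \<le> c\<^sup>2"
          using that by (intro power_mono) (auto simp: dist_norm norm_minus_commute)
        moreover have "4 * c\<^sup>2 \<le> (norm (u - y))\<^sup>2" using 1 c power_mono[of "2 * c" _ 2] by (simp add: power_mult_distrib)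
        ultimately have "(norm (u - q))\<^sup>2 \<le> 0" by linarith
        then show False using that by simp
      qed
      define A where "A = (\<lambda>p. K p * (norm (p - z))\<^sup>2 - ((p - z) \<bullet> v p)\<^sup>2)"
      define T where "T = (\<lambda>p. 2 * K p - (norm (v p))\<^sup>2)"
      have Aq: "0 < A q"
      proof -
        have "((q - z) \<bullet> v q)\<^sup>2 \<le> (norm (q - z))\<^sup>2 * (norm (v q))\<^sup>2"
          using Cauchy_Schwarz_ineq[of "q - z" "v q"] by (simp add: power2_norm_eq_inner)
        moreover have "(norm (q - z))\<^sup>2 * (norm (v q))\<^sup>2 < (norm (q - z))\<^sup>2 * K q"
          using ell[OF q\<Omega>(1)] c nzq by (intro mult_strict_left_mono) auto
        ultimately show ?thesis by (simp add: A_def mult.commute)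
      qed
      \<comment> \<open>At \<open>q\<close>, where \<open>s = 0\<close>, the operator takes the value \<open>8 \<beta> A - 2 T\<close> on the barrier; this
          \<open>\<beta>\<close> makes it positive.\<close>
      define \<beta> where "\<beta> = 2 * (1 + \<bar>T q\<bar>) / A q"
      have \<beta>: "\<beta> > 0" using Aq by (simp add: \<beta>_def)
      let ?G = "\<lambda>p. 8 * \<beta> * A p - 2 * T p * (1 + 2 * \<beta> * (c\<^sup>2 - (norm (p - z))\<^sup>2))"
      have Gq: "?G q > 0"
      proof -
        have "\<beta> * A q = 2 * (1 + \<bar>T q\<bar>)" using Aq by (simp add: \<beta>_def)
        then have "?G q = 16 * (1 + \<bar>T q\<bar>) - 2 * T q" by (simp add: nzq mult.assoc)
        then show ?thesis by (simp add: abs_if)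
      qed
      have cG: "continuous_on \<Omega> ?G"
        unfolding A_def T_def by (intro continuous_intros K v)
      obtain d where d: "d > 0" "\<And>u. u \<in> \<Omega> \<Longrightarrow> dist u q < d \<Longrightarrow> 0 < ?G u"
      proof -
        obtain d where "d > 0" and d: "\<forall>u\<in>\<Omega>. dist u q < d \<longrightarrow> dist (?G u) (?G q) < ?G q"
          using cG[unfolded continuous_on_iff, rule_format, OF q\<Omega>(1) Gq] by blast
        have "0 < ?G u" if "u \<in> \<Omega>" "dist u q < d" for u
        proof -
          have "dist (?G u) (?G q) < ?G q" using d that by blast
          then show ?thesis unfolding dist_real_def by linarith
        qed
        with \<open>d > 0\<close> show ?thesis by (rule that)
      qed
      obtain d' where d': "d' > 0" "cball q d' \<subseteq> \<Omega>" using \<Omega>(1) q\<Omega>(1) open_contains_cball by blast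
      define k where "k = min d d'"
      have k: "k > 0" "cball q k \<subseteq> \<Omega>" using d d' by (auto simp: k_def)
      let ?w = "barrier z c 0 1 \<beta> 0"
      obtain e where e: "e > 0" "\<And>p. p \<in> cball q k \<inter> cball z c \<Longrightarrow> e * ?w p \<le> f p"
      proof (rule barrier_comparison[of "cball z c" q k f ?w])
        show "closed (cball z c)" by simp
        show "continuous_on (cball q k \<inter> cball z c) f" using cf k by (blast intro: continuous_on_subset)
        show "continuous_on (cball q k \<inter> cball z c) ?w" by (rule continuous_on_barrier)
        show "0 \<le> f p" if "p \<in> cball q k \<inter> cball z c" for p using that f0 k by blast
        show "0 < f p" if "p \<in> sphere q k \<inter> cball z c" for p
          by (rule posV) (use that k in auto)
        fix p assume p: "p \<in> ball q k \<inter> cball z c" "0 < ?w p"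
        then have p\<Omega>: "p \<in> \<Omega>" using k by auto
        have "norm (p - z) \<noteq> c" using p(2) by (auto simp: barrier_def)
        then have int: "p \<in> interior (cball z c)" using p(1) by (auto simp: dist_norm norm_minus_commute)
        have "0 < ?G p" using d(2)[OF p\<Omega>] p(1) by (auto simp: k_def dist_commute)
        then have "0 < flow_op (K p) (v p) (barrier_hess z c 0 1 \<beta> 0 p)"
          unfolding flow_op_barrier_hess by (simp add: A_def T_def)
        then have "strictly_sub f ?w p"
          by (rule strictly_subI[OF Q(1)[OF p\<Omega>] quadratic_form_barrier_hess Q(2)[OF p\<Omega>]
                second_along_barrier ell[OF p\<Omega>] L[OF p\<Omega>]])
        then show "p \<in> interior (cball z c) \<and> strictly_sub f ?w p" using int by blast
      qed blast
      let ?F = "\<lambda>t. f (q + t *\<^sub>R (z - q))" and ?W = "\<lambda>t. ?w (q + t *\<^sub>R (z - q))"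
      have Fd: "(?F has_real_derivative grad f q \<bullet> (z - q)) (at 0)"
        using has_real_derivative_along_line[of f q 0 "z - q"] df[OF q\<Omega>(1)] by simp
      have qt: "q + t *\<^sub>R (z - q) \<in> cball q k \<inter> cball z c" if "0 \<le> t" "t \<le> 1" "t * c \<le> k" for t
      proof -
        have "q + t *\<^sub>R (z - q) - z = (1 - t) *\<^sub>R (q - z)" by (simp add: algebra_simps)
        then have "norm (q + t *\<^sub>R (z - q) - z) = (1 - t) * c"
          using that by (simp add: nzq)
        moreover have "(1 - t) * c \<le> 1 * c" using that c by (intro mult_right_mono) auto
        ultimately have 1: "norm (z - (q + t *\<^sub>R (z - q))) \<le> c" by (simp add: norm_minus_commute)
        have "norm (z - q) = c" using nzq(2) by (simp add: norm_minus_commute)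
        then show ?thesis using 1 that by (simp add: dist_norm)
      qed
      have "grad f q \<bullet> (z - q) = 0"
      proof (rule DERIV_local_min[OF Fd])
        show "0 < k / c" using k c by simp
        show "\<forall>y. \<bar>0 - y\<bar> < k / c \<longrightarrow> ?F 0 \<le> ?F y"
        proof (intro allI impI)
          fix t assume "\<bar>0 - t\<bar> < k / c"
          then have "\<bar>t\<bar> * c < k" using c by (simp add: field_simps)
          then have "q + t *\<^sub>R (z - q) \<in> cball q k" using nzq by (simp add: dist_norm norm_minus_commute)
          then have "q + t *\<^sub>R (z - q) \<in> \<Omega>" using k(2) by blast
          then show "?F 0 \<le> ?F t" using f0 q\<Omega>(2) by simp
        qed
      qed
      moreover have "(?W has_real_derivative 2 * c\<^sup>2) (at 0)"
      proof -
        have "(q - z) \<bullet> (z - q) = - ((norm (q - z))\<^sup>2)"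
          unfolding power2_norm_eq_inner by (metis inner_minus_right minus_diff_eq)
        then show ?thesis
          using barrier_along[of z c 0 1 \<beta> 0 q "z - q" 0] by (simp add: barrier_slope_def nzq)
      qed
      ultimately have "((\<lambda>t. ?F t - e * ?W t) has_real_derivative - (e * (2 * c\<^sup>2))) (at 0)"
        using Fd by (auto intro!: derivative_eq_intros)
      moreover have "- (e * (2 * c\<^sup>2)) < 0" using e c by simp
      ultimately obtain b where b: "b > 0" "\<And>t. 0 < t \<Longrightarrow> t < b \<Longrightarrow> ?F t - e * ?W t < ?F 0 - e * ?W 0"
        using DERIV_neg_dec_right by fastforce
      define t where "t = min (min (b / 2) 1) (k / c)"
      have t: "0 < t" "t < b" "t \<le> 1" "t \<le> k / c" using b(1) k(1) c unfolding t_def by simp_all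
      then have "t * c \<le> k" using c by (simp add: pos_le_divide_eq)
      have "e * ?W t \<le> ?F t" using e(2)[OF qt] t \<open>t * c \<le> k\<close> by simp
      moreover have "?F 0 - e * ?W 0 = 0" using q\<Omega> by (simp add: barrier_def nzq)
      ultimately show False using b(2)[of t] t by linarith
    qed
    then show ?thesis using r by blast
  qed
  have "open Z" unfolding open_contains_ball using ball by blast
  moreover have "open {p\<in>\<Omega>. 0 < f p}"
  proof -
    have "open (\<Omega> \<inter> f -` {0<..})" using continuous_open_preimage[OF cf \<Omega>(1) open_greaterThan] .
    then show ?thesis by (simp add: vimage_def Int_def)
  qed
  moreover have "\<Omega> \<subseteq> Z \<union> {p\<in>\<Omega>. 0 < f p}" using f0 by (force simp: Z_def)
  moreover have "Z \<inter> {p\<in>\<Omega>. 0 < f p} \<inter> \<Omega> = {}" by (auto simp: Z_def)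
  moreover have "{p\<in>\<Omega>. 0 < f p} \<inter> \<Omega> \<noteq> {}" using y0 by blast
  ultimately have "Z \<inter> \<Omega> = {}" using connectedD[OF \<Omega>(2)] by blast
  then show ?thesis using p f0[OF p] by (force simp: Z_def)
qed

text \<open>Subtracting a small multiple \<open>e g\<close> of a strict subsolution rules out interior minima. The boundary is
  treated by the hypothesis that \<open>f - e g\<close> has no minimum at a boundary point where \<open>f < 0\<close>; for an
  oblique derivative condition it is enough that \<open>f - e g\<close> decreases into the domain, which may be due
  to \<open>g\<close> alone. Then \<open>f \<ge> - 2 e sup |g|\<close> for every \<open>e > 0\<close>.\<close>
lemma weak_minimum_principle:
  fixes f g :: "plane \<Rightarrow> real"
  assumes \<Omega>: "open \<Omega>" "bounded \<Omega>"
    and cf: "continuous_on (closure \<Omega>) f" and cg: "continuous_on (closure \<Omega>) g"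
    and L: "\<And>p. p \<in> \<Omega> \<Longrightarrow> strictly_sub f g p"
    and B: "\<And>p e. p \<in> frontier \<Omega> \<Longrightarrow> f p < 0 \<Longrightarrow> 0 < e \<Longrightarrow> \<exists>q\<in>closure \<Omega>. f q - e * g q < f p - e * g p"
    and p: "p \<in> \<Omega>"
  shows "0 \<le> f p"
proof -
  have comp: "compact (closure \<Omega>)" and ne: "closure \<Omega> \<noteq> {}" using \<Omega> p by (auto simp: compact_closure)
  obtain G where G: "\<And>q. q \<in> closure \<Omega> \<Longrightarrow> \<bar>g q\<bar> \<le> G"
    using compact_imp_bounded[OF compact_continuous_image[OF cg comp]] by (auto simp: bounded_iff)
  have main: "- e * (2 * G) \<le> f p" if e: "e > 0" for e
  proof -
    have "continuous_on (closure \<Omega>) (\<lambda>q. f q - e * g q)" by (intro continuous_intros cf cg)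
    then obtain q where q: "q \<in> closure \<Omega>" "\<And>x. x \<in> closure \<Omega> \<Longrightarrow> f q - e * g q \<le> f x - e * g x"
      using continuous_attains_inf[OF comp ne] by blast
    have "q \<notin> \<Omega>"
    proof
      assume q\<Omega>: "q \<in> \<Omega>"
      have "\<forall>\<^sub>F x in nhds q. f q - e * g q \<le> f x - e * g x"
        unfolding eventually_nhds using \<Omega>(1) q\<Omega> q(2) closure_subset by blast
      then show False using strictly_sub_no_local_min[OF L[OF q\<Omega>] e] by blast
    qed
    then have "q \<in> frontier \<Omega>" using q \<Omega> by (simp add: frontier_def interior_open)
    then have "0 \<le> f q" using B[of q e] q(2) e by (meson leD not_le)
    moreover have pc: "p \<in> closure \<Omega>" using p closure_subset by blast
    moreover have "e * g q \<le> e * G" "e * - G \<le> e * g p"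
      using G[OF q(1)] G[OF pc] e by (intro mult_left_mono; simp add: abs_le_iff)+
    ultimately show ?thesis using q(2)[of p] by (simp add: algebra_simps)
  qed
  show ?thesis
  proof (rule ccontr)
    assume n: "\<not> 0 \<le> f p"
    have "0 \<le> \<bar>g p\<bar>" by simp
    then have "0 \<le> G" using G[of p] p closure_subset by fastforce
    then have "- (- f p / (4 * G + 1)) * (2 * G) \<le> f p" using n by (intro main) (simp add: field_simps)
    then have "0 \<le> f p * (2 * G + 1)" using \<open>0 \<le> G\<close> by (simp add: field_simps)
    moreover have "f p * (2 * G + 1) < 0" using n \<open>0 \<le> G\<close> by (intro mult_neg_pos) auto
    ultimately show False by simp
  qed
qed

section \<open>The Jordan curve theorem in the real plane\<close>

lemma inside_homeomorphic_image_le: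
  fixes f :: "'a::real_normed_vector \<Rightarrow> 'b::real_normed_vector"
  assumes f: "continuous_on UNIV f" "continuous_on UNIV g" and fg: "\<And>x. g (f x) = x" "\<And>y. f (g y) = y"
    and b: "\<And>S. bounded S \<Longrightarrow> bounded (f ` S)"
  shows "f ` inside S \<subseteq> inside (f ` S)"
proof
  fix y assume "y \<in> f ` inside S"
  then obtain x where x: "y = f x" "x \<notin> S" "bounded (connected_component_set (- S) x)"
    unfolding inside_def by auto
  let ?C = "connected_component_set (- f ` S) y"
  have y: "y \<notin> f ` S" using x fg by (metis image_iff)
  have "connected (g ` ?C)"
    by (rule connected_continuous_image[OF continuous_on_subset[OF f(2)]]) auto
  moreover have "g ` ?C \<subseteq> - S"
  proof
    fix u assume "u \<in> g ` ?C"
    then obtain w where w: "u = g w" "w \<in> ?C" by blast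
    then have "w \<notin> f ` S" using connected_component_subset by fastforce
    then show "u \<in> - S" using w fg by (metis ComplI image_eqI)
  qed
  moreover have "x \<in> g ` ?C" using y x fg by (metis ComplI connected_component_refl image_eqI mem_Collect_eq)
  ultimately have "g ` ?C \<subseteq> connected_component_set (- S) x" by (intro connected_component_maximal)
  then have "bounded (f ` g ` ?C)" using x b bounded_subset by blast
  moreover have "f ` g ` ?C = ?C" using fg by (force simp: image_image)
  ultimately show "y \<in> inside (f ` S)" using y by (simp add: inside_def)
qed

lemma inside_homeomorphic_image:
  fixes f :: "'a::real_normed_vector \<Rightarrow> 'b::real_normed_vector"
  assumes f: "continuous_on UNIV f" "continuous_on UNIV g" and fg: "\<And>x. g (f x) = x" "\<And>y. f (g y) = y"
    and b: "\<And>S. bounded S \<Longrightarrow> bounded (f ` S)" "\<And>S. bounded S \<Longrightarrow> bounded (g ` S)"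
  shows "inside (f ` S) = f ` inside S"
proof (rule antisym)
  have "g ` inside (f ` S) \<subseteq> inside (g ` f ` S)"
    by (rule inside_homeomorphic_image_le[OF f(2,1) fg(2,1) b(2)])
  also have "g ` f ` S = S" using fg by (simp add: image_image)
  finally have "f ` g ` inside (f ` S) \<subseteq> f ` inside S" by blast
  then show "inside (f ` S) \<subseteq> f ` inside S" using fg by (simp add: image_image)
qed (rule inside_homeomorphic_image_le[OF f fg b(1)])

text \<open>The Jordan curve theorem for complex curves, transported along the isometry \<open>(x, y) \<mapsto> x + i y\<close>.\<close>
lemma Jordan_plane:
  fixes c :: "real \<Rightarrow> plane"
  assumes c: "simple_path c" "pathfinish c = pathstart c"
  shows "connected (inside (path_image c))" "frontier (inside (path_image c)) = path_image c"
proof -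
  define f where "f = (\<lambda>p::plane. Complex (fst p) (snd p))"
  define g where "g = (\<lambda>w. (Re w, Im w))"
  have lf: "bounded_linear f"
  proof (rule bounded_linear_intro[where K = 1])
    show "norm (f p) \<le> norm p * 1" for p by (simp add: f_def cmod_def norm_prod_def)
  qed (auto simp: f_def complex_eq_iff)
  have lg: "bounded_linear g"
  proof (rule bounded_linear_intro[where K = 1])
    show "norm (g p) \<le> norm p * 1" for p by (simp add: g_def cmod_def norm_prod_def)
  qed (auto simp: g_def)
  have fg: "g (f x) = x" "f (g y) = y" for x y by (simp_all add: f_def g_def)
  note cf = linear_continuous_on[OF lf] linear_continuous_on[OF lg]
  have in_eq: "inside (f ` path_image c) = f ` inside (path_image c)"
    by (rule inside_homeomorphic_image[OF cf fg])
      (auto intro: bounded_linear_image lf lg)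
  have inj: "inj f" by (metis fg(1) injI)
  have "simple_path (f \<circ> c)"
    using simple_path_linear_image_eq[OF bounded_linear.linear[OF lf] inj] c by blast
  moreover have "pathfinish (f \<circ> c) = pathstart (f \<circ> c)"
    using c by (simp add: pathfinish_def pathstart_def)
  ultimately have J: "connected (inside (path_image (f \<circ> c)))" "frontier (inside (path_image (f \<circ> c))) = path_image (f \<circ> c)"
    using Jordan_inside_outside by blast+
  have pi: "path_image (f \<circ> c) = f ` path_image c" by (simp add: path_image_compose)
  have gf: "S = g ` f ` S" for S using fg by (simp add: image_image)
  have "connected (g ` inside (f ` path_image c))"
    by (rule connected_continuous_image[OF continuous_on_subset[OF cf(2)] J(1)[unfolded pi]]) auto
  then show "connected (inside (path_image c))" unfolding in_eq gf[symmetric] .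
  have "f ` frontier (inside (path_image c)) = frontier (f ` inside (path_image c))"
  proof -
    have "closed (f ` path_image c)" "closed (path_image c)"
      using c \<open>simple_path (f \<circ> c)\<close> unfolding pi[symmetric] by (simp_all add: closed_simple_path_image)
    then have "open (f ` inside (path_image c))" "open (inside (path_image c))"
      unfolding in_eq[symmetric] by (simp_all add: open_inside)
    moreover have "f ` closure S = closure (f ` S)" for S
      using closure_injective_linear_image[OF bounded_linear.linear[OF lf] inj] .
    ultimately show ?thesis by (simp add: frontier_def interior_open image_set_diff[OF inj])
  qed
  then have "f ` frontier (inside (path_image c)) = f ` path_image c"
    using J(2) unfolding pi in_eq by simp
  then show "frontier (inside (path_image c)) = path_image c"
    using gf by metis
qed

lemma connected_subset_inside:
  assumes "connected H" "H \<inter> J = {}" "H \<inter> inside J \<noteq> {}"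
  shows "H \<subseteq> inside J"
proof
  fix x assume "x \<in> H"
  obtain y where y: "y \<in> H" "y \<in> inside J" using assms by blast
  have "connected_component (- J) y x"
    unfolding connected_component_def using assms y \<open>x \<in> H\<close> by (intro exI[of _ H]) auto
  then show "x \<in> inside J" using y inside_same_component by blast
qed

lemma complement_convex_subset_outside:
  fixes J :: "'a :: {real_normed_vector, perfect_space} set"
  assumes "convex C" "J \<subseteq> C"
  shows "- C \<subseteq> outside J"
  using outside_convex[OF assms(1)] outside_mono[OF assms(2)] by blast

section \<open>A circular sector and the curved triangle outside it\<close>

text \<open>A circle of center \<open>z\<close> and radius \<open>c\<close> with two independent radii \<open>A\<close> and \<open>B\<close>, and the point
  \<open>tip = z + \<kappa> B\<close> outside the circle. They stand for the sonic circle, the points \<open>P\<^sub>1\<close> and \<open>P\<^sub>4\<close> on it, and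
  the point \<open>P\<^sub>0\<close>. In the affine coordinates \<open>\<alpha>\<close>, \<open>\<beta>\<close> with respect to \<open>A\<close>, \<open>B\<close> the arc from
  \<open>z + A\<close> to \<open>z + B\<close> and the two segments issuing from the tip are described by simple inequalities.\<close>
locale sector =
  fixes z A B :: plane and c \<kappa> :: real
  assumes c: "0 < c" and \<kappa>: "1 < \<kappa>" and nA: "norm A = c" and nB: "norm B = c"
    and det: "fst A * snd B - snd A * fst B \<noteq> 0"
begin

definition \<alpha> :: "plane \<Rightarrow> real" where
  "\<alpha> q = ((fst q - fst z) * snd B - (snd q - snd z) * fst B) / (fst A * snd B - snd A * fst B)"

definition \<beta> :: "plane \<Rightarrow> real" where
  "\<beta> q = (fst A * (snd q - snd z) - snd A * (fst q - fst z)) / (fst A * snd B - snd A * fst B)"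

lemma coords: "q = z + \<alpha> q *\<^sub>R A + \<beta> q *\<^sub>R B"
proof -
  let ?d = "fst A * snd B - snd A * fst B"
  have "\<alpha> q * ?d = (fst q - fst z) * snd B - (snd q - snd z) * fst B"
    "\<beta> q * ?d = fst A * (snd q - snd z) - snd A * (fst q - fst z)"
    using det by (simp_all add: \<alpha>_def \<beta>_def)
  then have "(\<alpha> q * fst A + \<beta> q * fst B) * ?d = (fst q - fst z) * ?d"
    "(\<alpha> q * snd A + \<beta> q * snd B) * ?d = (snd q - snd z) * ?d" by algebra+
  then show ?thesis using det by (intro prod_eqI) auto
qed

lemma \<alpha>_eq: "\<alpha> (z + a *\<^sub>R A + b *\<^sub>R B) = a" and \<beta>_eq: "\<beta> (z + a *\<^sub>R A + b *\<^sub>R B) = b"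
  using det by (simp_all add: \<alpha>_def \<beta>_def field_simps)

lemma coords_eqI: "q = z + a *\<^sub>R A + b *\<^sub>R B \<Longrightarrow> \<alpha> q = a \<and> \<beta> q = b"
  using \<alpha>_eq \<beta>_eq by simp

lemma norm_coords: "norm (q - z) = norm (\<alpha> q *\<^sub>R A + \<beta> q *\<^sub>R B)"
  using arg_cong[OF coords[of q], of "\<lambda>x. norm (x - z)"] by (simp add: add.assoc)

lemma continuous_on_coords [continuous_intros]:
  "continuous_on S f \<Longrightarrow> continuous_on S (\<lambda>x. \<alpha> (f x))" "continuous_on S f \<Longrightarrow> continuous_on S (\<lambda>x. \<beta> (f x))"
  unfolding \<alpha>_def \<beta>_def using det by (intro continuous_intros; simp)+

definition tip :: plane where "tip = z + \<kappa> *\<^sub>R B"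

text \<open>The part outside the disc of the open triangle with vertices \<open>z\<close>, \<open>z + A\<close> and \<open>tip\<close>.\<close>
definition Tri :: "plane set" where
  "Tri = {q. 0 < \<alpha> q \<and> 0 < \<beta> q \<and> \<alpha> q + \<beta> q / \<kappa> < 1 \<and> c < norm (q - z)}"

definition tri_bd :: "plane set" where
  "tri_bd = closed_segment tip (z + A) \<union> closed_segment tip (z + B) \<union> circle_arc z c (z + A) (z + B)"

lemma circle_arc_iff: "q \<in> circle_arc z c (z + A) (z + B) \<longleftrightarrow> norm (q - z) = c \<and> 0 \<le> \<alpha> q \<and> 0 \<le> \<beta> q"
proof
  assume "q \<in> circle_arc z c (z + A) (z + B)"
  then obtain s t where "norm (q - z) = c" "0 \<le> s" "0 \<le> t" "q = z + s *\<^sub>R A + t *\<^sub>R B"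
    by (auto simp: circle_arc_def dist_norm norm_minus_commute)
  then show "norm (q - z) = c \<and> 0 \<le> \<alpha> q \<and> 0 \<le> \<beta> q" using coords_eqI by auto
next
  assume "norm (q - z) = c \<and> 0 \<le> \<alpha> q \<and> 0 \<le> \<beta> q"
  then show "q \<in> circle_arc z c (z + A) (z + B)"
    using coords[of q] unfolding circle_arc_def by (auto simp: dist_norm norm_minus_commute)
qed

lemma segment_tip_A: "q \<in> closed_segment tip (z + A) \<longleftrightarrow> 0 \<le> \<alpha> q \<and> 0 \<le> \<beta> q \<and> \<alpha> q + \<beta> q / \<kappa> = 1"
proof
  assume "q \<in> closed_segment tip (z + A)"
  then obtain u where u: "0 \<le> u" "u \<le> 1" "q = (1 - u) *\<^sub>R tip + u *\<^sub>R (z + A)" by (auto simp: in_segment)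
  then have "q = z + u *\<^sub>R A + ((1 - u) * \<kappa>) *\<^sub>R B" by (simp add: tip_def algebra_simps)
  with u \<kappa> show "0 \<le> \<alpha> q \<and> 0 \<le> \<beta> q \<and> \<alpha> q + \<beta> q / \<kappa> = 1" using coords_eqI by fastforce
next
  assume q: "0 \<le> \<alpha> q \<and> 0 \<le> \<beta> q \<and> \<alpha> q + \<beta> q / \<kappa> = 1"
  then have b: "\<beta> q = (1 - \<alpha> q) * \<kappa>" using \<kappa> by (simp add: field_simps)
  have "z + \<alpha> q *\<^sub>R A + \<beta> q *\<^sub>R B = (1 - \<alpha> q) *\<^sub>R tip + \<alpha> q *\<^sub>R (z + A)"
    unfolding b by (simp add: tip_def algebra_simps)
  then have "q = (1 - \<alpha> q) *\<^sub>R tip + \<alpha> q *\<^sub>R (z + A)"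
    using coords[of q] by simp
  moreover have "\<alpha> q \<le> 1" using q b \<kappa> by (smt (verit) divide_nonneg_pos)
  ultimately show "q \<in> closed_segment tip (z + A)" using q unfolding in_segment by blast
qed

lemma segment_tip_B: "q \<in> closed_segment tip (z + B) \<longleftrightarrow> \<alpha> q = 0 \<and> 1 \<le> \<beta> q \<and> \<beta> q \<le> \<kappa>"
proof
  assume "q \<in> closed_segment tip (z + B)"
  then obtain u where u: "0 \<le> u" "u \<le> 1" "q = (1 - u) *\<^sub>R tip + u *\<^sub>R (z + B)" by (auto simp: in_segment)
  then have "q = z + 0 *\<^sub>R A + ((1 - u) * \<kappa> + u) *\<^sub>R B" by (simp add: tip_def algebra_simps)
  then have "\<alpha> q = 0" "\<beta> q = (1 - u) * \<kappa> + u" using coords_eqI by blast+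
  moreover have "(1 - u) * 1 \<le> (1 - u) * \<kappa>" by (rule mult_left_mono) (use u \<kappa> in auto)
  moreover have "0 \<le> u * (\<kappa> - 1)" using u \<kappa> by simp
  ultimately show "\<alpha> q = 0 \<and> 1 \<le> \<beta> q \<and> \<beta> q \<le> \<kappa>" by (simp add: algebra_simps)
next
  assume q: "\<alpha> q = 0 \<and> 1 \<le> \<beta> q \<and> \<beta> q \<le> \<kappa>"
  define u where "u = (\<kappa> - \<beta> q) / (\<kappa> - 1)"
  have u: "0 \<le> u" "u \<le> 1" using q \<kappa> by (auto simp: u_def)
  have "u * (\<kappa> - 1) = \<kappa> - \<beta> q" using \<kappa> by (simp add: u_def)
  then have b: "\<beta> q = (1 - u) * \<kappa> + u" by (simp add: algebra_simps)
  have "z + \<beta> q *\<^sub>R B = (1 - u) *\<^sub>R tip + u *\<^sub>R (z + B)"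
    unfolding b by (simp add: tip_def algebra_simps)
  then have "q = (1 - u) *\<^sub>R tip + u *\<^sub>R (z + B)"
    using coords[of q] q by simp
  then show "q \<in> closed_segment tip (z + B)" using u unfolding in_segment by blast
qed

lemma open_Tri: "open Tri"
  unfolding Tri_def by (intro open_Collect_conj open_Collect_less continuous_intros) (use \<kappa> in auto)

lemma bounded_Tri: "bounded Tri"
proof (rule boundedI)
  fix q assume q: "q \<in> Tri"
  then have "0 < \<alpha> q" "0 < \<beta> q" "\<alpha> q + \<beta> q / \<kappa> < 1" by (auto simp: Tri_def)
  then have "\<alpha> q \<le> 1" "\<beta> q / \<kappa> \<le> 1" using \<kappa> divide_pos_pos[of "\<beta> q" \<kappa>] by linarith+
  then have "\<beta> q \<le> \<kappa>" using \<kappa> by (simp add: field_simps)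
  have "norm q \<le> norm z + \<alpha> q * c + \<beta> q * c"
    using coords[of q] norm_triangle_ineq[of "z + \<alpha> q *\<^sub>R A" "\<beta> q *\<^sub>R B"] norm_triangle_ineq[of z "\<alpha> q *\<^sub>R A"]
      \<open>0 < \<alpha> q\<close> \<open>0 < \<beta> q\<close> nA nB by simp
  also have "\<dots> \<le> norm z + 1 * c + \<kappa> * c"
    using \<open>\<alpha> q \<le> 1\<close> \<open>\<beta> q \<le> \<kappa>\<close> c by (intro add_mono mult_right_mono) auto
  finally show "norm q \<le> norm z + 1 * c + \<kappa> * c" .
qed

lemma frontier_Tri: "frontier Tri \<subseteq> tri_bd"
proof
  fix q assume "q \<in> frontier Tri"
  then have qn: "q \<notin> Tri" and qc: "q \<in> closure Tri" using open_Tri by (auto simp: frontier_def interior_open)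
  have "closure Tri \<subseteq> {q. 0 \<le> \<alpha> q \<and> 0 \<le> \<beta> q \<and> \<alpha> q + \<beta> q / \<kappa> \<le> 1 \<and> c \<le> norm (q - z)}"
  proof (rule closure_minimal)
    show "closed {q. 0 \<le> \<alpha> q \<and> 0 \<le> \<beta> q \<and> \<alpha> q + \<beta> q / \<kappa> \<le> 1 \<and> c \<le> norm (q - z)}"
      by (intro closed_Collect_conj closed_Collect_le continuous_intros) (use \<kappa> in auto)
  qed (auto simp: Tri_def)
  with qc have q: "0 \<le> \<alpha> q" "0 \<le> \<beta> q" "\<alpha> q + \<beta> q / \<kappa> \<le> 1" "c \<le> norm (q - z)" by auto
  consider "\<alpha> q = 0" | "\<beta> q = 0" | "\<alpha> q + \<beta> q / \<kappa> = 1" | "norm (q - z) = c"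
    using q qn by (force simp: Tri_def)
  then show "q \<in> tri_bd"
  proof cases
    case 1
    then have "c \<le> \<beta> q * c" using q norm_coords[of q] nB by simp
    then have "1 \<le> \<beta> q" using c by simp
    moreover have "\<beta> q \<le> \<kappa>" using q 1 \<kappa> by (simp add: field_simps)
    ultimately show ?thesis using 1 segment_tip_B by (auto simp: tri_bd_def)
  next
    case 2
    then have "c \<le> \<alpha> q * c" using q norm_coords[of q] nA by simp
    then have "1 \<le> \<alpha> q" using c by simp
    then show ?thesis using 2 q segment_tip_A by (auto simp: tri_bd_def)
  qed (use q segment_tip_A circle_arc_iff in \<open>auto simp: tri_bd_def\<close>)
qed

lemma Tri_disjoint_tri_bd: "Tri \<inter> tri_bd = {}"
  by (auto simp: Tri_def tri_bd_def segment_tip_A segment_tip_B circle_arc_iff)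

text \<open>An open bounded set lies inside its frontier, and the frontier consists of points of the boundary curve.\<close>
lemma Tri_subset_inside: "Tri \<subseteq> inside tri_bd"
proof -
  have "Tri \<subseteq> inside (frontier Tri)"
    using interior_inside_frontier[OF bounded_Tri] open_Tri by (simp add: interior_open)
  then show ?thesis using inside_mono[OF frontier_Tri] Tri_disjoint_tri_bd by blast
qed

text \<open>The curved triangle is star-shaped with respect to its tip.\<close>
lemma Tri_star:
  assumes q: "q \<in> Tri" and l: "0 \<le> l" "l < 1"
  shows "q + l *\<^sub>R (tip - q) \<in> Tri"
proof -
  define q' where "q' = q + l *\<^sub>R (tip - q)"
  note q1 = q[unfolded Tri_def mem_Collect_eq]
  have "q' = (1 - l) *\<^sub>R (z + \<alpha> q *\<^sub>R A + \<beta> q *\<^sub>R B) + l *\<^sub>R tip"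
    unfolding q'_def using coords[of q] by (metis (no_types, lifting) add.commute add_diff_eq diff_add_eq diff_diff_eq2 scaleR_left_diff_distrib scaleR_one scaleR_right_diff_distrib)
  then have "q' = z + ((1 - l) * \<alpha> q) *\<^sub>R A + ((1 - l) * \<beta> q + l * \<kappa>) *\<^sub>R B"
    by (simp add: tip_def algebra_simps)
  then have ab: "\<alpha> q' = (1 - l) * \<alpha> q" "\<beta> q' = (1 - l) * \<beta> q + l * \<kappa>" using coords_eqI by blast+
  have "0 < \<alpha> q'" "0 < \<beta> q'" using ab q1 l \<kappa> by (simp_all add: add_pos_nonneg)
  moreover have "\<alpha> q' + \<beta> q' / \<kappa> < 1"
  proof -
    have "\<alpha> q' + \<beta> q' / \<kappa> = (1 - l) * (\<alpha> q + \<beta> q / \<kappa>) + l" using \<kappa> by (simp add: ab add_divide_distrib diff_divide_distrib algebra_simps)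
    moreover have "(1 - l) * (\<alpha> q + \<beta> q / \<kappa>) < (1 - l) * 1" using q1 l by (intro mult_strict_left_mono) auto
    ultimately show ?thesis by simp
  qed
  moreover have "c < norm (q' - z)"
  proof (rule ccontr)
    assume n: "\<not> c < norm (q' - z)"
    \<comment> \<open>The ray from the tip through \<open>q\<close> reaches the radius \<open>\<beta> = 0\<close> at a point \<open>w\<close> of the disc.
        If it had met the disc already before \<open>q\<close>, then \<open>q\<close> would lie in the disc by convexity.\<close>
    have "\<beta> q / \<kappa> < 1" using q1 by linarith
    then have bk: "\<beta> q < \<kappa>" using \<kappa> by simp
    define t where "t = \<kappa> / (\<kappa> - \<beta> q)"
    have t1: "1 < t" using q1 bk by (simp add: t_def)
    have tk: "t * (\<kappa> - \<beta> q) = \<kappa>" using bk by (simp add: t_def)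
    define w where "w = tip + t *\<^sub>R (q - tip)"
    have "w = tip + t *\<^sub>R (z + \<alpha> q *\<^sub>R A + \<beta> q *\<^sub>R B - tip)"
      using coords[of q] by (simp add: w_def)
    also have "\<dots> = z + (t * \<alpha> q) *\<^sub>R A + (\<kappa> - t * (\<kappa> - \<beta> q)) *\<^sub>R B" by (simp add: tip_def algebra_simps)
    finally have w: "w = z + (t * \<alpha> q) *\<^sub>R A" unfolding tk by simp
    have "\<alpha> q * \<kappa> < \<kappa> - \<beta> q" using q1 \<kappa> by (simp add: field_simps)
    then have "t * \<alpha> q \<le> 1" using bk by (simp add: t_def field_simps)
    then have "norm (w - z) \<le> c" using w q1 t1 nA c by (simp add: mult_le_cancel_right1)
    define m where "m = l / (t - 1 + l)"
    have m: "0 \<le> m" "m \<le> 1" using t1 l by (auto simp: m_def)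
    have "q - z = (1 - m) *\<^sub>R (q' - z) + m *\<^sub>R (w - z)"
    proof -
      have q'w: "q' - q = l *\<^sub>R (tip - q)" "w - q = - ((t - 1) *\<^sub>R (tip - q))"
        by (simp_all add: q'_def w_def algebra_simps)
      have "(1 - m) * l = m * (t - 1)" using t1 l by (simp add: m_def field_simps)
      then have "(1 - m) *\<^sub>R (q' - q) + m *\<^sub>R (w - q) = 0" unfolding q'w by simp
      then show ?thesis by (simp add: algebra_simps)
    qed
    then have "norm (q - z) \<le> (1 - m) * norm (q' - z) + m * norm (w - z)"
      using norm_triangle_ineq[of "(1 - m) *\<^sub>R (q' - z)" "m *\<^sub>R (w - z)"] m by simp
    also have "\<dots> \<le> (1 - m) * c + m * c"
      using n \<open>norm (w - z) \<le> c\<close> m by (intro add_mono mult_left_mono) auto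
    finally show False using q1 by (simp add: algebra_simps)
  qed
  ultimately show ?thesis by (simp add: Tri_def q'_def)
qed

text \<open>The segments to the tip and a small disc about the tip connect the curved triangle to the outside of \<open>J\<close>.\<close>
lemma Tri_subset_outside:
  assumes J: "closed J" "J \<inter> Tri = {}" "tip \<notin> J" and tip: "tip \<in> closure (outside J)"
  shows "Tri \<subseteq> outside J"
proof
  fix q assume q: "q \<in> Tri"
  obtain e where e: "e > 0" "ball tip e \<subseteq> - J" using J(1,3) open_contains_ball[of "- J"] by (metis ComplI open_Compl)
  obtain w where w: "w \<in> outside J" "dist w tip < e" using tip e closure_approachable by blast
  have "closed_segment q tip \<subseteq> - J"
  proof
    fix x assume "x \<in> closed_segment q tip"
    then obtain l where l: "0 \<le> l" "l \<le> 1" "x = (1 - l) *\<^sub>R q + l *\<^sub>R tip" by (auto simp: in_segment)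
    then have x: "x = q + l *\<^sub>R (tip - q)" by (simp add: algebra_simps)
    show "x \<in> - J"
    proof (cases "l = 1")
      case True then show ?thesis using x J by simp
    next
      case False then show ?thesis using Tri_star[OF q, of l] l x J by auto
    qed
  qed
  then have "closed_segment q tip \<union> ball tip e \<subseteq> - J" using e by blast
  moreover have "connected (closed_segment q tip \<union> ball tip e)"
    by (rule connected_Un) (use e in auto)
  moreover have "w \<in> ball tip e" using w by (simp add: dist_commute)
  ultimately have "connected_component (- J) w q"
    unfolding connected_component_def by (intro exI[of _ "closed_segment q tip \<union> ball tip e"]) auto
  then show "q \<in> outside J" using w outside_same_component by blast
qed

text \<open>The arc from \<open>z + B\<close> to \<open>z + A\<close>, as the central projection of the chord; the parameter is recovered as
  \<open>\<alpha> / (\<alpha> + \<beta>)\<close>.\<close>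
definition carc :: "real \<Rightarrow> plane" where
  "carc t = z + (c / norm ((1 - t) *\<^sub>R B + t *\<^sub>R A)) *\<^sub>R ((1 - t) *\<^sub>R B + t *\<^sub>R A)"

lemma carc_nonzero: "(1 - t) *\<^sub>R B + t *\<^sub>R A \<noteq> 0"
proof
  assume "(1 - t) *\<^sub>R B + t *\<^sub>R A = 0"
  then have "z = z + t *\<^sub>R A + (1 - t) *\<^sub>R B" by (simp add: add.commute)
  then have "\<alpha> z = t" "\<beta> z = 1 - t" using coords_eqI by blast+
  moreover have "\<alpha> z = 0" "\<beta> z = 0" by (simp_all add: \<alpha>_def \<beta>_def)
  ultimately show False by simp
qed

lemma carc_coords:
  defines "n \<equiv> \<lambda>t. c / norm ((1 - t) *\<^sub>R B + t *\<^sub>R A)"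
  shows "\<alpha> (carc t) = n t * t" "\<beta> (carc t) = n t * (1 - t)" "0 < n t"
proof -
  have "carc t = z + (n t * t) *\<^sub>R A + (n t * (1 - t)) *\<^sub>R B"
    by (simp add: carc_def n_def scaleR_add_right add.commute)
  then show "\<alpha> (carc t) = n t * t" "\<beta> (carc t) = n t * (1 - t)" using coords_eqI by blast+
  show "0 < n t" using c carc_nonzero by (simp add: n_def)
qed

lemma arc_carc: "arc carc" and path_image_carc: "path_image carc = circle_arc z c (z + A) (z + B)"
  and pathstart_carc: "pathstart carc = z + B" and pathfinish_carc: "pathfinish carc = z + A"
proof -
  have "path carc" unfolding path_def carc_def using carc_nonzero by (intro continuous_intros) auto
  moreover have "inj_on carc {0..1}"
  proof (rule inj_on_inverseI[where g = "\<lambda>q. \<alpha> q / (\<alpha> q + \<beta> q)"])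
    fix t
    have "\<alpha> (carc t) + \<beta> (carc t) = c / norm ((1 - t) *\<^sub>R B + t *\<^sub>R A)"
      unfolding carc_coords by (simp only: distrib_left[symmetric]) simp
    then show "\<alpha> (carc t) / (\<alpha> (carc t) + \<beta> (carc t)) = t"
      using c carc_nonzero[of t] by (simp add: carc_coords)
  qed
  ultimately show "arc carc" by (simp add: arc_def)
  show "pathstart carc = z + B" "pathfinish carc = z + A"
    using c nA nB by (simp_all add: pathstart_def pathfinish_def carc_def)
  show "path_image carc = circle_arc z c (z + A) (z + B)"
  proof (intro antisym subsetI)
    fix q assume "q \<in> path_image carc"
    then obtain t where t: "0 \<le> t" "t \<le> 1" "q = carc t" by (auto simp: path_image_def)
    have "norm (carc t - z) = c" using c carc_nonzero by (simp add: carc_def)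
    then show "q \<in> circle_arc z c (z + A) (z + B)"
      using t c by (simp add: circle_arc_iff carc_coords)
  next
    fix q assume "q \<in> circle_arc z c (z + A) (z + B)"
    then have q: "norm (q - z) = c" "0 \<le> \<alpha> q" "0 \<le> \<beta> q" by (auto simp: circle_arc_iff)
    have "\<alpha> q + \<beta> q \<noteq> 0"
    proof
      assume "\<alpha> q + \<beta> q = 0"
      then have "\<alpha> q = 0" "\<beta> q = 0" using q by linarith+
      then show False using norm_coords[of q] q c by simp
    qed
    then have s: "0 < \<alpha> q + \<beta> q" using q by linarith
    define t where "t = \<alpha> q / (\<alpha> q + \<beta> q)"
    have t: "0 \<le> t" "t \<le> 1" using s q by (auto simp: t_def)
    have ts: "(\<alpha> q + \<beta> q) * t = \<alpha> q" "(\<alpha> q + \<beta> q) * (1 - t) = \<beta> q" using s by (auto simp: t_def field_simps)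
    let ?v = "(1 - t) *\<^sub>R B + t *\<^sub>R A"
    have sv: "(\<alpha> q + \<beta> q) *\<^sub>R ?v = q - z"
      using coords[of q] unfolding scaleR_add_right scaleR_scaleR ts
      by (metis (no_types, lifting) add.commute add_diff_cancel_left' add.left_commute)
    then have "(\<alpha> q + \<beta> q) * norm ?v = c" using q s by (metis abs_of_pos norm_scaleR)
    then have "c / norm ?v = \<alpha> q + \<beta> q" using carc_nonzero[of t] by (simp add: field_simps)
    then have "carc t = q" using sv by (simp add: carc_def)
    then show "q \<in> path_image carc" using t by (auto simp: path_image_def)
  qed
qed

text \<open>A point of the arc with \<open>\<alpha> + \<beta> / \<kappa> \<ge> 1\<close> could be shrunk towards \<open>z\<close> to a point of the segment from the tip
  to \<open>z + A\<close>, which would then have a point other than \<open>z + A\<close> in the disc, against the hypothesis.\<close>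
lemma arc_interior_coords:
  assumes supersonic_P0_P1: "\<And>q. q \<in> closed_segment tip (z + A) - {z + A} \<Longrightarrow> c < norm (q - z)"
    and p: "p \<in> circle_arc z c (z + A) (z + B) - {z + A, z + B}"
  shows "0 < \<alpha> p" "0 < \<beta> p" "\<alpha> p + \<beta> p / \<kappa> < 1"
proof -
  have n: "norm (p - z) = c" and ab: "0 \<le> \<alpha> p" "0 \<le> \<beta> p" using p by (auto simp: circle_arc_iff)
  have "\<alpha> p \<noteq> 0"
  proof
    assume a: "\<alpha> p = 0"
    then have "\<beta> p = 1" using n norm_coords[of p] nB c ab by simp
    then show False using a p coords[of p] by simp
  qed
  then show a: "0 < \<alpha> p" using ab by simp
  have "\<beta> p \<noteq> 0"
  proof
    assume b: "\<beta> p = 0"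
    then have "\<alpha> p = 1" using n norm_coords[of p] nA c ab by simp
    then show False using b p coords[of p] by simp
  qed
  then show b: "0 < \<beta> p" using ab by simp
  show "\<alpha> p + \<beta> p / \<kappa> < 1"
  proof (rule ccontr)
    define m where "m = \<alpha> p + \<beta> p / \<kappa>"
    assume "\<not> \<alpha> p + \<beta> p / \<kappa> < 1"
    then have m: "1 \<le> m" by (simp add: m_def)
    define q where "q = z + (\<alpha> p / m) *\<^sub>R A + (\<beta> p / m) *\<^sub>R B"
    have q: "\<alpha> q = \<alpha> p / m" "\<beta> q = \<beta> p / m" using coords_eqI[OF q_def] by auto
    have "\<alpha> p / m + \<beta> p / m / \<kappa> = (\<alpha> p + \<beta> p / \<kappa>) / m" by (simp add: add_divide_distrib)
    then have "\<alpha> q + \<beta> q / \<kappa> = 1" using m unfolding q by (simp add: m_def[symmetric])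
    then have "q \<in> closed_segment tip (z + A)" using a b m q by (simp add: segment_tip_A)
    moreover have "q \<noteq> z + A"
    proof
      assume "q = z + A"
      then have "\<beta> q = 0" using coords_eqI[of q 1 0] by simp
      then show False using q b m by simp
    qed
    ultimately have "c < norm (q - z)" using supersonic_P0_P1 by blast
    moreover have "q - z = (1 / m) *\<^sub>R (p - z)"
      using arg_cong[OF coords[of p], of "\<lambda>x. (1 / m) *\<^sub>R (x - z)"] by (simp add: q_def scaleR_add_right add.assoc)
    then have "norm (q - z) = c / m" using n m by simp
    moreover have "c / m \<le> c" using m c by (simp add: field_simps)
    ultimately show False by simp
  qed
qed

lemma near_arc_interior:
  assumes supersonic_P0_P1: "\<And>q. q \<in> closed_segment tip (z + A) - {z + A} \<Longrightarrow> c < norm (q - z)"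
    and p: "p \<in> circle_arc z c (z + A) (z + B) - {z + A, z + B}"
  obtains k where "k > 0" "\<And>q. q \<in> ball p k \<Longrightarrow> norm (q - z) = c \<Longrightarrow> q \<in> circle_arc z c (z + A) (z + B) - {z + A, z + B}"
    "\<And>q. q \<in> ball p k \<Longrightarrow> c < norm (q - z) \<Longrightarrow> q \<in> Tri"
proof -
  let ?N = "{q. 0 < \<alpha> q \<and> 0 < \<beta> q \<and> \<alpha> q + \<beta> q / \<kappa> < 1}"
  have "open ?N"
    by (intro open_Collect_conj open_Collect_less continuous_intros) (use \<kappa> in auto)
  moreover have "p \<in> ?N" using arc_interior_coords[OF supersonic_P0_P1 p] by simp
  ultimately obtain k where k: "k > 0" "ball p k \<subseteq> ?N" using open_contains_ball by blast
  show ?thesis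
  proof (rule that[OF k(1)])
    fix q assume q: "q \<in> ball p k"
    then have N: "0 < \<alpha> q" "0 < \<beta> q" "\<alpha> q + \<beta> q / \<kappa> < 1" using k by auto
    have "q \<noteq> z + A" "q \<noteq> z + B" using N coords_eqI[of q 1 0] coords_eqI[of q 0 1] by auto
    then show "q \<in> circle_arc z c (z + A) (z + B) - {z + A, z + B}" if "norm (q - z) = c"
      using that N by (simp add: circle_arc_iff)
    show "q \<in> Tri" if "c < norm (q - z)" using that N by (simp add: Tri_def)
  qed
qed

end

section \<open>The geometry of regular reflection\<close>

lemma phi1_eq_phi2: "phi1 u x0 = phi2 u x0 0"
  by (rule ext) (simp add: phi1_def phi2_def)

lemma grad_phi1: "grad (phi1 u x0) p = (u - fst p, - snd p)"
  unfolding phi1_eq_phi2 grad_phi2 by simp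

lemma grad_phi2_center: "grad (phi2 u2 x0 \<theta>) p = sonic_center \<theta> u2 - p"
  by (simp add: grad_phi2 sonic_center_def minus_prod_def)

definition wedge_normal :: "real \<Rightarrow> plane" where "wedge_normal \<theta> = (- sin \<theta>, cos \<theta>)"

text \<open>The geometric part of a regular reflection solution. The inequality \<open>u1 < x0\<close> follows from the formula
  for the position of the incident shock.\<close>
locale reflection_geometry =
  fixes \<gamma> \<rho>0 \<rho>1 u1 x0 \<theta> u2 :: real and P1 :: plane and \<sigma> :: "real \<Rightarrow> plane"
  assumes \<gamma>: "1 < \<gamma>" and \<rho>1: "0 < \<rho>1" and \<theta>: "0 < \<theta>" "\<theta> < pi / 2" and u1: "0 < u1" "u1 < x0"
    and adm: "state2_admissible \<gamma> \<rho>0 \<rho>1 u1 x0 \<theta> u2 P1"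
    and shock: "shock_curve \<gamma> \<rho>0 x0 \<theta> u2 P1 \<sigma>"
begin

abbreviation "cc \<equiv> c2 \<gamma> \<rho>0 x0 \<theta> u2"
abbreviation "zz \<equiv> sonic_center \<theta> u2"
abbreviation "p4 \<equiv> P4 \<gamma> \<rho>0 x0 \<theta> u2"
abbreviation "p2 \<equiv> pathfinish \<sigma>"
abbreviation "Arc \<equiv> sonic_arc \<gamma> \<rho>0 x0 \<theta> u2 P1"
abbreviation "Arc_int \<equiv> sonic_arc_interior \<gamma> \<rho>0 x0 \<theta> u2 P1"
abbreviation "\<Omega> \<equiv> Omega \<gamma> \<rho>0 x0 \<theta> u2 P1 \<sigma>"
abbreviation "Reg2 \<equiv> region2 \<gamma> \<rho>0 x0 \<theta> u2 P1"
abbreviation "nu \<equiv> wedge_normal \<theta>"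

text \<open>The curve that bounds \<open>\<Omega>\<close>.\<close>
definition "J = path_image \<sigma> \<union> closed_segment p2 P3 \<union> closed_segment P3 p4 \<union> Arc"

lemma trig: "0 < sin \<theta>" "0 < cos \<theta>" "0 < tan \<theta>" "tan \<theta> = sin \<theta> / cos \<theta>"
proof -
  show "0 < sin \<theta>" "0 < cos \<theta>" using \<theta> by (simp_all add: sin_gt_zero2 cos_gt_zero)
  then show "0 < tan \<theta>" "tan \<theta> = sin \<theta> / cos \<theta>" by (simp_all add: tan_def)
qed

lemma nu_inner: "nu \<bullet> p = snd p * cos \<theta> - fst p * sin \<theta>"
  by (simp add: wedge_normal_def inner_prod_def)

lemma nu_nu: "nu \<bullet> nu = 1"
  by (simp add: nu_inner) (simp add: wedge_normal_def power2_eq_square[symmetric])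

lemma norm_nu: "norm nu = 1"
  using nu_nu by (simp add: norm_eq_1)

lemma Lam_iff: "p \<in> Lam \<theta> \<longleftrightarrow> 0 < snd p \<and> 0 < nu \<bullet> p"
  using trig(2) unfolding Lam_def trig(4) by (simp add: nu_inner field_simps)

lemma u2: "0 < u2" and S2: "0 < sound_sq_of \<gamma> \<rho>0 (phi2 u2 x0 \<theta>) p" and rho21: "\<rho>1 < rho2 \<gamma> \<rho>0 x0 \<theta> u2"
  and P1Lam: "P1 \<in> Lam \<theta>" and P1c: "norm (P1 - zz) = cc"
proof -
  show "0 < sound_sq_of \<gamma> \<rho>0 (phi2 u2 x0 \<theta>) p" using adm unfolding state2_admissible_def by blast
qed (use adm in \<open>simp_all add: state2_admissible_def dist_norm norm_minus_commute\<close>)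

lemma supersonic_P0_P1: "q \<in> closed_segment (P0 x0 \<theta>) P1 - {P1} \<Longrightarrow> cc < norm (q - zz)"
  using adm unfolding state2_admissible_def grad_phi2_center by (simp add: norm_minus_commute)

lemma cc_pos: "0 < cc"
  using rho21 \<rho>1 by (simp add: c2_def)

lemma cc_square: "cc\<^sup>2 = sound_sq_of \<gamma> \<rho>0 (phi2 u2 x0 \<theta>) p"
proof -
  have "rho2 \<gamma> \<rho>0 x0 \<theta> u2 = sound_sq_of \<gamma> \<rho>0 (phi2 u2 x0 \<theta>) p powr (1 / (\<gamma> - 1))"
    using rho_of_phi2[of \<gamma> \<rho>0 u2 x0 \<theta> p] by (simp add: rho_of_def rho_def sound_sq_of_def)
  then have "cc = sound_sq_of \<gamma> \<rho>0 (phi2 u2 x0 \<theta>) p powr (1 / 2)"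
    using \<gamma> by (simp add: c2_def powr_powr)
  then show ?thesis using S2[of p] by (simp add: powr_half_sqrt)
qed

text \<open>The center of the sonic circle precedes \<open>P\<^sub>0\<close> on the wedge, that is, the arc \<open>P\<^sub>1P\<^sub>4\<close> faces \<open>P\<^sub>0\<close>. Otherwise \<open>u2 \<ge> x0 > u1\<close>,
  and at \<open>P\<^sub>0\<close> the two sides of the Rankine-Hugoniot condition between states (1) and (2) would have
  opposite signs.\<close>
lemma u2_less_x0: "u2 < x0"
proof (rule ccontr)
  assume n: "\<not> u2 < x0"
  let ?t = "tan \<theta>"
  have "(\<rho>1 *\<^sub>R grad (phi1 u1 x0) (P0 x0 \<theta>) - rho2 \<gamma> \<rho>0 x0 \<theta> u2 *\<^sub>R grad (phi2 u2 x0 \<theta>) (P0 x0 \<theta>))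
      \<bullet> (grad (phi1 u1 x0) (P0 x0 \<theta>) - grad (phi2 u2 x0 \<theta>) (P0 x0 \<theta>)) = 0"
    using adm by (simp add: state2_admissible_def)
  then have "\<rho>1 * ((x0 - u1) * (u2 - u1) + x0 * u2 * ?t\<^sup>2) = - (rho2 \<gamma> \<rho>0 x0 \<theta> u2 * ((u2 - x0) * (u2 - u1 + u2 * ?t\<^sup>2)))"
    by (simp add: grad_phi1 grad_phi2 P0_def inner_prod_def) (simp add: algebra_simps power2_eq_square)
  moreover have "0 < \<rho>1 * ((x0 - u1) * (u2 - u1) + x0 * u2 * ?t\<^sup>2)"
    using \<rho>1 u1 u2 n trig by (intro mult_pos_pos add_nonneg_pos mult_nonneg_nonneg) auto
  moreover have "0 \<le> rho2 \<gamma> \<rho>0 x0 \<theta> u2 * ((u2 - x0) * (u2 - u1 + u2 * ?t\<^sup>2))"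
    using rho21 \<rho>1 u1 u2 n by (intro mult_nonneg_nonneg add_nonneg_nonneg) auto
  ultimately show False by linarith
qed

definition "kk = (x0 - u2) / (cc * cos \<theta>)"

abbreviation "AA \<equiv> P1 - zz"
definition "BB = cc *\<^sub>R (cos \<theta>, sin \<theta>)"

lemma P0_eq: "zz + kk *\<^sub>R BB = P0 x0 \<theta>"
  using cc_pos trig(2) unfolding BB_def sonic_center_def P0_def trig(4) by (simp add: kk_def field_simps)

lemma nu_zz: "nu \<bullet> zz = 0" and nu_BB: "nu \<bullet> BB = 0"
  using trig by (simp_all add: nu_inner sonic_center_def BB_def)

lemma P1_ne_P0: "P0 x0 \<theta> \<noteq> P1"
  using P1Lam trig by (auto simp: Lam_iff nu_inner P0_def)

text \<open>State (2) is supersonic at \<open>P\<^sub>0\<close>, that is, \<open>P\<^sub>0\<close> lies outside the sonic circle.\<close>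
lemma kk_gt_1: "1 < kk"
proof -
  have "cc < norm (P0 x0 \<theta> - zz)" using P1_ne_P0 by (intro supersonic_P0_P1) auto
  also have "P0 x0 \<theta> - zz = kk *\<^sub>R BB" using P0_eq by (simp add: diff_eq_eq add.commute)
  also have "norm (kk *\<^sub>R BB) = \<bar>kk\<bar> * cc" unfolding norm_scaleR BB_def using cc_pos by (simp add: norm_prod_def)
  finally have "1 < \<bar>kk\<bar>" using cc_pos by simp
  moreover have "0 < kk" using u2_less_x0 cc_pos trig by (simp add: kk_def)
  ultimately show ?thesis by simp
qed

sublocale sector zz AA BB cc kk
proof
  show "0 < cc" by (rule cc_pos)
  show "1 < kk" by (rule kk_gt_1)
  show "norm AA = cc" by (rule P1c)
  show "norm BB = cc" unfolding norm_scaleR BB_def using cc_pos by (simp add: norm_prod_def)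
  have "0 < nu \<bullet> AA" using P1Lam nu_zz by (simp add: Lam_iff inner_diff_right)
  then have "0 < cc * (nu \<bullet> AA)" using cc_pos by simp
  then show "fst AA * snd BB - snd AA * fst BB \<noteq> 0" by (simp add: BB_def nu_inner algebra_simps)
qed

lemma tip_P0: "tip = P0 x0 \<theta>" unfolding tip_def by (rule P0_eq)

lemma P1_eq: "zz + AA = P1" by simp
lemma P4_eq: "zz + BB = p4" by (simp add: P4_def BB_def)
lemma Arc_eq: "Arc = circle_arc zz cc (zz + AA) (zz + BB)" by (simp add: sonic_arc_def P4_eq)
lemma Arc_norm: "q \<in> Arc \<Longrightarrow> norm (q - zz) = cc"
  unfolding Arc_eq circle_arc_iff by simp
lemma Arc_int_eq: "Arc_int = circle_arc zz cc (zz + AA) (zz + BB) - {zz + AA, zz + BB}"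
  by (simp add: sonic_arc_interior_def sonic_arc_def P4_eq)

lemma region2_eq: "Reg2 = inside tri_bd"
  unfolding region2_def tri_bd_def Arc_eq tip_P0 P1_eq P4_eq by simp

lemma Omega_eq: "\<Omega> = inside J"
  by (simp add: Omega_def J_def)

lemma nu_AA: "0 < nu \<bullet> AA"
  using P1Lam nu_zz by (simp add: Lam_iff inner_diff_right)

lemma nu_coords: "nu \<bullet> q = \<alpha> q * (nu \<bullet> AA)"
proof -
  have "nu \<bullet> (zz + \<alpha> q *\<^sub>R AA + \<beta> q *\<^sub>R BB) = \<alpha> q * (nu \<bullet> AA)"
    using nu_zz nu_BB by (simp add: inner_add_right)
  then show ?thesis using coords[of q] by simp
qed

lemma snd_zz: "0 < snd zz" "0 < snd p4" "0 < fst p4" "0 < snd (P0 x0 \<theta>)"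
  using u2 u1 trig cc_pos by (auto simp: sonic_center_def P4_def P0_def add_pos_pos)

text \<open>Such a point is a convex combination of the sonic center, \<open>P\<^sub>1\<close> and \<open>P\<^sub>0\<close>, with a positive weight at \<open>P\<^sub>1\<close>; the
  first and the last of them lie on the wedge.\<close>
lemma sector_Lam:
  assumes "0 < \<alpha> q" "0 < \<beta> q" "\<alpha> q + \<beta> q / kk < 1"
  shows "q \<in> Lam \<theta>"
proof -
  have eq: "q = (1 - \<alpha> q - \<beta> q / kk) *\<^sub>R zz + \<alpha> q *\<^sub>R P1 + (\<beta> q / kk) *\<^sub>R P0 x0 \<theta>"
  proof -
    have "(1 - \<alpha> q - \<beta> q / kk) *\<^sub>R zz + \<alpha> q *\<^sub>R P1 + (\<beta> q / kk) *\<^sub>R (zz + kk *\<^sub>R BB) = zz + \<alpha> q *\<^sub>R AA + \<beta> q *\<^sub>R BB"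
      using kk_gt_1 by (simp add: algebra_simps)
    then show ?thesis using coords[of q] unfolding P0_eq by simp
  qed
  have "snd q = (1 - \<alpha> q - \<beta> q / kk) * snd zz + \<alpha> q * snd P1 + (\<beta> q / kk) * snd (P0 x0 \<theta>)"
    using arg_cong[OF eq, of snd] unfolding snd_add snd_scaleR real_scaleR_def .
  moreover have "0 < snd P1" using P1Lam by (simp add: Lam_iff)
  ultimately have "0 < snd q" using assms snd_zz kk_gt_1 by (simp add: add_pos_pos)
  moreover have "0 < nu \<bullet> q" using assms nu_AA by (simp add: nu_coords[of q])
  ultimately show ?thesis by (simp add: Lam_iff)
qed

lemma supersonic_tip_A: "q \<in> closed_segment tip (zz + AA) - {zz + AA} \<Longrightarrow> cc < norm (q - zz)"
  unfolding tip_P0 P1_eq by (rule supersonic_P0_P1)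

lemma Arc_int_Lam: "Arc_int \<subseteq> Lam \<theta>"
  using sector_Lam arc_interior_coords[OF supersonic_tip_A] unfolding Arc_int_eq by blast

lemma Tri_Lam: "Tri \<subseteq> Lam \<theta>"
  using sector_Lam by (auto simp: Tri_def)

lemma Arc_cases: "q \<in> Arc \<Longrightarrow> q \<in> Lam \<theta> \<or> q = p4"
  using Arc_int_Lam P1Lam unfolding sonic_arc_interior_def by blast

lemma p4_nu: "nu \<bullet> p4 = 0"
  unfolding P4_eq[symmetric] inner_add_right nu_zz nu_BB by simp

lemma p4_Arc: "p4 \<in> Arc"
  using pathstart_in_path_image[of carc] unfolding path_image_carc pathstart_carc Arc_eq P4_eq .

text \<open>The number \<open>u2 / cos \<theta> + cc\<close> is the distance from the vertex to \<open>P\<^sub>4\<close>.\<close>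
lemma seg_P3_p4:
  assumes "q \<in> closed_segment P3 p4"
  obtains s where "0 \<le> s" "q = s *\<^sub>R (cos \<theta>, sin \<theta>)" "q = p4 \<or> s < u2 / cos \<theta> + cc"
proof -
  have p4: "p4 = (u2 / cos \<theta> + cc) *\<^sub>R (cos \<theta>, sin \<theta>)"
    using trig by (simp add: P4_def sonic_center_def field_simps)
  obtain t where t: "0 \<le> t" "t \<le> 1" "q = t *\<^sub>R p4" using assms by (auto simp: in_segment P3_def zero_prod_def[symmetric])
  have pos: "0 < u2 / cos \<theta> + cc" using u2 trig cc_pos by (simp add: add_pos_pos)
  show ?thesis
  proof (rule that[of "t * (u2 / cos \<theta> + cc)"])
    show "0 \<le> t * (u2 / cos \<theta> + cc)" using t pos by simp
    show "q = (t * (u2 / cos \<theta> + cc)) *\<^sub>R (cos \<theta>, sin \<theta>)" using t(3) p4 by simp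
    show "q = p4 \<or> t * (u2 / cos \<theta> + cc) < u2 / cos \<theta> + cc" using t pos by (cases "t = 1") auto
  qed
qed

lemma shock_props: "arc \<sigma>" "pathstart \<sigma> = P1" "fst p2 < 0" "snd p2 = 0"
  "\<And>t. 0 \<le> t \<Longrightarrow> t < 1 \<Longrightarrow> \<sigma> t \<in> Lam \<theta>"
  "path_image \<sigma> \<inter> closed_segment (P0 x0 \<theta>) P1 = {P1}" "path_image \<sigma> \<inter> Arc = {P1}"
  using shock by (auto simp: shock_curve_def)

lemma shock_cases: "q \<in> path_image \<sigma> \<Longrightarrow> q \<in> Lam \<theta> \<or> q = p2"
  using shock_props(5) unfolding path_image_def pathfinish_def by force

lemma seg_p2_P3: "q \<in> closed_segment p2 P3 \<Longrightarrow> snd q = 0 \<and> fst q \<le> 0 \<and> (q = p2 \<or> fst p2 < fst q)"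
proof -
  assume "q \<in> closed_segment p2 P3"
  then obtain t where t: "0 \<le> t" "t \<le> 1" "q = (1 - t) *\<^sub>R p2" by (auto simp: in_segment P3_def zero_prod_def[symmetric])
  have "fst q = fst p2 - t * fst p2" "snd q = 0" unfolding t(3) using shock_props(4) by (simp_all add: left_diff_distrib)
  moreover have "t = 0 \<or> t * fst p2 < 0" using t(1) shock_props(3) mult_pos_neg[of t "fst p2"] by linarith
  moreover have "(1 - t) * fst p2 \<le> 0" using t shock_props(3) by (simp add: mult_nonneg_nonpos)
  ultimately show ?thesis using t(3) by (auto simp: left_diff_distrib)
qed

lemma seg_P3_p4_nu:
  assumes "q \<in> closed_segment P3 p4"
  shows "nu \<bullet> q = 0"
proof -
  obtain s where "q = s *\<^sub>R (cos \<theta>, sin \<theta>)" by (rule seg_P3_p4[OF assms])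
  then show ?thesis by (simp add: nu_inner)
qed

lemma wall_not_Lam: "q \<in> closed_segment p2 P3 \<union> closed_segment P3 p4 \<Longrightarrow> q \<notin> Lam \<theta>"
  using seg_p2_P3[of q] seg_P3_p4_nu[of q] by (auto simp: Lam_iff)

lemma simple_closed_J: obtains g where "simple_path g" "pathfinish g = pathstart g" "path_image g = J"
proof -
  let ?l1 = "linepath p2 P3" and ?l2 = "linepath P3 p4"
  have ne: "p2 \<noteq> P3" "P3 \<noteq> p4" using shock_props(3) snd_zz(3) by (metis P3_def fst_conv less_irrefl)+
  have pl: "path_image (\<sigma> +++ ?l1) = path_image \<sigma> \<union> closed_segment p2 P3" by (simp add: path_image_join)
  have pl2: "path_image ((\<sigma> +++ ?l1) +++ ?l2) = path_image \<sigma> \<union> closed_segment p2 P3 \<union> closed_segment P3 p4"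
    by (subst path_image_join) (auto simp: pl)
  have a1: "arc (\<sigma> +++ ?l1)"
  proof (rule arc_join)
    show "path_image \<sigma> \<inter> path_image ?l1 \<subseteq> {pathstart ?l1}"
    proof
      fix q assume "q \<in> path_image \<sigma> \<inter> path_image ?l1"
      then have "snd q = 0" "q \<in> Lam \<theta> \<or> q = p2" using seg_p2_P3 shock_cases by auto
      then show "q \<in> {pathstart ?l1}" by (auto simp: Lam_iff)
    qed
  qed (use shock_props ne in \<open>auto\<close>)
  have a2: "arc ((\<sigma> +++ ?l1) +++ ?l2)"
  proof (rule arc_join[OF a1])
    show "path_image (\<sigma> +++ ?l1) \<inter> path_image ?l2 \<subseteq> {pathstart ?l2}"
    proof
      fix q assume q: "q \<in> path_image (\<sigma> +++ ?l1) \<inter> path_image ?l2"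
      then obtain s where s: "0 \<le> s" "q = s *\<^sub>R (cos \<theta>, sin \<theta>)" using seg_P3_p4[of q] by auto
      then have "nu \<bullet> q = 0" "0 \<le> fst q" using trig by (auto simp: nu_inner)
      then have "q \<notin> Lam \<theta>" "q \<noteq> p2" using shock_props by (auto simp: Lam_iff)
      then have "q \<in> closed_segment p2 P3" using q shock_cases unfolding pl by blast
      then have "snd q = 0" using seg_p2_P3 by simp
      then show "q \<in> {pathstart ?l2}" using s trig by (simp add: P3_def)
    qed
  qed (use ne in auto)
  show ?thesis
  proof (rule that[of "((\<sigma> +++ ?l1) +++ ?l2) +++ carc"])
    show "simple_path (((\<sigma> +++ ?l1) +++ ?l2) +++ carc)"
    proof (rule simple_path_join_loop[OF a2 arc_carc])
      show "path_image ((\<sigma> +++ ?l1) +++ ?l2) \<inter> path_image carc \<subseteq> {pathstart ((\<sigma> +++ ?l1) +++ ?l2), pathstart carc}"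
      proof
        fix q assume "q \<in> path_image ((\<sigma> +++ ?l1) +++ ?l2) \<inter> path_image carc"
        then have q: "q \<in> path_image \<sigma> \<or> q \<in> closed_segment p2 P3 \<or> q \<in> closed_segment P3 p4" and qa: "q \<in> Arc"
          unfolding pl2 path_image_carc Arc_eq by auto
        from q show "q \<in> {pathstart ((\<sigma> +++ ?l1) +++ ?l2), pathstart carc}"
        proof (elim disjE)
          assume "q \<in> path_image \<sigma>"
          then show ?thesis using qa shock_props by auto
        next
          assume "q \<in> closed_segment p2 P3"
          then have "snd q = 0" using seg_p2_P3 by simp
          then show ?thesis using Arc_cases[OF qa] snd_zz by (auto simp: Lam_iff)
        next
          assume "q \<in> closed_segment P3 p4"
          then obtain s where s: "q = s *\<^sub>R (cos \<theta>, sin \<theta>)" using seg_P3_p4[of q] by auto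
          then have "nu \<bullet> q = 0" using trig by (auto simp: nu_inner)
          then show ?thesis using Arc_cases[OF qa] by (auto simp: Lam_iff pathstart_carc P4_eq[symmetric])
        qed
      qed
    qed (auto simp: pathstart_carc pathfinish_carc shock_props P4_eq)
    show "pathfinish (((\<sigma> +++ ?l1) +++ ?l2) +++ carc) = pathstart (((\<sigma> +++ ?l1) +++ ?l2) +++ carc)"
      by (simp add: pathfinish_carc shock_props)
    show "path_image (((\<sigma> +++ ?l1) +++ ?l2) +++ carc) = J"
      by (subst path_image_join) (auto simp: pathstart_carc P4_eq pl2 path_image_carc J_def Arc_eq)
  qed
qed

definition "closed_Lam = {p. 0 \<le> snd p \<and> 0 \<le> nu \<bullet> p}"

lemma convex_closed_Lam: "convex closed_Lam"
  unfolding closed_Lam_def by (rule convexI) (auto simp: inner_add_right)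

lemma Lam_closed_Lam: "Lam \<theta> \<subseteq> closed_Lam" by (auto simp: closed_Lam_def Lam_iff)

lemma convex_Lam: "convex (Lam \<theta>)"
proof (rule convexI)
  fix x y and u v :: real assume xy: "x \<in> Lam \<theta>" "y \<in> Lam \<theta>" and uv: "0 \<le> u" "0 \<le> v" "u + v = 1"
  have pos: "0 < u * a + v * b" if "0 < a" "0 < b" for a b :: real
    using that uv by (cases "u = 0") (auto intro: add_pos_nonneg)
  show "u *\<^sub>R x + v *\<^sub>R y \<in> Lam \<theta>" using xy pos by (simp add: Lam_iff inner_add_right)
qed

lemma open_Lam: "open (Lam \<theta>)"
  unfolding Lam_def by (intro open_Collect_conj open_Collect_less continuous_intros)

lemma J_cases:
  assumes "q \<in> J"
  shows "q \<in> path_image \<sigma> \<and> q \<in> Lam \<theta> \<or> q \<in> Arc_int \<or> q = p2 \<or> q = p4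
    \<or> (snd q = 0 \<and> fst p2 < fst q \<and> fst q < 0) \<or> (\<exists>s. 0 \<le> s \<and> s < u2 / cos \<theta> + cc \<and> q = s *\<^sub>R (cos \<theta>, sin \<theta>))"
proof -
  have pos: "0 < u2 / cos \<theta> + cc" using u2 trig cc_pos by (simp add: add_pos_pos)
  consider "q \<in> path_image \<sigma>" | "q \<in> closed_segment p2 P3" | "q \<in> closed_segment P3 p4" | "q \<in> Arc"
    using assms J_def by auto
  then show ?thesis
  proof cases
    case 1 then show ?thesis using shock_cases by blast
  next
    case 2
    then have "snd q = 0" "fst q \<le> 0" "q = p2 \<or> fst p2 < fst q" using seg_p2_P3 by auto
    moreover have "q = 0 *\<^sub>R (cos \<theta>, sin \<theta>)" if "fst q = 0" using \<open>snd q = 0\<close> that by (simp add: prod_eq_iff)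
    ultimately show ?thesis using pos by (metis less_eq_real_def order_refl)
  next
    case 3 then show ?thesis using seg_P3_p4 by metis
  next
    case 4
    have "P1 \<in> path_image \<sigma>" using shock_props(2) pathstart_in_path_image by metis
    then show ?thesis using 4 P1Lam unfolding sonic_arc_interior_def by blast
  qed
qed

lemma J_closed_Lam: "J \<subseteq> closed_Lam"
proof
  fix q assume "q \<in> J"
  from J_cases[OF this] show "q \<in> closed_Lam"
    using Lam_closed_Lam Arc_int_Lam shock_props trig snd_zz p4_nu
    by (elim disjE) (auto simp: closed_Lam_def nu_inner mult_nonpos_nonneg)
qed

text \<open>The complement of the closed convex region is unbounded and connected, and the curve \<open>J\<close> does not meet it.\<close>
lemma compl_closed_Lam_outside: "- closed_Lam \<subseteq> outside J"
  by (rule complement_convex_subset_outside[OF convex_closed_Lam J_closed_Lam])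

lemma Omega_topology: "open \<Omega>" "connected \<Omega>" "bounded \<Omega>" "frontier \<Omega> = J" "\<Omega> \<subseteq> Lam \<theta>" "\<Omega> \<inter> J = {}" "closed J"
proof -
  obtain g where g: "simple_path g" "pathfinish g = pathstart g" "path_image g = J" by (rule simple_closed_J)
  show "connected \<Omega>" "frontier \<Omega> = J" using Jordan_plane[OF g(1,2)] g(3) Omega_eq by auto
  have comp: "compact J" using g by (metis compact_simple_path_image)
  then show cl: "closed J" by (rule compact_imp_closed)
  then show op: "open \<Omega>" unfolding Omega_eq by (rule open_inside)
  show "bounded \<Omega>" unfolding Omega_eq using comp by (simp add: bounded_inside compact_imp_bounded)
  show "\<Omega> \<inter> J = {}" unfolding Omega_eq by simp
  have sub: "\<Omega> \<subseteq> closed_Lam" using compl_closed_Lam_outside inside_Int_outside[of J] unfolding Omega_eq by blast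
  show "\<Omega> \<subseteq> Lam \<theta>"
  proof
    fix q assume "q \<in> \<Omega>"
    then obtain e where e: "e > 0" "cball q e \<subseteq> \<Omega>" using op open_contains_cball by blast
    have "q - (0, e) \<in> cball q e" "q - e *\<^sub>R nu \<in> cball q e"
      using e nu_nu by (auto simp: dist_norm norm_eq_sqrt_inner)
    then have "q - (0, e) \<in> closed_Lam" "q - e *\<^sub>R nu \<in> closed_Lam" using e sub by blast+
    then show "q \<in> Lam \<theta>" using e nu_nu by (auto simp: closed_Lam_def Lam_iff inner_diff_right)
  qed
qed

text \<open>The shock \<open>P\<^sub>1P\<^sub>2\<close> without \<open>P\<^sub>1\<close> is connected, avoids the frontier of the curved triangle, and ends at a point
  outside of the triangle.\<close>
lemma Tri_J: "J \<inter> Tri = {}"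
proof -
  let ?S = "\<sigma> ` {0<..1}"
  have inj: "inj_on \<sigma> {0..1}" using shock_props(1) by (simp add: arc_def)
  have not1: "\<sigma> t \<noteq> P1" if "t \<in> {0<..1}" for t
    using inj_onD[OF inj, of t 0] that shock_props(2) by (auto simp: pathstart_def)
  have sp: "\<sigma> t \<in> path_image \<sigma>" if "t \<in> {0<..1}" for t using that by (auto simp: path_image_def)
  have "?S \<inter> tri_bd = {}"
  proof -
    have "\<sigma> t \<notin> tri_bd" if t: "t \<in> {0<..1}" for t
    proof
      assume "\<sigma> t \<in> tri_bd"
      moreover have "\<sigma> t \<notin> closed_segment tip (zz + AA)"
        using not1[OF t] sp[OF t] shock_props(6) unfolding tip_P0 P1_eq by blast
      moreover have "\<sigma> t \<notin> circle_arc zz cc (zz + AA) (zz + BB)"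
        using not1[OF t] sp[OF t] shock_props(7) unfolding Arc_eq[symmetric] by blast
      ultimately have "\<sigma> t \<in> closed_segment tip (zz + BB)" unfolding tri_bd_def by blast
      then have ab: "\<alpha> (\<sigma> t) = 0" "1 \<le> \<beta> (\<sigma> t)" by (auto simp: segment_tip_B)
      then have "\<sigma> t \<notin> Lam \<theta>" by (simp add: Lam_iff nu_coords[of "\<sigma> t"])
      then have p2: "\<sigma> t = p2" using shock_cases sp[OF t] by blast
      have "fst (\<sigma> t) = fst zz + \<beta> (\<sigma> t) * (cc * cos \<theta>)"
        using arg_cong[OF coords[of "\<sigma> t"], of fst] ab by (simp add: BB_def)
      moreover have "0 < \<beta> (\<sigma> t) * (cc * cos \<theta>)" using ab cc_pos trig by (intro mult_pos_pos) auto
      moreover have "0 < fst zz" using u2 by (simp add: sonic_center_def)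
      ultimately show False using p2 shock_props(3) by simp
    qed
    then show ?thesis by blast
  qed
  then have dis: "?S \<inter> frontier Tri = {}" using frontier_Tri by blast
  have p2S: "p2 \<in> ?S" by (auto simp: pathfinish_def)
  have "p2 \<notin> Tri" using Tri_Lam shock_props(4) by (auto simp: Lam_iff)
  have "connected ?S"
    by (rule connected_continuous_image) (use shock_props(1) in \<open>auto simp: arc_def path_def intro: continuous_on_subset\<close>)
  then have "?S \<inter> Tri = {}" using connected_Int_frontier[of ?S Tri] dis p2S \<open>p2 \<notin> Tri\<close> by blast
  moreover have "\<sigma> 0 \<notin> Tri" using shock_props(2) P1c by (simp add: Tri_def pathstart_def)
  moreover have "path_image \<sigma> = insert (\<sigma> 0) ?S" unfolding path_image_def
    by (auto simp: image_iff) (metis atLeastAtMost_iff greaterThanAtMost_iff less_eq_real_def)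
  ultimately have 1: "path_image \<sigma> \<inter> Tri = {}" by auto
  have 2: "q \<notin> Tri" if "snd q = 0 \<or> nu \<bullet> q = 0" for q using that Tri_Lam by (auto simp: Lam_iff)
  have "closed_segment p2 P3 \<inter> Tri = {}" using 2 seg_p2_P3 by blast
  moreover have "closed_segment P3 p4 \<inter> Tri = {}"
  proof -
    show ?thesis using 2 seg_P3_p4_nu by blast
  qed
  moreover have "q \<notin> Tri" if "q \<in> Arc" for q using Arc_norm[OF that] by (simp add: Tri_def)
  then have "Arc \<inter> Tri = {}" by blast
  ultimately show ?thesis using 1 unfolding J_def by blast
qed

text \<open>The tip \<open>P\<^sub>0\<close> lies on the wedge beyond \<open>P\<^sub>4\<close>, hence not on \<open>J\<close>, and is a limit of points below the wedge, which
  are outside of \<open>J\<close>.\<close>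
lemma Tri_outside: "Tri \<subseteq> outside J"
proof (rule Tri_subset_outside[OF Omega_topology(7) Tri_J])
  have nuP0: "nu \<bullet> P0 x0 \<theta> = 0" using trig by (simp add: nu_inner P0_def)
  show "tip \<notin> J"
  proof
    assume J: "tip \<in> J"
    have a: "\<alpha> tip = 0" "\<beta> tip = kk" unfolding tip_def using coords_eqI[of "zz + kk *\<^sub>R BB" 0 kk] by auto
    have "tip \<notin> Lam \<theta>" using nuP0 by (simp add: tip_P0 Lam_iff)
    moreover have "0 < fst tip" using u1 by (simp add: tip_P0 P0_def)
    moreover from this have "tip \<noteq> p2" using shock_props(3) by (metis less_asym)
    moreover have "tip \<notin> closed_segment P3 p4"
    proof
      assume "tip \<in> closed_segment P3 p4"
      then obtain s where s: "tip = s *\<^sub>R (cos \<theta>, sin \<theta>)" "tip = p4 \<or> s < u2 / cos \<theta> + cc" using seg_P3_p4 by metis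
      have "fst p4 < fst tip"
      proof -
        have "1 * (cc * cos \<theta>) < kk * (cc * cos \<theta>)" using kk_gt_1 cc_pos trig by (intro mult_strict_right_mono) auto
        moreover have "fst tip = fst zz + kk * fst BB" by (simp add: tip_def)
        moreover have "fst BB = cc * cos \<theta>" by (simp add: BB_def)
        ultimately show ?thesis by (simp add: P4_def)
      qed
      moreover have "s * cos \<theta> < (u2 / cos \<theta> + cc) * cos \<theta>" if "s < u2 / cos \<theta> + cc"
        using that trig by simp
      moreover have "(u2 / cos \<theta> + cc) * cos \<theta> = fst p4" using trig by (simp add: P4_def sonic_center_def field_simps)
      moreover have "fst tip = s * cos \<theta>" using s by simp
      ultimately show False using s(2) by auto
    qed
    moreover have "tip \<notin> closed_segment p2 P3" using seg_p2_P3[of tip] \<open>0 < fst tip\<close> by auto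
    moreover have "tip \<notin> Arc"
    proof
      assume "tip \<in> Arc"
      then have "norm (tip - zz) = cc" by (rule Arc_norm)
      moreover have "cc < norm (tip - zz)" using supersonic_P0_P1[of tip] P1_ne_P0 unfolding tip_P0 by simp
      ultimately show False by simp
    qed
    ultimately show False using J shock_cases unfolding J_def by blast
  qed
  show "tip \<in> closure (outside J)" unfolding closure_approachable
  proof (intro allI impI)
    fix e :: real assume e: "0 < e"
    let ?w = "tip - (e / 2) *\<^sub>R nu"
    have "nu \<bullet> ?w = - (e / 2)" using nuP0 nu_nu by (simp add: tip_P0 inner_diff_right)
    then have "?w \<in> - closed_Lam" using e by (simp add: closed_Lam_def)
    moreover have "dist ?w tip < e" using e by (simp add: dist_norm norm_nu)
    ultimately show "\<exists>y\<in>outside J. dist y tip < e" using compl_closed_Lam_outside by blast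
  qed
qed

text \<open>A small disc about the point meets \<open>J\<close> only in the sonic circle, which divides it into two halves. The
  outer half lies in the curved triangle, hence outside of \<open>J\<close>. As the point belongs to the frontier of
  \<open>\<Omega>\<close>, the inner half meets \<open>\<Omega>\<close>, and being connected it is contained in \<open>\<Omega>\<close>.\<close>
lemma near_Arc_int:
  assumes p: "p \<in> Arc_int"
  obtains k where "k > 0" "\<And>q. q \<in> ball p k \<Longrightarrow> norm (q - zz) = cc \<Longrightarrow> q \<in> Arc_int"
    "\<And>q. q \<in> ball p k \<Longrightarrow> cc < norm (q - zz) \<Longrightarrow> q \<in> Reg2"
    "\<And>q. q \<in> ball p k \<Longrightarrow> norm (q - zz) < cc \<Longrightarrow> q \<in> \<Omega>"
proof -
  obtain k1 where k1: "k1 > 0" "\<And>q. q \<in> ball p k1 \<Longrightarrow> norm (q - zz) = cc \<Longrightarrow> q \<in> Arc_int"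
    "\<And>q. q \<in> ball p k1 \<Longrightarrow> cc < norm (q - zz) \<Longrightarrow> q \<in> Tri"
    using near_arc_interior[OF supersonic_tip_A p[unfolded Arc_int_eq]] unfolding Arc_int_eq by metis
  let ?K = "path_image \<sigma> \<union> closed_segment p2 P3 \<union> closed_segment P3 p4"
  have pL: "p \<in> Lam \<theta>" "p \<in> Arc" "p \<noteq> P1" using p Arc_int_Lam by (auto simp: sonic_arc_interior_def)
  have "p \<notin> ?K"
  proof
    assume "p \<in> ?K"
    moreover have "p \<notin> path_image \<sigma>" using shock_props(7) pL by blast
    moreover have "p \<notin> closed_segment p2 P3 \<union> closed_segment P3 p4" using wall_not_Lam pL(1) by blast
    ultimately show False by blast
  qed
  moreover have "closed ?K" using shock_props(1) by (intro closed_Un closed_segment closed_path_image arc_imp_path) auto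
  ultimately obtain k2 where k2: "k2 > 0" "ball p k2 \<subseteq> - ?K"
    using open_contains_ball[of "- ?K"] by (metis ComplI open_Compl)
  define k where "k = min k1 k2"
  have k: "k > 0" "ball p k \<subseteq> ball p k1" "ball p k \<subseteq> ball p k2" using k1 k2 by (auto simp: k_def)
  have Jk: "norm (q - zz) = cc" if "q \<in> ball p k" "q \<in> J" for q
    using that k2(2) k(3) Arc_norm[of q] unfolding J_def by blast
  let ?H = "ball p k \<inter> ball zz cc"
  have "?H \<subseteq> inside J"
  proof (rule connected_subset_inside)
    show "connected ?H" by (intro convex_connected convex_Int) auto
    show "?H \<inter> J = {}" using Jk by (force simp: dist_norm norm_minus_commute)
    have "p \<in> closure \<Omega>" using Omega_topology(4) pL(2) unfolding J_def frontier_def by blast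
    then obtain q where q: "q \<in> \<Omega>" "dist q p < k" using k closure_approachable by blast
    then have qb: "q \<in> ball p k" by (simp add: dist_commute)
    have "\<not> cc < norm (q - zz)"
    proof
      assume "cc < norm (q - zz)"
      then have "q \<in> outside J" using k1(3)[of q] qb k Tri_outside by blast
      then show False using q inside_Int_outside[of J] unfolding Omega_eq by blast
    qed
    moreover have "norm (q - zz) \<noteq> cc"
    proof
      assume "norm (q - zz) = cc"
      then have "q \<in> J" using k1(2)[of q] qb k by (auto simp: sonic_arc_interior_def J_def)
      then show False using q Omega_topology(6) by blast
    qed
    ultimately have "q \<in> ?H" using qb by (simp add: dist_norm norm_minus_commute)
    then show "?H \<inter> inside J \<noteq> {}" using q unfolding Omega_eq by blast
  qed
  then have "q \<in> \<Omega>" if "q \<in> ball p k" "norm (q - zz) < cc" for q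
    using that unfolding Omega_eq by (auto simp: dist_norm norm_minus_commute)
  moreover have "q \<in> Reg2" if "q \<in> ball p k" "cc < norm (q - zz)" for q
    using that k1(3) k Tri_subset_inside unfolding region2_eq by blast
  ultimately show ?thesis using that k k1(2) by blast
qed

text \<open>Near such a point the curve \<open>J\<close> does not enter the convex region \<open>Lam \<theta>\<close>. As the point belongs to the frontier
  of \<open>\<Omega> \<subseteq> Lam \<theta>\<close>, the part of a small disc in \<open>Lam \<theta>\<close> meets \<open>\<Omega>\<close>, and being connected it is contained in \<open>\<Omega>\<close>.\<close>
lemma near_wall:
  assumes p: "p \<in> J" "p \<notin> Lam \<theta>" "p \<noteq> p2" "p \<noteq> p4"
  obtains k where "k > 0" "Lam \<theta> \<inter> ball p k \<subseteq> \<Omega>"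
proof -
  let ?K = "path_image \<sigma> \<union> Arc"
  have "p \<notin> ?K" using p shock_cases Arc_cases by blast
  moreover have "closed Arc"
    using arc_carc unfolding Arc_eq path_image_carc[symmetric] by (intro closed_path_image arc_imp_path)
  then have "closed ?K" using shock_props(1) by (intro closed_Un closed_path_image arc_imp_path)
  ultimately obtain k where k: "k > 0" "ball p k \<subseteq> - ?K"
    using open_contains_ball[of "- ?K"] by (metis ComplI open_Compl)
  have "Lam \<theta> \<inter> ball p k \<subseteq> inside J"
  proof (rule connected_subset_inside)
    show "connected (Lam \<theta> \<inter> ball p k)" by (intro convex_connected convex_Int convex_Lam) auto
    show "Lam \<theta> \<inter> ball p k \<inter> J = {}" using k wall_not_Lam unfolding J_def by blast
    have "p \<in> closure \<Omega>" using Omega_topology(4) p(1) unfolding frontier_def by blast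
    then obtain q where q: "q \<in> \<Omega>" "dist q p < k" using k closure_approachable by blast
    then show "Lam \<theta> \<inter> ball p k \<inter> inside J \<noteq> {}"
      using Omega_topology(5) unfolding Omega_eq by (auto simp: dist_commute)
  qed
  then show ?thesis using that k unfolding Omega_eq by blast
qed

lemma Arc_int_nonempty: "Arc_int \<noteq> {}" and p4_closure: "p4 \<in> closure Arc_int"
proof -
  have in_Arc_int: "carc t \<in> Arc_int" if "0 < t" "t < 1" for t
  proof -
    have "carc t \<in> Arc" unfolding Arc_eq path_image_carc[symmetric] using that by (auto simp: path_image_def)
    moreover have "carc t \<noteq> P1" "carc t \<noteq> p4"
      using inj_onD[of carc "{0..1}" t 1] inj_onD[of carc "{0..1}" t 0] that arc_carc pathstart_carc pathfinish_carc
      unfolding P4_eq P1_eq by (auto simp: arc_def pathstart_def pathfinish_def)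
    ultimately show ?thesis by (simp add: sonic_arc_interior_def)
  qed
  have "carc (1 / 2) \<in> Arc_int" by (rule in_Arc_int) auto
  then show "Arc_int \<noteq> {}" by blast
  have "continuous_on {0..1} carc" using arc_carc by (simp add: arc_def path_def)
  then have "carc 0 \<in> carc ` {0..1}" and c: "continuous_on (closure {0<..<1}) carc" by auto
  have "carc ` closure {0<..<1} \<subseteq> closure Arc_int"
  proof (rule image_closure_subset[OF c closed_closure], rule image_subsetI)
    fix t :: real assume "t \<in> {0<..<1}"
    then have "carc t \<in> Arc_int" by (intro in_Arc_int) auto
    then show "carc t \<in> closure Arc_int" using closure_subset by blast
  qed
  moreover have "carc 0 = p4" using pathstart_carc P4_eq by (simp add: pathstart_def)
  ultimately show "p4 \<in> closure Arc_int" by force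
qed

end

section \<open>The solution lies strictly above state (2)\<close>

lemma second_along_cong:
  assumes "open U" "p \<in> U" "\<And>q. q \<in> U \<Longrightarrow> f q = g q" "second_along g p h l"
  shows "second_along f p h l"
proof -
  from assms(4) obtain g' where
    g: "\<forall>\<^sub>F t in nhds 0. ((\<lambda>t. g (p + t *\<^sub>R h)) has_real_derivative g' t) (at t)" "(g' has_real_derivative l) (at 0)"
    unfolding second_along_def by blast
  have "open ((\<lambda>t. p + t *\<^sub>R h) -` U)"
    by (rule open_vimage[OF assms(1)]) (intro continuous_intros)
  then have "\<forall>\<^sub>F t in nhds 0. t \<in> (\<lambda>t. p + t *\<^sub>R h) -` U"
    using assms(2) eventually_nhds_in_open by force
  then have "\<forall>\<^sub>F t in nhds 0. ((\<lambda>t. f (p + t *\<^sub>R h)) has_real_derivative g' t) (at t)"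
    using g(1)
  proof eventually_elim
    case (elim t)
    show ?case
      by (rule has_field_derivative_transform_within_open[OF elim(2) \<open>open ((\<lambda>t. p + t *\<^sub>R h) -` U)\<close> elim(1)])
        (use assms(3) in auto)
  qed
  then show ?thesis using g(2) unfolding second_along_def by blast
qed

lemma differentiable_phi2: "phi2 u2 x0 \<theta> differentiable (at p)"
  unfolding differentiable_def using has_derivative_phi2 by blast

lemma second_along_phi2: "second_along (phi2 u2 x0 \<theta>) p h (- ((norm h)\<^sup>2))"
  unfolding second_along_def
proof (intro exI conjI always_eventually allI)
  show "((\<lambda>t. phi2 u2 x0 \<theta> (p + t *\<^sub>R h)) has_real_derivative grad (phi2 u2 x0 \<theta>) (p + t *\<^sub>R h) \<bullet> h) (at t)" for t
    by (rule has_real_derivative_along_line[OF differentiable_phi2])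
  have "(\<lambda>t. grad (phi2 u2 x0 \<theta>) (p + t *\<^sub>R h) \<bullet> h) = (\<lambda>t. (sonic_center \<theta> u2 - p) \<bullet> h - t * (norm h)\<^sup>2)"
    by (rule ext) (simp add: grad_phi2_center inner_diff_left inner_add_left power2_norm_eq_inner)
  then show "((\<lambda>t. grad (phi2 u2 x0 \<theta>) (p + t *\<^sub>R h) \<bullet> h) has_real_derivative - ((norm h)\<^sup>2)) (at 0)"
    by (auto intro!: derivative_eq_intros)
qed

lemma continuous_on_phi2: "continuous_on S (phi2 u2 x0 \<theta>)"
  by (intro continuous_at_imp_continuous_on ballI differentiable_imp_continuous_within differentiable_phi2)

lemma grad_diff:
  assumes "f differentiable (at p)" "g differentiable (at p)"
  shows "grad (\<lambda>q. f q - g q) p = grad f p - grad g p"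
proof -
  have "((\<lambda>q. f q - g q) has_derivative (\<lambda>h. (Dxi f p * fst h + Deta f p * snd h) - (Dxi g p * fst h + Deta g p * snd h))) (at p)"
    by (intro has_derivative_diff has_derivative_Dxi_Deta assms)
  then show ?thesis by (simp add: grad_def Dxi_eqI Deta_eqI)
qed

text \<open>The function \<open>|q|\<^sup>2 + n \<bullet> q\<close> serves as the strict subsolution of the weak minimum principle. For \<open>n\<close> the unit
  normal of the wedge its normal derivative is \<open>1\<close> along the whole wedge line through the origin, so that
  it turns the Neumann condition into a strict inequality, up to the vertex.\<close>
lemma second_along_wall_corrector: "second_along (\<lambda>q. (norm q)\<^sup>2 + n \<bullet> q) p h (2 * (norm (h :: plane))\<^sup>2)"
  unfolding second_along_def
proof (intro exI conjI always_eventually allI)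
  have *: "(\<lambda>t. (norm (p + t *\<^sub>R h))\<^sup>2 + n \<bullet> (p + t *\<^sub>R h)) =
    (\<lambda>t. (norm p)\<^sup>2 + 2 * t * (p \<bullet> h) + t\<^sup>2 * (norm h)\<^sup>2 + (n \<bullet> p + t * (n \<bullet> h)))"
    using norm_sq_along[of p _ h 0] by (auto simp: inner_add_right)
  show "((\<lambda>t. (norm (p + t *\<^sub>R h))\<^sup>2 + n \<bullet> (p + t *\<^sub>R h)) has_real_derivative 2 * ((p + t *\<^sub>R h) \<bullet> h) + n \<bullet> h) (at t)" for t
    unfolding * by (rule derivative_eq_intros refl)+ (simp add: inner_add_left power2_norm_eq_inner)
  have "(\<lambda>t. 2 * ((p + t *\<^sub>R h) \<bullet> h) + n \<bullet> h) = (\<lambda>t. 2 * (p \<bullet> h) + 2 * t * (norm h)\<^sup>2 + n \<bullet> h)"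
    by (auto simp: inner_add_left power2_norm_eq_inner)
  then show "((\<lambda>t. 2 * ((p + t *\<^sub>R h) \<bullet> h) + n \<bullet> h) has_real_derivative 2 * (norm h)\<^sup>2) (at 0)"
    by (auto intro!: derivative_eq_intros)
qed

lemma quadratic_form_norm: "quadratic_form (\<lambda>h. a * (norm h)\<^sup>2)"
  unfolding quadratic_form_def
proof (intro exI allI)
  show "a * (norm h)\<^sup>2 = a * (fst h)\<^sup>2 + 0 * (fst h * snd h) + a * (snd h)\<^sup>2" for h :: plane
    by (simp add: norm_plane_sq distrib_left)
qed

text \<open>A regular reflection solution; of the conditions outside of \<open>\<Omega>\<close> it retains those on the region of
  state (2) and on the shock.\<close>
locale reflection_solution = reflection_geometry +
  fixes \<phi> :: "plane \<Rightarrow> real"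
  assumes weak: "weak_solution \<gamma> \<rho>0 (Lam \<theta>) \<phi>" and slip: "slip_condition \<theta> \<phi>"
    and smooth: "smooth_in \<Omega> \<phi>" and holder: "\<exists>a\<in>{0<..<1}. C1_holder_up_to_boundary a \<Omega> \<phi>"
    and reg2: "\<And>p. p \<in> Reg2 \<Longrightarrow> \<phi> p = phi2 u2 x0 \<theta> p"
    and ell: "\<And>p. p \<in> \<Omega> \<Longrightarrow> elliptic_at \<gamma> \<rho>0 \<phi> p"
    and psi_ge_on_shock: "\<And>p. p \<in> path_image \<sigma> \<inter> Lam \<theta> \<Longrightarrow> phi2 u2 x0 \<theta> p \<le> \<phi> p"
begin

abbreviation "ph2 \<equiv> phi2 u2 x0 \<theta>"
definition "psi p = \<phi> p - ph2 p"
definition "psi_hess p h = hess \<phi> p h + (norm h)\<^sup>2"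

lemma Ck2_Omega: "Ck 2 \<Omega> \<phi>" using smooth by (simp add: smooth_in_def)

lemma differentiable_phi: "p \<in> \<Omega> \<Longrightarrow> \<phi> differentiable (at p)"
  using Ck_1D(1)[OF Ck_2D(1)[OF Ck2_Omega]] .

lemma psi_second_along:
  assumes "p \<in> \<Omega>"
  shows "second_along psi p h (psi_hess p h)"
  using second_along_diff[OF second_along_hess[OF Omega_topology(1) assms Ck2_Omega] second_along_phi2, where e = 1 and h = h]
  unfolding psi_def[abs_def] psi_hess_def by simp

lemma quadratic_form_psi_hess: "quadratic_form (psi_hess p)"
proof -
  have "psi_hess p = (\<lambda>h. hess \<phi> p h - (-1) * (1 * (norm h)\<^sup>2))" by (auto simp: psi_hess_def)
  then show ?thesis using quadratic_form_diff[OF quadratic_form_hess quadratic_form_norm] by metis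
qed

lemma psi_equation: "p \<in> \<Omega> \<Longrightarrow> flow_op (sound_sq_of \<gamma> \<rho>0 \<phi> p) (grad \<phi> p) (psi_hess p) = 0"
  unfolding psi_hess_def[abs_def]
  using flow_equation[OF \<gamma> weak Omega_topology(1,5) _ Ck2_Omega ell] .

lemma phi_lipschitz: "\<exists>L. L-lipschitz_on (Lam \<theta> \<inter> ball 0 R) \<phi>"
  using weak by (simp add: weak_solution_def)

text \<open>Moving outward along the radius, one enters the region of state (2).\<close>
lemma Arc_int_limit: "p \<in> Arc_int \<Longrightarrow> p \<in> closure (Reg2 \<inter> ball p r)" if "r > 0"
proof -
  assume p: "p \<in> Arc_int"
  obtain k where k: "k > 0" "\<And>q. q \<in> ball p k \<Longrightarrow> cc < norm (q - zz) \<Longrightarrow> q \<in> Reg2"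
    using near_Arc_int[OF p] by metis
  have n: "norm (p - zz) = cc" using p Arc_norm by (auto simp: sonic_arc_interior_def)
  show ?thesis unfolding closure_approachable
  proof (intro allI impI)
    fix e :: real assume "0 < e"
    define m where "m = min (min k r) e / (2 * cc)"
    have m: "0 < m" using cc_pos k \<open>0 < e\<close> that by (simp add: m_def)
    have "m * cc = min (min k r) e / 2" using cc_pos by (simp add: m_def)
    then have mc: "m * cc < k" "m * cc < r" "m * cc < e" using k \<open>0 < e\<close> that by auto
    define q where "q = p + m *\<^sub>R (p - zz)"
    have dq: "dist p q = m * cc" using m n by (simp add: q_def dist_norm)
    have "q - zz = (1 + m) *\<^sub>R (p - zz)" by (simp add: q_def algebra_simps)
    then have "norm (q - zz) = (1 + m) * cc" using m n by simp
    then have "cc < norm (q - zz)" using m cc_pos by simp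
    then have "q \<in> Reg2" using k(2)[of q] dq mc by simp
    then show "\<exists>y\<in>Reg2 \<inter> ball p r. dist y p < e"
      using dq mc by (intro bexI[of _ q]) (auto simp: dist_commute)
  qed
qed

text \<open>Since \<open>\<phi>\<close> is Lipschitz on bounded parts of \<open>Lam \<theta>\<close>, the function \<open>\<psi>\<close> extends continuously to the closure of
  \<open>\<Omega>\<close>, including the points \<open>P\<^sub>2\<close> and \<open>P\<^sub>4\<close> on the boundary of \<open>Lam \<theta>\<close>. Its sign on the arc is inherited from the
  region of state (2), and at \<open>P\<^sub>2\<close> and \<open>P\<^sub>4\<close> it follows by passing to the limit along the shock and the arc.\<close>
lemma phi_extension:
  obtains f where "continuous_on (closure \<Omega>) f" "\<And>p. p \<in> \<Omega> \<Longrightarrow> f p = psi p"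
    "\<And>p. p \<in> path_image \<sigma> \<union> Arc \<Longrightarrow> 0 \<le> f p"
proof -
  have "bounded (closure \<Omega>)" using Omega_topology(3) by (simp add: bounded_closure)
  then obtain R where R: "closure \<Omega> \<subseteq> ball 0 R" using bounded_subset_ballD by blast
  obtain L where "L-lipschitz_on (Lam \<theta> \<inter> ball 0 R) \<phi>" using phi_lipschitz by blast
  then obtain g where g: "L-lipschitz_on (closure (Lam \<theta> \<inter> ball 0 R)) g" "\<And>p. p \<in> Lam \<theta> \<inter> ball 0 R \<Longrightarrow> g p = \<phi> p"
    using lipschitz_extend_closure by metis
  define D where "D = Lam \<theta> \<inter> ball 0 R"
  have oD: "open D" unfolding D_def using open_Lam by auto
  define f where "f = (\<lambda>p. g p - ph2 p)"
  have cg: "continuous_on (closure D) g" using g(1) lipschitz_on_continuous_on unfolding D_def by blast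
  have cf: "continuous_on (closure D) f" unfolding f_def by (intro continuous_intros cg continuous_on_phi2)
  have fD: "f p = psi p" if "p \<in> D" for p using that g(2) by (simp add: f_def psi_def D_def)
  have Om_D: "\<Omega> \<subseteq> D" using Omega_topology(5) R closure_subset[of \<Omega>] unfolding D_def by blast
  have J_cl: "J \<subseteq> closure \<Omega>" using Omega_topology(4) by (auto simp: frontier_def)
  have J_D: "p \<in> D" if "p \<in> J" "p \<in> Lam \<theta>" for p using that J_cl R unfolding D_def by blast
  have ge_closure: "0 \<le> f p" if "p \<in> closure S" "S \<subseteq> closure D" "\<And>q. q \<in> S \<Longrightarrow> 0 \<le> f q" for p S
    by (rule continuous_ge_on_closure[OF continuous_on_subset[OF cf] that(1,3)])
      (use that(2) closure_minimal in auto)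
  have s1: "0 \<le> f p" if "p \<in> path_image \<sigma>" "p \<in> Lam \<theta>" for p
    using fD[OF J_D[of p]] psi_ge_on_shock[of p] that by (simp add: J_def psi_def)
  have a1: "0 \<le> f p" if p: "p \<in> Arc_int" for p
  proof -
    have "p \<in> D" using p Arc_int_Lam by (intro J_D) (auto simp: J_def sonic_arc_interior_def)
    then obtain r where r: "r > 0" "ball p r \<subseteq> D" using oD open_contains_ball by blast
    show ?thesis
    proof (rule ge_closure[OF Arc_int_limit[OF r(1) p]])
      show "Reg2 \<inter> ball p r \<subseteq> closure D" using r closure_subset by blast
      fix q assume "q \<in> Reg2 \<inter> ball p r"
      then show "0 \<le> f q" using fD[of q] reg2[of q] r by (auto simp: psi_def)
    qed
  qed
  have p4: "0 \<le> f p4"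
  proof (rule ge_closure[OF p4_closure])
    show "Arc_int \<subseteq> closure D"
      using J_D Arc_int_Lam closure_subset[of D] by (auto simp: J_def sonic_arc_interior_def)
  qed (rule a1)
  have p2: "0 \<le> f p2"
  proof (rule ge_closure)
    have L: "\<sigma> t \<in> D" if "t \<in> {0<..<1}" for t
      using that shock_props(5)[of t] by (intro J_D) (auto simp: J_def path_image_def)
    have c: "continuous_on (closure {0<..<1}) \<sigma>" using shock_props(1) by (simp add: arc_def path_def)
    have "\<sigma> ` closure {0<..<1} \<subseteq> closure (\<sigma> ` {0<..<1})"
      by (rule image_closure_subset[OF c closed_closure closure_subset])
    then show "p2 \<in> closure (\<sigma> ` {0<..<1})" by (auto simp: pathfinish_def)
    show "\<sigma> ` {0<..<1} \<subseteq> closure D" using L closure_subset by blast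
    fix q assume "q \<in> \<sigma> ` {0<..<1}"
    then obtain t where "t \<in> {0<..<1}" "q = \<sigma> t" by blast
    then show "0 \<le> f q" using shock_props(5)[of t] by (intro s1) (auto simp: path_image_def)
  qed
  show ?thesis
  proof (rule that[of f])
    show "continuous_on (closure \<Omega>) f" by (rule continuous_on_subset[OF cf closure_mono[OF Om_D]])
    show "f p = psi p" if "p \<in> \<Omega>" for p by (rule fD[OF subsetD[OF Om_D that]])
    fix p assume "p \<in> path_image \<sigma> \<union> Arc"
    then consider "p \<in> path_image \<sigma>" "p \<in> Lam \<theta>" | "p = p2" | "p = p4" | "p \<in> Arc_int" | "p = P1"
      using shock_cases unfolding sonic_arc_interior_def by blast
    then show "0 \<le> f p"
    proof cases
      case 5
      then show ?thesis using s1 P1Lam shock_props(2) pathstart_in_path_image by metis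
    qed (use s1 p2 p4 a1 in auto)
  qed
qed

text \<open>Hoelder continuity extends \<open>D\<phi>\<close> to the closure of \<open>\<Omega>\<close>. Near a point of a wall \<open>Lam \<theta>\<close> coincides with \<open>\<Omega>\<close>, so the
  extension is the limit of \<open>D\<phi>\<close> to which the slip condition applies.\<close>
lemma grad_extension:
  obtains G where "continuous_on (closure \<Omega>) G" "\<And>p. p \<in> \<Omega> \<Longrightarrow> G p = grad \<phi> p"
    "\<And>p. p \<in> J \<Longrightarrow> p \<notin> Lam \<theta> \<Longrightarrow> p \<noteq> p2 \<Longrightarrow> p \<noteq> p4 \<Longrightarrow> p \<noteq> 0 \<Longrightarrow> G p \<bullet> wall_normal \<theta> p = 0"
proof -
  obtain a C where a: "0 < a" and C: "\<And>p q. p \<in> \<Omega> \<Longrightarrow> q \<in> \<Omega> \<Longrightarrow> dist (grad \<phi> p) (grad \<phi> q) \<le> C * dist p q powr a"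
    using holder unfolding C1_holder_up_to_boundary_def greaterThanLessThan_iff Bex_def by blast
  have uc: "uniformly_continuous_on \<Omega> (grad \<phi>)"
    unfolding uniformly_continuous_on_def
  proof (intro allI impI)
    fix e :: real assume e: "0 < e"
    define d where "d = (e / (\<bar>C\<bar> + 1)) powr (1 / a)"
    have d: "0 < d" using e by (simp add: d_def)
    have "dist (grad \<phi> q) (grad \<phi> p) < e" if "p \<in> \<Omega>" "q \<in> \<Omega>" "dist q p < d" for p q
    proof -
      have "dist q p powr a \<le> d powr a" using that a by (intro powr_mono2) auto
      also have "d powr a = e / (\<bar>C\<bar> + 1)" using a e by (simp add: d_def powr_powr)
      finally have "(\<bar>C\<bar> + 1) * dist q p powr a \<le> e" by (simp add: field_simps)
      moreover have "dist (grad \<phi> q) (grad \<phi> p) \<le> \<bar>C\<bar> * dist q p powr a"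
        using C[OF that(2,1)] mult_right_mono[OF abs_ge_self[of C] powr_ge_zero[of "dist q p" a]] by linarith
      ultimately show ?thesis
      proof (cases "q = p")
        case False
        then have "0 < dist q p powr a" by simp
        moreover have "dist q p powr a + \<bar>C\<bar> * dist q p powr a \<le> e"
          using \<open>(\<bar>C\<bar> + 1) * dist q p powr a \<le> e\<close> by (simp add: algebra_simps)
        ultimately show ?thesis using \<open>dist (grad \<phi> q) (grad \<phi> p) \<le> \<bar>C\<bar> * dist q p powr a\<close> by linarith
      qed (use e in simp)
    qed
    then have "\<forall>p\<in>\<Omega>. \<forall>q\<in>\<Omega>. dist q p < d \<longrightarrow> dist (grad \<phi> q) (grad \<phi> p) < e"
      by (intro ballI impI)
    with d show "\<exists>d>0. \<forall>p\<in>\<Omega>. \<forall>q\<in>\<Omega>. dist q p < d \<longrightarrow> dist (grad \<phi> q) (grad \<phi> p) < e"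
      by (intro exI[of _ d] conjI)
  qed
  obtain G where G: "uniformly_continuous_on (closure \<Omega>) G" "\<And>p. p \<in> \<Omega> \<Longrightarrow> grad \<phi> p = G p"
    by (rule uniformly_continuous_on_extension_on_closure[OF uc], rule that)
  have cG: "continuous_on (closure \<Omega>) G" using G(1) by (rule uniformly_continuous_imp_continuous)
  show ?thesis
  proof (rule that[OF cG])
    show "G p = grad \<phi> p" if "p \<in> \<Omega>" for p using G(2)[OF that] by simp
    fix p assume p: "p \<in> J" "p \<notin> Lam \<theta>" "p \<noteq> p2" "p \<noteq> p4" "p \<noteq> 0"
    obtain k where k: "k > 0" "Lam \<theta> \<inter> ball p k \<subseteq> \<Omega>" using near_wall[OF p(1-4)] .
    have pc: "p \<in> closure \<Omega>" using p(1) Omega_topology(4) by (auto simp: frontier_def)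
    have ev: "\<forall>\<^sub>F q in at p within Lam \<theta>. q \<in> \<Omega>"
      unfolding eventually_at using k by (intro exI[of _ k]) (auto simp: dist_commute)
    have "(G \<longlongrightarrow> G p) (at p within closure \<Omega>)" using cG pc by (auto simp: continuous_on_def)
    moreover have "at p within Lam \<theta> \<le> at p within closure \<Omega>"
      unfolding le_filter_def
    proof (intro allI impI)
      fix P assume "\<forall>\<^sub>F x in at p within closure \<Omega>. P x"
      then have "\<forall>\<^sub>F x in at p. x \<in> closure \<Omega> \<longrightarrow> P x" by (simp add: eventually_at_filter)
      then have "\<forall>\<^sub>F x in at p within Lam \<theta>. x \<in> closure \<Omega> \<longrightarrow> P x"
        by (auto simp: eventually_at_filter elim: eventually_mono)
      then show "\<forall>\<^sub>F x in at p within Lam \<theta>. P x"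
        using ev by eventually_elim (use closure_subset in auto)
    qed
    ultimately have "(G \<longlongrightarrow> G p) (at p within Lam \<theta>)" using tendsto_mono by blast
    then have "(grad \<phi> \<longlongrightarrow> G p) (at p within Lam \<theta>)"
      by (rule Lim_transform_eventually) (use ev G(2) in \<open>auto elim: eventually_mono\<close>)
    moreover have "\<forall>\<^sub>F q in at p within Lam \<theta>. \<phi> differentiable (at q)"
      using ev by (rule eventually_mono) (rule differentiable_phi)
    moreover have "p \<in> frontier (Lam \<theta>) - {0}"
    proof -
      have "p \<in> closure (Lam \<theta>)" using pc Omega_topology(5) closure_mono by blast
      then show ?thesis using p open_Lam by (simp add: frontier_def interior_open)
    qed
    ultimately show "G p \<bullet> wall_normal \<theta> p = 0" using slip unfolding slip_condition_def by blast
  qed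
qed

lemma wall_cases:
  assumes p: "p \<in> J" "p \<notin> path_image \<sigma> \<union> Arc"
  shows "p \<notin> Lam \<theta>" "p \<noteq> p2" "p \<noteq> p4" "(snd p = 0 \<and> fst p < 0) \<or> (\<exists>s\<ge>0. p = s *\<^sub>R (cos \<theta>, sin \<theta>))"
proof -
  show "p \<noteq> p2" "p \<noteq> p4" using p p4_Arc by auto
  show "p \<notin> Lam \<theta>" using p wall_not_Lam unfolding J_def by blast
  have "p \<notin> Arc_int" using p by (auto simp: sonic_arc_interior_def)
  then show "(snd p = 0 \<and> fst p < 0) \<or> (\<exists>s\<ge>0. p = s *\<^sub>R (cos \<theta>, sin \<theta>))"
    using J_cases[OF p(1)] p(2) p4_Arc by auto
qed

lemma floor_direction:
  assumes "snd p = 0" "fst p < 0" "0 < t"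
  shows "p + t *\<^sub>R (0, 1) \<in> Lam \<theta>"
  using assms trig mult_neg_pos[of "fst p" "sin \<theta>"] by (simp add: Lam_iff nu_inner)
    (smt (verit) mult_pos_pos)

lemma wedge_direction:
  assumes "p = s *\<^sub>R (cos \<theta>, sin \<theta>)" "0 \<le> s" "0 < t"
  shows "p + t *\<^sub>R nu \<in> Lam \<theta>" "nu \<bullet> p = 0"
proof -
  show "nu \<bullet> p = 0" using assms by (simp add: nu_inner)
  then have "nu \<bullet> (p + t *\<^sub>R nu) = t" by (simp add: inner_add_right nu_nu)
  moreover have "0 < snd (p + t *\<^sub>R nu)" using assms trig by (simp add: wedge_normal_def add_nonneg_pos)
  ultimately show "p + t *\<^sub>R nu \<in> Lam \<theta>" using assms by (simp add: Lam_iff)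
qed

text \<open>The weak minimum principle, with the corrector \<open>g = |q|\<^sup>2 + \<nu> \<bullet> q\<close>, where \<open>\<nu>\<close> is the unit normal of the wedge. At a
  point of the open segment \<open>P\<^sub>2P\<^sub>3\<close> the derivative of \<open>\<psi> - e g\<close> in direction \<open>(0, 1)\<close> is
  \<open>- u2 tan \<theta> - e cos \<theta>\<close>. On the wedge, including the vertex \<open>P\<^sub>3\<close>, its derivative in direction \<open>\<nu>\<close> is
  \<open>- e\<close>. In both cases \<open>\<psi> - e g\<close> is smaller inside \<open>\<Omega>\<close> than at the boundary point.\<close>
lemma psi_nonneg: "p \<in> \<Omega> \<Longrightarrow> 0 \<le> psi p"
proof -
  assume pOm: "p \<in> \<Omega>"
  obtain f where cf: "continuous_on (closure \<Omega>) f" and f: "\<And>p. p \<in> \<Omega> \<Longrightarrow> f p = psi p"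
    "\<And>p. p \<in> path_image \<sigma> \<union> Arc \<Longrightarrow> 0 \<le> f p" using phi_extension by blast
  obtain G where cG: "continuous_on (closure \<Omega>) G" and G: "\<And>p. p \<in> \<Omega> \<Longrightarrow> G p = grad \<phi> p"
    "\<And>p. p \<in> J \<Longrightarrow> p \<notin> Lam \<theta> \<Longrightarrow> p \<noteq> p2 \<Longrightarrow> p \<noteq> p4 \<Longrightarrow> p \<noteq> 0 \<Longrightarrow> G p \<bullet> wall_normal \<theta> p = 0"
    using grad_extension by blast
  let ?g = "\<lambda>q. (norm q)\<^sup>2 + nu \<bullet> q"
  have cl: "closure \<Omega> = \<Omega> \<union> J" using Omega_topology(4) closure_Un_frontier by metis
  have descend: "\<exists>q\<in>closure \<Omega>. f q - e * ?g q < f p - e * ?g p"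
    if p: "p \<in> closure \<Omega>" and k: "k > 0" "\<And>t. 0 < t \<Longrightarrow> t < k \<Longrightarrow> p + t *\<^sub>R d \<in> \<Omega>"
      and neg: "(G p - (zz - p)) \<bullet> d - e * (2 * (p \<bullet> d) + nu \<bullet> d) < 0" for p d k e
  proof -
    let ?q = "\<lambda>t. p + t *\<^sub>R d"
    let ?H' = "\<lambda>t. (G (?q t) - (zz - ?q t)) \<bullet> d - e * (2 * (?q t \<bullet> d) + nu \<bullet> d)"
    have seg: "?q t \<in> closure \<Omega>" if "t \<in> {0..k / 2}" for t
      using that p k(2)[of t] k(1) closure_subset[of \<Omega>] by (cases "t = 0") auto
    have im: "?q ` {0..k / 2} \<subseteq> closure \<Omega>" using seg by blast
    have cq: "continuous_on {0..k / 2} ?q" by (intro continuous_intros)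
    have cGq: "continuous_on {0..k / 2} (\<lambda>t. G (?q t))"
      using continuous_on_compose2[OF cG cq im] .
    have cH': "continuous_on {0..k / 2} ?H'" by (intro continuous_intros cGq)
    have "0 < - ?H' 0" using neg by simp
    moreover have "0 \<in> {0..k / 2}" using k by simp
    ultimately obtain m where m: "0 < m" "\<And>t. t \<in> {0..k / 2} \<Longrightarrow> dist t 0 < m \<Longrightarrow> dist (?H' t) (?H' 0) < - ?H' 0"
      using cH' unfolding continuous_on_iff by meson
    have Hneg: "?H' t < 0" if "0 < t" "t < m" "t \<le> k / 2" for t
    proof -
      have "dist (?H' t) (?H' 0) < - ?H' 0" using m(2)[of t] that by (simp add: dist_real_def)
      then show ?thesis unfolding dist_real_def by linarith
    qed
    define b where "b = min (k / 2) (m / 2)"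
    have b: "0 < b" "b \<le> k / 2" "b < m" using k m by (auto simp: b_def)
    let ?H = "\<lambda>t. f (?q t) - e * ?g (?q t)"
    have cH: "continuous_on {0..b} ?H"
    proof -
      have "continuous_on {0..b} (\<lambda>t. f (?q t))"
        by (rule continuous_on_subset[OF continuous_on_compose2[OF cf cq im]]) (use b in auto)
      then show ?thesis by (intro continuous_intros)
    qed
    have dH: "(?H has_derivative (\<lambda>s. ?H' t * s)) (at t)" if t: "0 < t" "t < b" for t
    proof -
      have qOm: "?q t \<in> \<Omega>" using k(2) t b by simp
      have d1: "((\<lambda>t. \<phi> (?q t)) has_real_derivative grad \<phi> (?q t) \<bullet> d) (at t)"
        by (rule has_real_derivative_along_line[OF differentiable_phi[OF qOm]])
      have d2: "((\<lambda>t. ph2 (?q t)) has_real_derivative grad ph2 (?q t) \<bullet> d) (at t)"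
        by (rule has_real_derivative_along_line[OF differentiable_phi2])
      have d3: "((\<lambda>t. psi (?q t)) has_real_derivative (G (?q t) - (zz - ?q t)) \<bullet> d) (at t)"
        using DERIV_diff[OF d1 d2] unfolding psi_def by (simp add: G(1)[OF qOm] grad_phi2_center inner_diff_left)
      have "open (?q -` \<Omega>)" by (rule open_vimage[OF Omega_topology(1)]) (intro continuous_intros)
      then have d4: "((\<lambda>t. f (?q t)) has_real_derivative (G (?q t) - (zz - ?q t)) \<bullet> d) (at t)"
        by (rule has_field_derivative_transform_within_open[OF d3]) (use qOm f(1) in auto)
      have *: "(\<lambda>t. ?g (?q t)) = (\<lambda>t. (norm p)\<^sup>2 + 2 * t * (p \<bullet> d) + t\<^sup>2 * (norm d)\<^sup>2 + (nu \<bullet> p + t * (nu \<bullet> d)))"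
        using norm_sq_along[of p _ d 0] by (auto simp: inner_add_right)
      have d5: "((\<lambda>t. ?g (?q t)) has_real_derivative 2 * (?q t \<bullet> d) + nu \<bullet> d) (at t)"
        unfolding * by (rule derivative_eq_intros refl)+ (simp add: inner_add_left power2_norm_eq_inner)
      have "(?H has_real_derivative ?H' t) (at t)"
        using DERIV_diff[OF d4 DERIV_cmult[OF d5, of e]] .
      then show ?thesis by (simp add: has_field_derivative_def)
    qed
    obtain x where x: "0 < x" "x < b" "?H b - ?H 0 = ?H' x * (b - 0)"
      using mvt[OF b(1) cH dH] by blast
    have "?H' x < 0" using Hneg[of x] x b by simp
    then have "?H' x * (b - 0) < 0" using b(1) by (simp add: mult_neg_pos)
    then have "?H b < ?H 0" using x(3) by linarith
    then show ?thesis using seg[of b] b by (intro bexI[of _ "?q b"]) auto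
  qed
  have wall: "G p \<bullet> nu = 0" if p: "p \<in> J" "p \<notin> Lam \<theta>" "p \<noteq> p2" "p \<noteq> p4" "p = s *\<^sub>R (cos \<theta>, sin \<theta>)" "0 \<le> s" for p s
  proof (cases "s = 0")
    case False
    then have "0 < s" using p by simp
    then have "0 < fst p" using p(5) trig by simp
    then have "p \<noteq> 0" "\<not> fst p < 0" by auto
    then show ?thesis using G(2)[OF p(1-4)] by (simp add: wall_normal_def wedge_normal_def)
  next
    case True
    then have p0: "p = 0 *\<^sub>R (cos \<theta>, sin \<theta>)" using p(5) by simp
    \<comment> \<open>The vertex has no normal of its own, but it is a limit of points of the open wedge segment.\<close>
    let ?S = "(\<lambda>s. s *\<^sub>R (cos \<theta>, sin \<theta>)) ` {0<..<u2 / cos \<theta> + cc}"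
    have pos: "0 < u2 / cos \<theta> + cc" using u2 trig cc_pos by (simp add: add_pos_pos)
    have SJ: "q \<in> J \<and> G q \<bullet> nu = 0" if "q \<in> ?S" for q
    proof -
      obtain s where s: "0 < s" "s < u2 / cos \<theta> + cc" "q = s *\<^sub>R (cos \<theta>, sin \<theta>)" using \<open>q \<in> ?S\<close> by auto
      have p4: "p4 = (u2 / cos \<theta> + cc) *\<^sub>R (cos \<theta>, sin \<theta>)"
        using trig by (simp add: P4_def sonic_center_def field_simps)
      define r where "r = s / (u2 / cos \<theta> + cc)"
      have r: "0 < r" "r < 1" "r * (u2 / cos \<theta> + cc) = s" using s pos by (auto simp: r_def)
      have "q = (1 - r) *\<^sub>R P3 + r *\<^sub>R p4" unfolding p4 s(3) r(3)[symmetric] by (simp add: P3_def)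
      then have "q \<in> closed_segment P3 p4" unfolding in_segment using r by (intro exI[of _ r]) auto
      then have qJ: "q \<in> J" and qL: "q \<notin> Lam \<theta>" using wall_not_Lam by (auto simp: J_def)
      have "0 < fst q" using s trig by simp
      then have "q \<noteq> 0" "q \<noteq> p2" "\<not> fst q < 0" using shock_props(3) by auto
      moreover have "fst q \<noteq> fst p4" unfolding p4 s(3) using s(2) trig by simp
      ultimately show ?thesis using G(2)[OF qJ qL] qJ by (auto simp: wall_normal_def wedge_normal_def)
    qed
    have SC: "closure ?S \<subseteq> closure \<Omega>" using SJ cl by (intro closure_minimal closed_closure) blast
    have "p \<in> closure ?S"
    proof -
      have "(\<lambda>s. s *\<^sub>R (cos \<theta>, sin \<theta>)) ` closure {0<..<u2 / cos \<theta> + cc} \<subseteq> closure ?S"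
        by (rule image_closure_subset) (auto intro!: continuous_intros closure_subset)
      moreover have "0 \<in> closure {0<..<u2 / cos \<theta> + cc}" using pos by simp
      ultimately show ?thesis unfolding p0 by blast
    qed
    moreover have "continuous_on (closure ?S) (\<lambda>q. G q \<bullet> nu)"
      using continuous_on_subset[OF cG SC] by (intro continuous_intros)
    ultimately show ?thesis
      using continuous_constant_on_closure[of ?S "\<lambda>q. G q \<bullet> nu" 0 p] SJ by blast
  qed
  have "0 \<le> f p"
  proof (rule weak_minimum_principle[OF Omega_topology(1,3) cf _ _ _ pOm])
    show "continuous_on (closure \<Omega>) ?g" by (intro continuous_intros)
    fix x assume x: "x \<in> \<Omega>"
    have K: "(norm (grad \<phi> x))\<^sup>2 < sound_sq_of \<gamma> \<rho>0 \<phi> x" using elliptic_atD[OF ell[OF x]] by simp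
    have "flow_op (sound_sq_of \<gamma> \<rho>0 \<phi> x) (grad \<phi> x) (\<lambda>h. 2 * (norm h)\<^sup>2)
        = 4 * sound_sq_of \<gamma> \<rho>0 \<phi> x - 2 * (norm (grad \<phi> x))\<^sup>2"
      by (simp add: flow_op_def norm_Pair)
    then have "0 < flow_op (sound_sq_of \<gamma> \<rho>0 \<phi> x) (grad \<phi> x) (\<lambda>h. 2 * (norm h)\<^sup>2)"
      using K zero_le_power2[of "norm (grad \<phi> x)"] by linarith
    moreover have "second_along f x h (psi_hess x h)" for h
      using second_along_cong[OF Omega_topology(1) x f(1) psi_second_along[OF x]] .
    ultimately show "strictly_sub f ?g x"
      using psi_equation[OF x]
      by (intro strictly_subI[OF quadratic_form_psi_hess quadratic_form_norm _ second_along_wall_corrector K]) auto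
  next
    fix p e assume "p \<in> frontier \<Omega>" and fp: "f p < 0" and e: "(0::real) < e"
    then have pJ: "p \<in> J" using Omega_topology(4) by simp
    have pn: "p \<notin> path_image \<sigma> \<union> Arc" using f(2)[of p] fp by auto
    note w = wall_cases[OF pJ pn]
    obtain k where k: "k > 0" "Lam \<theta> \<inter> ball p k \<subseteq> \<Omega>" using near_wall[OF pJ w(1-3)] .
    have pc: "p \<in> closure \<Omega>" using pJ cl by simp
    from w(4) show "\<exists>q\<in>closure \<Omega>. f q - e * ?g q < f p - e * ?g p"
    proof (elim disjE conjE exE)
      assume p: "snd p = 0" "fst p < 0"
      show ?thesis
      proof (rule descend[OF pc k(1)])
        show "p + t *\<^sub>R (0, 1) \<in> \<Omega>" if "0 < t" "t < k" for t
        proof -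
          have "norm (t *\<^sub>R (0, 1) :: plane) = t" unfolding norm_scaleR using that by (simp add: norm_prod_def)
          then have "p + t *\<^sub>R (0, 1) \<in> ball p k" using that by (simp add: dist_norm)
          then show ?thesis using floor_direction[OF p that(1)] k(2) by blast
        qed
        have "p \<noteq> 0" using p by auto
        then have "G p \<bullet> (0, 1) = 0" using G(2)[OF pJ w(1-3)] p by (simp add: wall_normal_def)
        moreover have "(zz - p) \<bullet> (0, 1) = u2 * tan \<theta>" using p by (simp add: sonic_center_def inner_prod_def)
        moreover have "p \<bullet> (0, 1) = 0" "nu \<bullet> (0, 1) = cos \<theta>" using p by (simp_all add: inner_prod_def wedge_normal_def)
        moreover have "0 < u2 * tan \<theta>" "0 < e * cos \<theta>" using u2 trig e by simp_all
        ultimately show "(G p - (zz - p)) \<bullet> (0, 1) - e * (2 * (p \<bullet> (0, 1)) + nu \<bullet> (0, 1)) < 0"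
          by (simp only: inner_diff_left[of "G p" "zz - p"] mult_zero_right add_0)
      qed
    next
      fix s assume s: "s \<ge> 0" "p = s *\<^sub>R (cos \<theta>, sin \<theta>)"
      show ?thesis
      proof (rule descend[OF pc k(1)])
        show "p + t *\<^sub>R nu \<in> \<Omega>" if "0 < t" "t < k" for t
        proof -
          have "p + t *\<^sub>R nu \<in> ball p k" using that by (simp add: dist_norm norm_nu)
          then show ?thesis using wedge_direction(1)[OF s(2,1) that(1)] k(2) by blast
        qed
        have n: "nu \<bullet> p = 0" using wedge_direction(2)[OF s(2,1), of 1] by simp
        have "G p \<bullet> nu = 0" by (rule wall[OF pJ w(1-3) s(2,1)])
        moreover have "(zz - p) \<bullet> nu = 0" using n nu_zz by (simp add: inner_commute[of _ nu] inner_diff_right)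
        ultimately show "(G p - (zz - p)) \<bullet> nu - e * (2 * (p \<bullet> nu) + nu \<bullet> nu) < 0"
          using n e by (simp add: inner_diff_left[of "G p"] nu_nu inner_commute[of p])
      qed
    qed
  qed
  then show ?thesis using f(1)[OF pOm] by simp
qed

lemma psi_grad: "p \<in> \<Omega> \<Longrightarrow> grad psi p = grad \<phi> p - (zz - p)"
  unfolding psi_def[abs_def] using grad_diff[OF differentiable_phi differentiable_phi2] by (simp add: grad_phi2_center)

lemma psi_differentiable: "p \<in> \<Omega> \<Longrightarrow> psi differentiable (at p)"
  unfolding psi_def[abs_def] by (intro differentiable_diff differentiable_phi differentiable_phi2)

text \<open>If \<open>\<psi>\<close> vanished identically, then \<open>D\<phi> = D\<phi>\<^sub>2\<close> up to the boundary; but \<open>D\<phi>\<^sub>2\<close> has the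
  component \<open>u2 tan \<theta> > 0\<close> normal to the segment \<open>P\<^sub>2P\<^sub>3\<close>, against the slip condition.\<close>
lemma psi_pos: "p \<in> \<Omega> \<Longrightarrow> 0 < psi p"
proof -
  assume p: "p \<in> \<Omega>"
  have "\<exists>y\<in>\<Omega>. 0 < psi y"
  proof (rule ccontr)
    assume "\<not> (\<exists>y\<in>\<Omega>. 0 < psi y)"
    then have z: "psi q = 0" if "q \<in> \<Omega>" for q using psi_nonneg[OF that] that by force
    obtain G where cG: "continuous_on (closure \<Omega>) G" and G: "\<And>p. p \<in> \<Omega> \<Longrightarrow> G p = grad \<phi> p"
      "\<And>p. p \<in> J \<Longrightarrow> p \<notin> Lam \<theta> \<Longrightarrow> p \<noteq> p2 \<Longrightarrow> p \<noteq> p4 \<Longrightarrow> p \<noteq> 0 \<Longrightarrow> G p \<bullet> wall_normal \<theta> p = 0"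
      using grad_extension by blast
    have g: "G q - (zz - q) = 0" if q: "q \<in> \<Omega>" for q
    proof -
      have "(psi has_derivative (\<lambda>h. 0)) (at q)"
        by (rule has_derivative_transform_within_open[OF has_derivative_const[of 0] Omega_topology(1) q])
          (use z in simp)
      then have "grad psi q = 0" by (simp add: grad_def Dxi_eqI Deta_eqI zero_prod_def)
      then show ?thesis using psi_grad[OF q] G(1)[OF q] by simp
    qed
    define m where "m = midpoint p2 P3"
    have m: "m = (fst p2 / 2, 0)" using shock_props(4) by (simp add: m_def midpoint_def P3_def prod_eq_iff)
    have "m \<in> closed_segment p2 P3" by (simp add: m_def midpoint_in_closed_segment)
    then have mJ: "m \<in> J" and mL: "m \<notin> Lam \<theta>" using wall_not_Lam by (auto simp: J_def)
    have ne: "m \<noteq> p2" "m \<noteq> p4" "m \<noteq> 0" "fst m < 0" "snd m = 0"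
      using m shock_props(3) snd_zz(3) by (auto simp: prod_eq_iff)
    have "m \<in> closure \<Omega>" using mJ Omega_topology(4) by (auto simp: frontier_def)
    moreover have "continuous_on (closure \<Omega>) (\<lambda>q. G q - (zz - q))" by (intro continuous_intros cG)
    ultimately have "G m - (zz - m) = 0" using g continuous_constant_on_closure[of \<Omega> "\<lambda>q. G q - (zz - q)" 0 m] by blast
    moreover have "G m \<bullet> wall_normal \<theta> m = 0" by (rule G(2)[OF mJ mL ne(1-3)])
    ultimately have "snd zz = 0" using ne(4,5) by (simp add: wall_normal_def inner_prod_def)
    then show False using snd_zz by simp
  qed
  then obtain y where y: "y \<in> \<Omega>" "0 < psi y" by blast
  have cS: "continuous_on \<Omega> (sound_sq_of \<gamma> \<rho>0 \<phi>)"
    unfolding sound_sq_of_alt[abs_def]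
    using Ck_1D(2-4)[OF Ck_2D(1)[OF Ck2_Omega]] by (intro continuous_intros; simp)
  show ?thesis
  proof (rule strong_minimum_principle[OF Omega_topology(1,2) cS continuous_on_grad[OF Ck_2D(1)[OF Ck2_Omega]], where Q = psi_hess])
    show "(norm (grad \<phi> q))\<^sup>2 < sound_sq_of \<gamma> \<rho>0 \<phi> q" if "q \<in> \<Omega>" for q using elliptic_atD[OF ell[OF that]] by simp
    show "flow_op (sound_sq_of \<gamma> \<rho>0 \<phi> q) (grad \<phi> q) (psi_hess q) \<le> 0" if "q \<in> \<Omega>" for q using psi_equation[OF that] by simp
  qed (use y p psi_differentiable quadratic_form_psi_hess psi_second_along psi_nonneg in auto)
qed

end

section \<open>Flatness at the sonic arc\<close>

text \<open>Here \<open>D\<close> stands for \<open>D\<psi>\<close>, so that \<open>D - P\<close> is \<open>D\<phi>\<close>, and \<open>K\<close> for \<open>c\<^sup>2\<close> of the solution. For \<open>D = 0\<close> and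
  \<open>K = c\<^sup>2\<close> the matrix \<open>K I - P P\<^sup>T\<close> has the eigenvalue \<open>s\<close> in the radial direction and \<open>c\<^sup>2\<close> in the tangential
  one, and the operator takes the value \<open>2 c\<^sup>2 s\<close> on \<open>s\<^sup>2 - s \<tau>\<^sup>2\<close>, up to the terms
  \<open>- 12 s\<^sup>2 + 2 \<tau>\<^sup>2 (c\<^sup>2 + 6 s)\<close>. The assumptions on \<open>s\<close>, \<open>K\<close> and \<open>D\<close> keep the
  sum of all errors below \<open>2 c\<^sup>2 s\<close>.\<close>
lemma sonic_barrier_positive:
  fixes P D e :: plane and c s K :: real
  assumes c: "0 < c" and s: "0 < s" "s \<le> c\<^sup>2 / 100" and P: "(norm P)\<^sup>2 = c\<^sup>2 - s"
    and e: "norm e = 1" and \<tau>: "(P \<bullet> e)\<^sup>2 \<le> s"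
    and K: "\<bar>K - c\<^sup>2\<bar> \<le> s / 100" and D: "c * norm D \<le> s / 100" and p: "p - z = P"
  shows "0 < flow_op K (D - P) (barrier_hess z c e 0 1 1 p)"
proof -
  define \<tau>' where "\<tau>' = P \<bullet> e"
  define d where "d = P \<bullet> D"
  define d' where "d' = D \<bullet> e"
  define k where "k = K - c\<^sup>2"
  have Kk: "K = c\<^sup>2 + k" by (simp add: k_def)
  have k: "\<bar>k\<bar> \<le> s / 100" using K by (simp add: k_def)
  have c2: "0 < c\<^sup>2" using c by simp
  have "norm P \<le> c"
    by (rule power2_le_imp_le) (use P s c in auto)
  then have "\<bar>d\<bar> \<le> c * norm D"
    using Cauchy_Schwarz_ineq2[of P D] mult_right_mono[of "norm P" c "norm D"] unfolding d_def by force
  then have d: "\<bar>d\<bar> \<le> s / 100" using D by linarith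
  have "\<bar>d'\<bar> \<le> norm D" using Cauchy_Schwarz_ineq2[of D e] e by (simp add: d'_def)
  then have "c * \<bar>d'\<bar> \<le> c * norm D" using c by (intro mult_left_mono) auto
  then have d': "c * \<bar>d'\<bar> \<le> s / 100" using D by linarith
  have \<tau>2: "\<tau>'\<^sup>2 \<le> s" using \<tau> by (simp add: \<tau>'_def)
  have \<tau>c: "\<bar>\<tau>'\<bar> \<le> c"
    using Cauchy_Schwarz_ineq2[of P e] e \<open>norm P \<le> c\<close> by (simp add: \<tau>'_def)
  have Pv: "P \<bullet> (D - P) = d - (c\<^sup>2 - s)"
    using P by (simp add: inner_diff_right d_def power2_norm_eq_inner)
  have ev: "e \<bullet> (D - P) = d' - \<tau>'" by (simp add: inner_diff_right d'_def \<tau>'_def inner_commute)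
  have vv: "(norm (D - P))\<^sup>2 = (norm D)\<^sup>2 - 2 * d + (c\<^sup>2 - s)"
    using P unfolding power2_norm_eq_inner by (simp add: inner_diff d_def inner_commute)
  define F where "F = 2 * (c\<^sup>2 + k) - ((norm D)\<^sup>2 - 2 * d + (c\<^sup>2 - s))"
  \<comment> \<open>The four groups come from \<open>D s \<otimes> D s\<close>, from \<open>D\<^sup>2s\<close>, from \<open>D s \<otimes> D (\<tau>\<^sup>2)\<close> and from \<open>s D\<^sup>2(\<tau>\<^sup>2)\<close>; they are at
      least \<open>7.6\<close>, \<open>-4.1\<close>, \<open>-0.2\<close> and \<open>-2.1\<close> times \<open>c\<^sup>2 s\<close>.\<close>
  have eq: "flow_op K (D - P) (barrier_hess z c e 0 1 1 p) =
      8 * ((c\<^sup>2 - s) * (s + k + 2 * d) - d\<^sup>2) - 2 * (F * (2 * s - \<tau>'\<^sup>2))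
      + (8 * (\<tau>'\<^sup>2 * (s + k + d)) + 8 * (\<tau>' * d' * (c\<^sup>2 - s - d)))
      - 2 * (s * (c\<^sup>2 + k - (d' - \<tau>')\<^sup>2))"
    unfolding flow_op_barrier_hess p Pv ev vv P e Kk \<tau>'_def[symmetric] F_def
    by (simp add: algebra_simps power2_eq_square)
  have T1: "(96 / 100 * c\<^sup>2) * s \<le> (c\<^sup>2 - s) * (s + k + 2 * d)"
  proof -
    have "(99 / 100 * c\<^sup>2) * (97 / 100 * s) \<le> (c\<^sup>2 - s) * (s + k + 2 * d)"
      using s c2 k d by (intro mult_mono) auto
    moreover have "0 \<le> c\<^sup>2 * s" using c2 s by simp
    ultimately show ?thesis by (simp add: algebra_simps)
  qed
  have T1': "d\<^sup>2 \<le> (1 / 1000 * c\<^sup>2) * s"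
  proof -
    have "\<bar>d\<bar>\<^sup>2 \<le> (s / 100)\<^sup>2" using d by (intro power_mono) auto
    then have "d\<^sup>2 \<le> (s / 100)\<^sup>2" by simp
    also have "\<dots> = (s / 10000) * s" by (simp add: power2_eq_square)
    also have "\<dots> \<le> (1 / 1000 * c\<^sup>2) * s" using s c2 by (intro mult_right_mono) auto
    finally show ?thesis .
  qed
  have T2: "F * (2 * s - \<tau>'\<^sup>2) \<le> (102 / 100 * c\<^sup>2) * (2 * s)"
  proof -
    have "0 \<le> (norm D)\<^sup>2" by simp
    moreover have "k \<le> s / 100" "d \<le> s / 100" using k d by (auto simp: abs_le_iff)
    moreover have "F = c\<^sup>2 + s + 2 * k + 2 * d - (norm D)\<^sup>2" by (simp add: F_def)
    moreover have "102 / 100 * c\<^sup>2 = c\<^sup>2 + 2 * (c\<^sup>2 / 100)" by simp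
    ultimately have "F \<le> 102 / 100 * c\<^sup>2" using s(2) s(1) c2 by linarith
    then have "F * (2 * s - \<tau>'\<^sup>2) \<le> (102 / 100 * c\<^sup>2) * (2 * s - \<tau>'\<^sup>2)"
      using \<tau>2 s by (intro mult_right_mono) auto
    also have "\<dots> \<le> (102 / 100 * c\<^sup>2) * (2 * s)" using c2 by (intro mult_left_mono) auto
    finally show ?thesis .
  qed
  have T3: "0 \<le> \<tau>'\<^sup>2 * (s + k + d)" using k d s by (intro mult_nonneg_nonneg) auto
  have T3': "- ((2 / 100 * c\<^sup>2) * s) \<le> \<tau>' * d' * (c\<^sup>2 - s - d)"
  proof -
    have a: "\<bar>\<tau>' * d'\<bar> \<le> s / 100"
    proof -
      have "\<bar>\<tau>' * d'\<bar> \<le> c * \<bar>d'\<bar>" unfolding abs_mult using \<tau>c by (intro mult_right_mono) auto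
      then show ?thesis using d' by linarith
    qed
    have b: "\<bar>c\<^sup>2 - s - d\<bar> \<le> 2 * c\<^sup>2" using s d c2 by (simp add: abs_le_iff)
    have "\<bar>\<tau>' * d' * (c\<^sup>2 - s - d)\<bar> \<le> (s / 100) * (2 * c\<^sup>2)"
      unfolding abs_mult[of "\<tau>' * d'"] using a b s by (intro mult_mono) auto
    then have "- ((s / 100) * (2 * c\<^sup>2)) \<le> \<tau>' * d' * (c\<^sup>2 - s - d)" by linarith
    then show ?thesis by (simp add: mult_ac)
  qed
  have T4: "s * (c\<^sup>2 + k - (d' - \<tau>')\<^sup>2) \<le> (101 / 100 * c\<^sup>2) * s"
  proof -
    have "0 \<le> (d' - \<tau>')\<^sup>2" by simp
    then have "c\<^sup>2 + k - (d' - \<tau>')\<^sup>2 \<le> 101 / 100 * c\<^sup>2" using k s c2 by linarith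
    then show ?thesis using s by (simp add: mult.commute mult_left_mono)
  qed
  have "0 < c\<^sup>2 * s" using c2 s by simp
  then show ?thesis unfolding eq using T1 T1' T2 T3 T3' T4 by (simp add: algebra_simps)
qed

lemma mvt_segment:
  fixes f :: "plane \<Rightarrow> real"
  assumes "\<And>q. q \<in> closed_segment a b \<Longrightarrow> f differentiable (at q)"
    and "\<And>q. q \<in> closed_segment a b \<Longrightarrow> norm (grad f q) \<le> B"
  shows "\<bar>f b - f a\<bar> \<le> B * norm (b - a)"
proof -
  let ?q = "\<lambda>t. a + t *\<^sub>R (b - a)"
  have seg: "?q t \<in> closed_segment a b" if "0 \<le> t" "t \<le> 1" for t
    unfolding in_segment using that by (intro exI[of _ t]) (simp add: algebra_simps)
  obtain t where t: "0 < t" "t < 1" "f (?q 1) - f (?q 0) = (1 - 0) * (grad f (?q t) \<bullet> (b - a))"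
    using MVT2[of 0 1 "\<lambda>t. f (?q t)" "\<lambda>t. grad f (?q t) \<bullet> (b - a)"]
      has_real_derivative_along_line[OF assms(1)[OF seg]] by auto
  have "\<bar>f b - f a\<bar> = \<bar>grad f (?q t) \<bullet> (b - a)\<bar>" using t by simp
  also have "\<dots> \<le> norm (grad f (?q t)) * norm (b - a)" by (rule Cauchy_Schwarz_ineq2)
  also have "\<dots> \<le> B * norm (b - a)" using assms(2)[OF seg] t by (intro mult_right_mono) auto
  finally show ?thesis .
qed

lemma eq_on_closure_point:
  fixes f g :: "plane \<Rightarrow> real"
  assumes "open U" "p \<in> U" "continuous_on U f" "continuous_on U g" "p \<in> closure S"
    and "\<And>q. q \<in> S \<Longrightarrow> q \<in> U \<Longrightarrow> f q = g q"
  shows "f p = g p"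
proof (rule ccontr)
  assume n: "f p \<noteq> g p"
  have "open (U \<inter> (\<lambda>q. f q - g q) -` (- {0}))"
    by (intro continuous_open_preimage assms(1) continuous_intros assms(3,4))
  moreover have "p \<in> U \<inter> (\<lambda>q. f q - g q) -` (- {0})" using n assms(2) by simp
  ultimately obtain q where "q \<in> S" "q \<in> U \<inter> (\<lambda>q. f q - g q) -` (- {0})"
    using assms(5) by (meson IntE closure_iff_nhds_not_empty disjoint_iff subset_refl)
  then show False using assms(6)[of q] by simp
qed

lemma Dxi_Deta_cong:
  assumes "open S" "p \<in> S" "f differentiable (at p)" "\<And>q. q \<in> S \<Longrightarrow> f q = g q"
  shows "Dxi f p = Dxi g p" "Deta f p = Deta g p"
  unfolding Dxi_def Deta_def
  using frechet_derivative_transform_within_open[OF assms(3,1,2,4)] by simp_all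

lemma Dxi_Deta_phi2:
  "Dxi (phi2 u2 x0 \<theta>) = (\<lambda>p. u2 - fst p)" "Deta (phi2 u2 x0 \<theta>) = (\<lambda>p. u2 * tan \<theta> - snd p)"
  using grad_phi2[of u2 x0 \<theta>] by (auto simp: grad_def fun_eq_iff)

lemma has_derivative_affine:
  "((\<lambda>p::plane. a - fst p) has_derivative (\<lambda>h. - fst h)) (at p)"
  "((\<lambda>p::plane. a - snd p) has_derivative (\<lambda>h. - snd h)) (at p)"
  by (auto intro!: derivative_eq_intros)

lemma affine_differentiable:
  "(\<lambda>p::plane. a - fst p) differentiable (at p)" "(\<lambda>p::plane. a - snd p) differentiable (at p)"
  unfolding differentiable_def using has_derivative_affine by blast+

lemma grad_affine:
  "grad (\<lambda>p::plane. a - fst p) p = (-1, 0)" "grad (\<lambda>p::plane. a - snd p) p = (0, -1)"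
  by (simp_all add: grad_def Dxi_eqI[OF has_derivative_affine(1)] Deta_eqI[OF has_derivative_affine(1)]
      Dxi_eqI[OF has_derivative_affine(2)] Deta_eqI[OF has_derivative_affine(2)])

context reflection_solution
begin

text \<open>The assumption to be refuted: \<open>\<phi>\<close> is \<open>C\<^sup>2\<close> in a neighbourhood \<open>U\<close> of the relative interior of the arc.\<close>
context
  fixes U
  assumes U: "open U" "Arc_int \<subseteq> U" "U \<subseteq> Lam \<theta>" and CU: "Ck 2 U \<phi>"
begin

lemma open_Reg2: "open Reg2"
proof -
  have "closed tri_bd" unfolding tri_bd_def path_image_carc[symmetric]
    using arc_carc by (intro closed_Un closed_segment closed_path_image arc_imp_path)
  then show ?thesis unfolding region2_eq by (rule open_inside)
qed

lemma Arc_int_closure_Reg2: "p \<in> Arc_int \<Longrightarrow> p \<in> closure Reg2"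
  using Arc_int_limit[of 1 p] closure_mono[of "Reg2 \<inter> ball p 1" Reg2] by auto

definition "X1 q = Dxi \<phi> q - (u2 - fst q)"
definition "X2 q = Deta \<phi> q - (u2 * tan \<theta> - snd q)"

lemma dU: "q \<in> U \<Longrightarrow> \<phi> differentiable (at q)" "q \<in> U \<Longrightarrow> Dxi \<phi> differentiable (at q)" "q \<in> U \<Longrightarrow> Deta \<phi> differentiable (at q)"
  using Ck_1D(1)[OF Ck_2D(1)[OF CU]] Ck_1D(1)[OF Ck_2D(2)[OF CU]] Ck_1D(1)[OF Ck_2D(3)[OF CU]] by auto

lemma psi_differentiable_U: "q \<in> U \<Longrightarrow> psi differentiable (at q)"
  unfolding psi_def[abs_def] by (intro differentiable_diff dU differentiable_phi2)

lemma grad_psi_U: "q \<in> U \<Longrightarrow> grad psi q = (X1 q, X2 q)"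
  unfolding psi_def[abs_def] X1_def X2_def
  using grad_diff[OF dU(1) differentiable_phi2, of q u2 x0 \<theta>] by (simp add: grad_phi2) (simp add: grad_def)

lemma X_differentiable: "q \<in> U \<Longrightarrow> X1 differentiable (at q)" "q \<in> U \<Longrightarrow> X2 differentiable (at q)"
  unfolding X1_def[abs_def] X2_def[abs_def] by (intro differentiable_diff dU affine_differentiable; assumption)+

lemma grad_X:
  assumes "q \<in> U"
  shows "grad X1 q = grad (Dxi \<phi>) q + (1, 0)" "grad X2 q = grad (Deta \<phi>) q + (0, 1)"
  unfolding X1_def[abs_def] X2_def[abs_def]
  using grad_diff[OF dU(2)[OF assms] affine_differentiable(1), of u2] grad_diff[OF dU(3)[OF assms] affine_differentiable(2), of "u2 * tan \<theta>"]
  by (simp_all add: grad_affine diff_conv_add_uminus[of "grad _ _"] del: diff_conv_add_uminus)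

lemma continuous_grad_X: "continuous_on U (grad X1)" "continuous_on U (grad X2)"
proof -
  have "continuous_on U (\<lambda>q. grad (Dxi \<phi>) q + (1, 0))" "continuous_on U (\<lambda>q. grad (Deta \<phi>) q + (0, 1))"
    by (intro continuous_on_add continuous_on_const continuous_on_grad Ck_2D[OF CU])+
  then show "continuous_on U (grad X1)" "continuous_on U (grad X2)"
    using continuous_on_cong[of U U "grad X1" "\<lambda>q. grad (Dxi \<phi>) q + (1, 0)"] continuous_on_cong[of U U "grad X2" "\<lambda>q. grad (Deta \<phi>) q + (0, 1)"]
    by (simp_all add: grad_X)
qed

lemma zero_Reg2:
  assumes q: "q \<in> Reg2" "q \<in> U"
  shows "psi q = 0" "X1 q = 0" "X2 q = 0" "grad X1 q = 0" "grad X2 q = 0"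
proof -
  have e: "\<phi> q = ph2 q" if "q \<in> Reg2" for q by (rule reg2[OF that])
  have oRU: "open (Reg2 \<inter> U)" using open_Reg2 U(1) by blast
  have d: "Dxi \<phi> q = u2 - fst q" "Deta \<phi> q = u2 * tan \<theta> - snd q" if "q \<in> Reg2 \<inter> U" for q
    using Dxi_Deta_cong[OF oRU that dU(1), of ph2] that e by (auto simp: Dxi_Deta_phi2)
  show "psi q = 0" "X1 q = 0" "X2 q = 0" using e[OF q(1)] d[of q] q by (auto simp: psi_def X1_def X2_def)
  have "grad (Dxi \<phi>) q = grad (\<lambda>q. u2 - fst q) q" "grad (Deta \<phi>) q = grad (\<lambda>q. u2 * tan \<theta> - snd q) q"
    unfolding grad_def
    using Dxi_Deta_cong[OF oRU _ dU(2)[OF q(2)], of "\<lambda>q. u2 - fst q"] Dxi_Deta_cong[OF oRU _ dU(3)[OF q(2)], of "\<lambda>q. u2 * tan \<theta> - snd q"] d q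
    by auto
  then show "grad X1 q = 0" "grad X2 q = 0" unfolding grad_X[OF q(2)] grad_affine by (auto simp: zero_prod_def)
qed

text \<open>All of these functions are continuous in \<open>U\<close> and vanish in the region of state (2).\<close>
lemma zero_Arc_int:
  assumes p: "p \<in> Arc_int"
  shows "psi p = 0" "X1 p = 0" "X2 p = 0" "grad X1 p = 0" "grad X2 p = 0"
proof -
  have pU: "p \<in> U" using p U by blast
  note cl = Arc_int_closure_Reg2[OF p]
  have c: "continuous_on U psi" "continuous_on U X1" "continuous_on U X2"
    by (intro continuous_at_imp_continuous_on ballI differentiable_imp_continuous_within psi_differentiable_U X_differentiable; assumption)+
  have z: "f p = 0" if "continuous_on U f" "\<And>q. q \<in> Reg2 \<Longrightarrow> q \<in> U \<Longrightarrow> f q = 0" for f :: "plane \<Rightarrow> real"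
    by (rule eq_on_closure_point[OF U(1) pU that(1) _ cl, of "\<lambda>_. 0"]) (use that(2) in auto)
  show "psi p = 0" "X1 p = 0" "X2 p = 0" using z[OF c(1)] z[OF c(2)] z[OF c(3)] zero_Reg2 by blast+
  have "norm (grad X1 p) = 0" by (rule z[OF continuous_on_norm[OF continuous_grad_X(1)]]) (simp add: zero_Reg2(4))
  moreover have "norm (grad X2 p) = 0" by (rule z[OF continuous_on_norm[OF continuous_grad_X(2)]]) (simp add: zero_Reg2(5))
  ultimately show "grad X1 p = 0" "grad X2 p = 0" by simp_all
qed

text \<open>Every point \<open>q\<close> near the arc is joined to its radial projection \<open>q'\<close> on the arc by a segment of length
  \<open>c\<^sub>2 - |q - z|\<close>. At \<open>q'\<close> the function \<open>\<psi>\<close> and its derivatives up to the second order vanish, and on the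
  segment \<open>D\<^sup>2\<psi>\<close> is small by continuity; the mean value theorem, applied first to the components of \<open>D\<psi>\<close> and
  then to \<open>\<psi>\<close>, gives the bounds.\<close>
lemma psi_flat:
  assumes p: "p \<in> Arc_int" and \<mu>: "0 < \<mu>"
  obtains k where "0 < k" "ball p k \<subseteq> U"
    "\<And>q. q \<in> ball p k \<Longrightarrow> norm (q - zz) < cc \<Longrightarrow> norm (grad psi q) \<le> \<mu> * (cc - norm (q - zz))"
    "\<And>q. q \<in> ball p k \<Longrightarrow> norm (q - zz) < cc \<Longrightarrow> \<bar>psi q\<bar> \<le> \<mu> * (cc - norm (q - zz))\<^sup>2"
proof -
  have pU: "p \<in> U" using p U by blast
  have np: "norm (p - zz) = cc" using p Arc_norm by (auto simp: sonic_arc_interior_def)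
  have small: "\<exists>d>0. \<forall>q\<in>U. dist q p < d \<longrightarrow> norm (f q) \<le> \<mu> / 2" if "continuous_on U f" "f p = 0" for f :: "plane \<Rightarrow> plane"
  proof -
    have "\<exists>d>0. \<forall>q\<in>U. dist q p < d \<longrightarrow> dist (f q) (f p) < \<mu> / 2"
      using that(1) pU \<mu> unfolding continuous_on_iff by (meson half_gt_zero)
    then show ?thesis using that(2) by (auto simp: less_imp_le)
  qed
  obtain d1 where d1: "0 < d1" "\<And>q. q \<in> U \<Longrightarrow> dist q p < d1 \<Longrightarrow> norm (grad X1 q) \<le> \<mu> / 2"
    using small[OF continuous_grad_X(1) zero_Arc_int(4)[OF p]] by blast
  obtain d2 where d2: "0 < d2" "\<And>q. q \<in> U \<Longrightarrow> dist q p < d2 \<Longrightarrow> norm (grad X2 q) \<le> \<mu> / 2"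
    using small[OF continuous_grad_X(2) zero_Arc_int(5)[OF p]] by blast
  obtain d3 where d3: "0 < d3" "ball p d3 \<subseteq> U" using U(1) pU open_contains_ball by blast
  obtain d4 where d4: "0 < d4" "\<And>q. q \<in> ball p d4 \<Longrightarrow> norm (q - zz) = cc \<Longrightarrow> q \<in> Arc_int"
    using near_Arc_int[OF p] by metis
  define m where "m = min (min d1 d2) (min d3 d4)"
  have m: "0 < m" "m \<le> d1" "m \<le> d2" "m \<le> d3" "m \<le> d4" using d1 d2 d3 d4 by (auto simp: m_def)
  have mU: "ball p m \<subseteq> U" using m d3 by force
  have D: "norm (grad psi y) \<le> \<mu> * norm (y - q')" if q': "q' \<in> ball p m" "norm (q' - zz) = cc" and y: "y \<in> ball p m" for q' y
  proof -
    have seg: "closed_segment q' y \<subseteq> ball p m" by (rule closed_segment_subset[OF q'(1) y convex_ball])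
    have z: "q' \<in> Arc_int" using d4(2)[of q'] q' m by simp
    have inU: "q \<in> U" "dist q p < d1" "dist q p < d2" if "q \<in> closed_segment q' y" for q
    proof -
      have "q \<in> ball p m" using that seg by blast
      then show "q \<in> U" "dist q p < d1" "dist q p < d2" using mU m by (auto simp: dist_commute)
    qed
    have "\<bar>X1 y - X1 q'\<bar> \<le> \<mu> / 2 * norm (y - q')" "\<bar>X2 y - X2 q'\<bar> \<le> \<mu> / 2 * norm (y - q')"
      by (rule mvt_segment; intro X_differentiable d1(2) d2(2) inU; assumption)+
    then have "\<bar>X1 y\<bar> + \<bar>X2 y\<bar> \<le> \<mu> * norm (y - q')" using zero_Arc_int(2,3)[OF z] by simp
    moreover have "norm (grad psi y) \<le> \<bar>X1 y\<bar> + \<bar>X2 y\<bar>"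
      unfolding grad_psi_U[OF subsetD[OF mU y]] using sqrt_sum_squares_le_sum_abs[of "X1 y" "X2 y"] by (simp add: norm_Pair)
    ultimately show ?thesis by linarith
  qed
  define k where "k = min (m / 2) cc"
  have k: "0 < k" "k \<le> m / 2" "k \<le> cc" using m cc_pos by (auto simp: k_def)
  have main: "norm (grad psi q) \<le> \<mu> * (cc - norm (q - zz)) \<and> \<bar>psi q\<bar> \<le> \<mu> * (cc - norm (q - zz))\<^sup>2"
    if q: "q \<in> ball p k" "norm (q - zz) < cc" for q
  proof -
    define r where "r = norm (q - zz)"
    have qp: "norm (q - p) < k" using q by (simp add: dist_norm norm_minus_commute)
    have tri: "cc \<le> r + norm (q - p)"
      using norm_triangle_ineq[of "q - zz" "p - q"] np by (simp add: r_def norm_minus_commute)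
    then have r: "0 < r" "r < cc" using qp k q by (auto simp: r_def)
    define q' where "q' = zz + (cc / r) *\<^sub>R (q - zz)"
    have nq': "norm (q' - zz) = cc" using r cc_pos by (simp add: q'_def r_def[symmetric])
    have "q - q' = (1 - cc / r) *\<^sub>R (q - zz)" by (simp add: q'_def algebra_simps)
    then have "norm (q - q') = \<bar>1 - cc / r\<bar> * r" by (simp add: r_def)
    also have "\<dots> = cc - r" using r by (simp add: abs_if field_simps)
    finally have x: "norm (q - q') = cc - r" .
    have "norm (q' - p) \<le> norm (q - q') + norm (q - p)"
      using norm_triangle_ineq[of "q' - q" "q - p"] by (simp add: norm_minus_commute)
    then have q'm: "q' \<in> ball p m" using x tri qp k by (simp add: dist_norm norm_minus_commute)
    have qm: "q \<in> ball p m" using q k by simp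
    have "norm (grad psi q) \<le> \<mu> * (cc - r)" using D[OF q'm nq' qm] x by simp
    moreover have "\<bar>psi q - psi q'\<bar> \<le> \<mu> * (cc - r) * norm (q - q')"
    proof (rule mvt_segment)
      fix y assume y: "y \<in> closed_segment q' q"
      then have ym: "y \<in> ball p m" using closed_segment_subset[OF q'm qm convex_ball] by blast
      then show "psi differentiable (at y)" using mU psi_differentiable_U by blast
      have "norm (y - q') \<le> cc - r" using y x segment_bound(1)[OF y] by simp
      then have "\<mu> * norm (y - q') \<le> \<mu> * (cc - r)" using \<mu> by simp
      then show "norm (grad psi y) \<le> \<mu> * (cc - r)" using D[OF q'm nq' ym] by linarith
    qed
    moreover have "q' \<in> Arc_int" using d4(2)[of q'] q'm nq' m by simp
    then have "psi q' = 0" by (rule zero_Arc_int)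
    ultimately show ?thesis using x by (simp add: r_def power2_eq_square)
  qed
  show ?thesis
  proof (rule that[OF k(1)])
    show "ball p k \<subseteq> U" using mU k m by force
  qed (use main in auto)
qed

text \<open>Bernoulli's law for \<open>\<phi>\<close> minus that for \<open>\<phi>\<^sub>2\<close>.\<close>
lemma sound_sq_diff:
  assumes "q \<in> \<Omega>"
  shows "sound_sq_of \<gamma> \<rho>0 \<phi> q - cc\<^sup>2 = - (\<gamma> - 1) * (psi q + (zz - q) \<bullet> grad psi q + (norm (grad psi q))\<^sup>2 / 2)"
proof -
  have "grad \<phi> q = grad psi q + (zz - q)" using psi_grad[OF assms] by simp
  then have "(norm (grad \<phi> q))\<^sup>2 = (norm (grad psi q))\<^sup>2 + 2 * ((zz - q) \<bullet> grad psi q) + (norm (zz - q))\<^sup>2"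
    unfolding power2_norm_eq_inner by (simp add: inner_add inner_commute)
  then show ?thesis
    unfolding cc_square[of q] sound_sq_of_def sound_sq_def grad_phi2_center psi_def by (simp add: field_simps)
qed

text \<open>The comparison takes place in the lens \<open>V\<close>, bounded by the sonic circle and the curve
  \<open>s = ((q - z) \<bullet> e)\<^sup>2\<close> near \<open>p\<close>. By \<open>psi_flat\<close> the coefficients satisfy the hypotheses of
  \<open>sonic_barrier_positive\<close> there. The resulting lower bound \<open>\<epsilon> s\<^sup>2\<close> for \<open>\<psi>\<close> on the radius through \<open>p\<close> contradicts
  \<open>psi_flat\<close>, used once more with a constant depending on \<open>\<epsilon>\<close>.\<close>
lemma C2_across_contradiction: False
proof -
  obtain p where p: "p \<in> Arc_int" using Arc_int_nonempty by blast
  have np: "norm (p - zz) = cc" using p Arc_norm by (auto simp: sonic_arc_interior_def)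
  define e where "e = (1 / cc) *\<^sub>R (- snd (p - zz), fst (p - zz))"
  have ne: "norm e = 1"
  proof -
    have "norm (- snd (p - zz), fst (p - zz)) = norm (p - zz)" by (simp add: norm_prod_def add.commute power2_commute[of "snd zz"])
    then show ?thesis unfolding e_def norm_scaleR using np cc_pos by simp
  qed
  have ep: "(p - zz) \<bullet> e = 0" unfolding e_def inner_scaleR_right by (simp add: inner_prod_def algebra_simps)
  \<comment> \<open>The constant is such that \<open>|D\<psi>| \<le> \<mu> s / c\<^sub>2\<close> and \<open>|\<psi>| \<le> \<mu> s\<close> change \<open>c\<^sup>2\<close> by at most
      \<open>3 (\<gamma> - 1) \<mu> s \<le> s / 100\<close>.\<close>
  define \<mu> where "\<mu> = min 1 (1 / (100 * (1 + 3 * (\<gamma> - 1))))"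
  have \<mu>: "0 < \<mu>" "\<mu> \<le> 1" "\<mu> \<le> 1 / (100 * (1 + 3 * (\<gamma> - 1)))" using \<gamma> by (auto simp: \<mu>_def)
  have \<mu>g: "100 * \<mu> + 300 * ((\<gamma> - 1) * \<mu>) \<le> 1"
  proof -
    have "\<mu> * (100 * (1 + 3 * (\<gamma> - 1))) \<le> 1" using \<mu>(3) \<gamma> by (subst (asm) pos_le_divide_eq) auto
    then show ?thesis by (simp add: algebra_simps)
  qed
  have \<mu>1: "100 * \<mu> \<le> 1" "300 * ((\<gamma> - 1) * \<mu>) \<le> 1"
    using \<mu>g \<mu>(1) \<gamma> mult_nonneg_nonneg[of "\<gamma> - 1" \<mu>] by linarith+
  obtain k1 where k1: "0 < k1" "ball p k1 \<subseteq> U"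
    "\<And>q. q \<in> ball p k1 \<Longrightarrow> norm (q - zz) < cc \<Longrightarrow> norm (grad psi q) \<le> \<mu> * (cc - norm (q - zz))"
    "\<And>q. q \<in> ball p k1 \<Longrightarrow> norm (q - zz) < cc \<Longrightarrow> \<bar>psi q\<bar> \<le> \<mu> * (cc - norm (q - zz))\<^sup>2"
    using psi_flat[OF p \<mu>(1)] by blast
  obtain k2 where k2: "0 < k2" "\<And>q. q \<in> ball p k2 \<Longrightarrow> norm (q - zz) < cc \<Longrightarrow> q \<in> \<Omega>"
    using near_Arc_int[OF p] by metis
  define k where "k = min (min k1 k2) (cc / 200) / 2"
  have k: "0 < k" "k < k1" "k < k2" "k \<le> cc / 400" using k1 k2 cc_pos by (auto simp: k_def)
  let ?s = "\<lambda>q. cc\<^sup>2 - (norm (q - zz))\<^sup>2"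
  define V where "V = {q. ((q - zz) \<bullet> e)\<^sup>2 \<le> ?s q}"
  let ?w = "barrier zz cc e 0 1 1"
  have V_Om: "norm (q - zz) < cc \<and> q \<in> \<Omega>" if q: "q \<in> cball p k \<inter> V" "q \<noteq> p" for q
  proof -
    have qV: "((q - zz) \<bullet> e)\<^sup>2 \<le> ?s q" using q by (simp add: V_def)
    moreover have "0 \<le> ((q - zz) \<bullet> e)\<^sup>2" by simp
    ultimately have "(norm (q - zz))\<^sup>2 \<le> cc\<^sup>2" by linarith
    then have le: "norm (q - zz) \<le> cc" by (rule power2_le_imp_le) (use cc_pos in simp)
    have "norm (q - zz) \<noteq> cc"
    proof
      assume n: "norm (q - zz) = cc"
      then have t0: "(q - zz) \<bullet> e = 0" using qV by simp
      \<comment> \<open>Then \<open>q - z\<close> is parallel to \<open>p - z\<close> and of the same length, and the antipode of \<open>p\<close> is too far away.\<close>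
      define a where "a = fst (p - zz)"
      define b where "b = snd (p - zz)"
      define x where "x = fst (q - zz)"
      define y where "y = snd (q - zz)"
      have ab: "a\<^sup>2 + b\<^sup>2 = cc\<^sup>2" using norm_plane_sq[of "p - zz"] np by (simp add: a_def b_def)
      have xy: "x\<^sup>2 + y\<^sup>2 = cc\<^sup>2" using norm_plane_sq[of "q - zz"] n by (simp add: x_def y_def)
      have "(1 / cc) * (y * a - x * b) = 0"
        using t0 unfolding e_def inner_scaleR_right inner_prod_def fst_conv snd_conv a_def[symmetric] b_def[symmetric] x_def[symmetric] y_def[symmetric]
        by (auto simp: algebra_simps)
      then have cr: "y * a - x * b = 0" using cc_pos by simp
      have "(x * a + y * b)\<^sup>2 + (y * a - x * b)\<^sup>2 = (x\<^sup>2 + y\<^sup>2) * (a\<^sup>2 + b\<^sup>2)" by algebra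
      then have sq: "(x * a + y * b)\<^sup>2 = (cc\<^sup>2)\<^sup>2" unfolding cr ab xy by (simp add: power2_eq_square)
      have "(norm (q - p))\<^sup>2 = 2 * cc\<^sup>2 - 2 * (x * a + y * b)"
      proof -
        have "(norm (q - p))\<^sup>2 = (x - a)\<^sup>2 + (y - b)\<^sup>2"
          unfolding norm_plane_sq by (simp add: x_def y_def a_def b_def)
        also have "\<dots> = (x\<^sup>2 + y\<^sup>2) + (a\<^sup>2 + b\<^sup>2) - 2 * (x * a + y * b)" by (simp add: power2_eq_square algebra_simps)
        finally show ?thesis unfolding ab xy by simp
      qed
      moreover have "x * a + y * b = cc\<^sup>2 \<or> x * a + y * b = - cc\<^sup>2" by (rule power2_eq_iff[THEN iffD1, OF sq])
      moreover have "norm (q - p) < cc" using q(1) k cc_pos by (simp add: dist_norm norm_minus_commute)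
      then have "(norm (q - p))\<^sup>2 < cc\<^sup>2" by (intro power_strict_mono) auto
      moreover have "0 < cc\<^sup>2" using cc_pos by simp
      ultimately have "(norm (q - p))\<^sup>2 = 0" by auto
      then show False using q(2) by simp
    qed
    then have lt: "norm (q - zz) < cc" using le by simp
    moreover have "q \<in> ball p k2" using q k by simp
    ultimately show ?thesis using k2(2) by blast
  qed
  have pU: "p \<in> U" using p U by blast
  have psi_p: "psi p = 0" by (rule zero_Arc_int[OF p])
  have cbU: "cball p k \<subseteq> U" using k1(2) k(2) by force
  obtain \<epsilon> where \<epsilon>: "0 < \<epsilon>" "\<And>q. q \<in> cball p k \<inter> V \<Longrightarrow> \<epsilon> * ?w q \<le> psi q"
  proof (rule barrier_comparison[of V p k psi ?w])
    show "closed V" unfolding V_def by (intro closed_Collect_le continuous_intros)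
    have "continuous_on U psi"
      by (intro continuous_at_imp_continuous_on ballI differentiable_imp_continuous_within psi_differentiable_U)
    then show "continuous_on (cball p k \<inter> V) psi" using cbU by (blast intro: continuous_on_subset)
    show "continuous_on (cball p k \<inter> V) ?w" by (rule continuous_on_barrier)
    show "0 \<le> psi q" if "q \<in> cball p k \<inter> V" for q
      using V_Om[OF that] psi_pos[of q] psi_p by (cases "q = p") auto
    show "0 < psi q" if "q \<in> sphere p k \<inter> V" for q
    proof -
      have "q \<in> cball p k \<inter> V" "q \<noteq> p" using that k by auto
      then show ?thesis using V_Om psi_pos by blast
    qed
    fix q assume q: "q \<in> ball p k \<inter> V" and w: "0 < ?w q"
    have "q \<noteq> p" using w np by (auto simp: barrier_def)
    moreover have "q \<in> cball p k \<inter> V" using q by auto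
    ultimately have lt: "norm (q - zz) < cc" and qOm: "q \<in> \<Omega>" using V_Om by blast+
    define r where "r = norm (q - zz)"
    define s where "s = cc\<^sup>2 - r\<^sup>2"
    have r: "0 \<le> r" "r < cc" using lt by (auto simp: r_def)
    have s_eq: "s = (cc - r) * (cc + r)" by (simp add: s_def power2_eq_square algebra_simps)
    then have s: "0 < s" using r by simp
    have sx: "(cc - r) * cc \<le> s" unfolding s_eq using r by (intro mult_left_mono) auto
    have rk: "cc - r \<le> k"
      using norm_triangle_ineq[of "q - zz" "p - q"] np q by (simp add: r_def dist_norm)
    have "s \<le> k * (2 * cc)" unfolding s_eq using r rk k by (intro mult_mono) auto
    also have "\<dots> \<le> (cc / 400) * (2 * cc)" using k cc_pos by (intro mult_right_mono) auto
    also have "\<dots> \<le> cc\<^sup>2 / 100" by (simp add: power2_eq_square)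
    finally have s100: "s \<le> cc\<^sup>2 / 100" .
    have w': "0 < s * (s - ((q - zz) \<bullet> e)\<^sup>2)" using w by (simp add: barrier_def s_def r_def)
    then have ts: "((q - zz) \<bullet> e)\<^sup>2 < s" using s by (simp add: zero_less_mult_iff)
    have int: "q \<in> interior V"
    proof (rule interiorI)
      show "open {q. ((q - zz) \<bullet> e)\<^sup>2 < ?s q}" by (intro open_Collect_less continuous_intros)
      show "q \<in> {q. ((q - zz) \<bullet> e)\<^sup>2 < ?s q}" using ts by (simp add: s_def r_def)
      show "{q. ((q - zz) \<bullet> e)\<^sup>2 < ?s q} \<subseteq> V" by (auto simp: V_def)
    qed
    let ?D = "grad psi q" and ?K = "sound_sq_of \<gamma> \<rho>0 \<phi> q"
    have qk1: "q \<in> ball p k1" using q k by simp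
    have D: "norm ?D \<le> \<mu> * (cc - r)" using k1(3)[OF qk1 lt] by (simp add: r_def)
    have psiq: "\<bar>psi q\<bar> \<le> \<mu> * (cc - r)\<^sup>2" using k1(4)[OF qk1 lt] by (simp add: r_def)
    have cD: "cc * norm ?D \<le> \<mu> * s"
    proof -
      have "cc * norm ?D \<le> cc * (\<mu> * (cc - r))" using D cc_pos by (intro mult_left_mono) auto
      also have "\<dots> = \<mu> * ((cc - r) * cc)" by simp
      also have "\<dots> \<le> \<mu> * s" using sx \<mu> by (intro mult_left_mono) auto
      finally show ?thesis .
    qed
    have x2: "(cc - r)\<^sup>2 \<le> s" unfolding power2_eq_square s_eq using r by (intro mult_left_mono) auto
    have A1: "\<bar>psi q\<bar> \<le> \<mu> * s" using psiq mult_left_mono[OF x2, of \<mu>] \<mu> by linarith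
    have A2: "\<bar>(zz - q) \<bullet> ?D\<bar> \<le> \<mu> * s"
    proof -
      have "\<bar>(zz - q) \<bullet> ?D\<bar> \<le> norm (zz - q) * norm ?D" by (rule Cauchy_Schwarz_ineq2)
      also have "\<dots> \<le> cc * norm ?D" using lt by (intro mult_right_mono) (auto simp: norm_minus_commute)
      finally show ?thesis using cD by linarith
    qed
    have A3: "(norm ?D)\<^sup>2 \<le> \<mu> * s"
    proof -
      have "(norm ?D)\<^sup>2 \<le> (\<mu> * (cc - r))\<^sup>2" using D by (intro power_mono) auto
      also have "\<dots> = \<mu> * (\<mu> * (cc - r)\<^sup>2)" by (simp add: power2_eq_square)
      also have "\<dots> \<le> \<mu> * (1 * s)" using \<mu> x2 by (intro mult_left_mono mult_mono) auto
      finally show ?thesis by simp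
    qed
    have KK: "\<bar>?K - cc\<^sup>2\<bar> \<le> s / 100"
    proof -
      have "\<bar>psi q + (zz - q) \<bullet> ?D + (norm ?D)\<^sup>2 / 2\<bar> \<le> 3 * (\<mu> * s)"
        using A1 A2 A3 zero_le_power2[of "norm ?D"] unfolding abs_le_iff by linarith
      then have "(\<gamma> - 1) * \<bar>psi q + (zz - q) \<bullet> ?D + (norm ?D)\<^sup>2 / 2\<bar> \<le> (\<gamma> - 1) * (3 * (\<mu> * s))"
        using \<gamma> by (intro mult_left_mono) auto
      also have "\<dots> = (3 * ((\<gamma> - 1) * \<mu>)) * s" by simp
      also have "\<dots> \<le> (1 / 100) * s" using \<mu>1(2) s by (intro mult_right_mono) auto
      finally show ?thesis unfolding sound_sq_diff[OF qOm] using \<gamma> by (simp add: abs_mult)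
    qed
    have cD': "cc * norm ?D \<le> s / 100"
    proof -
      have "\<mu> * s \<le> (1 / 100) * s" using \<mu>1(1) s by (intro mult_right_mono) auto
      then show ?thesis using cD by simp
    qed
    have "grad \<phi> q = ?D - (q - zz)" using psi_grad[OF qOm] by (simp add: algebra_simps)
    then have "0 < flow_op ?K (grad \<phi> q) (barrier_hess zz cc e 0 1 1 q)"
      using sonic_barrier_positive[OF cc_pos s s100 _ ne less_imp_le[OF ts] KK cD' refl]
      by (simp add: s_def r_def)
    then have "strictly_sub psi ?w q"
      by (rule strictly_subI[OF quadratic_form_psi_hess quadratic_form_barrier_hess psi_second_along[OF qOm]
            second_along_barrier elliptic_atD(1)[OF ell[OF qOm]] eq_refl[OF psi_equation[OF qOm]]])
    then show "q \<in> interior V \<and> strictly_sub psi ?w q" using int by blast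
  qed blast
  \<comment> \<open>On the radius \<open>s \<ge> c\<^sub>2 t\<close> at distance \<open>t\<close> from the arc, so half of \<open>\<epsilon> c\<^sub>2\<^sup>2\<close> is small enough.\<close>
  define \<mu>' where "\<mu>' = \<epsilon> * cc\<^sup>2 / 2"
  have \<mu>': "0 < \<mu>'" using \<epsilon> cc_pos by (simp add: \<mu>'_def)
  obtain k3 where k3: "0 < k3"
    "\<And>q. q \<in> ball p k3 \<Longrightarrow> norm (q - zz) < cc \<Longrightarrow> \<bar>psi q\<bar> \<le> \<mu>' * (cc - norm (q - zz))\<^sup>2"
    by (rule psi_flat[OF p \<mu>'], rule that)
  define t where "t = min k k3 / 2"
  have t: "0 < t" "t < k" "t < k3" "t < cc" using k k3 cc_pos by (auto simp: t_def)
  define q where "q = p - (t / cc) *\<^sub>R (p - zz)"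
  have "dist p q = t" using t np cc_pos by (simp add: q_def dist_norm)
  then have qb: "q \<in> cball p k" "q \<in> ball p k3" using t by auto
  have qz: "q - zz = (1 - t / cc) *\<^sub>R (p - zz)" by (simp add: q_def algebra_simps)
  have "0 \<le> 1 - t / cc" using t cc_pos by simp
  then have nq: "norm (q - zz) = cc - t" unfolding qz norm_scaleR np using cc_pos by (simp add: left_diff_distrib)
  have te: "(q - zz) \<bullet> e = 0" unfolding qz using ep by simp
  have s: "?s q = t * (2 * cc - t)" unfolding nq by (simp add: power2_eq_square algebra_simps)
  have tc: "t * cc \<le> t * (2 * cc - t)" using t by (intro mult_left_mono) auto
  have tc0: "0 < t * cc" using t cc_pos by simp
  have "q \<in> V" unfolding V_def using te s tc tc0 by simp
  then have "\<epsilon> * ?w q \<le> psi q" using \<epsilon>(2) qb by blast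
  moreover have "?w q = (t * (2 * cc - t))\<^sup>2" unfolding barrier_def s te by (simp add: power2_eq_square)
  moreover have "(t * cc)\<^sup>2 \<le> (t * (2 * cc - t))\<^sup>2" using tc tc0 by (intro power_mono) auto
  ultimately have "\<epsilon> * (t * cc)\<^sup>2 \<le> psi q" using \<epsilon>(1) by (smt (verit) mult_left_mono)
  moreover have "\<bar>psi q\<bar> \<le> \<mu>' * t\<^sup>2" using k3(2)[OF qb(2)] nq t by simp
  moreover have "\<mu>' * t\<^sup>2 = \<epsilon> * (t * cc)\<^sup>2 / 2" by (simp add: \<mu>'_def power_mult_distrib)
  moreover have "0 < \<epsilon> * (t * cc)\<^sup>2" by (intro mult_pos_pos \<epsilon>(1) zero_less_power tc0)
  ultimately show False by linarith
qed

end

end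

theorem theorem4p1:
  fixes \<gamma> \<rho>0 \<rho>1 u1 \<theta> u2 :: real and P1 :: "real \<times> real"
    and \<sigma> :: "real \<Rightarrow> real \<times> real" and \<phi> :: "real \<times> real \<Rightarrow> real"
  assumes "\<gamma> > 1" and "\<rho>0 > 0" and "\<rho>1 > \<rho>0" and "u1 > 0"
    and "xi0 \<gamma> \<rho>0 \<rho>1 = \<rho>1 * u1 / (\<rho>1 - \<rho>0)"
    and "0 < \<theta>" and "\<theta> < pi / 2"
    and "regular_reflection_solution \<gamma> \<rho>0 \<rho>1 u1 \<theta> u2 P1 \<sigma> \<phi>"
  shows "\<not> C2_across (Lam \<theta>) (sonic_arc_interior \<gamma> \<rho>0 (xi0 \<gamma> \<rho>0 \<rho>1) \<theta> u2 P1) \<phi>"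
proof -
  have "u1 * (\<rho>1 - \<rho>0) < u1 * \<rho>1" using assms(2-4) by (intro mult_strict_left_mono) auto
  then have "u1 < xi0 \<gamma> \<rho>0 \<rho>1" unfolding assms(5) using assms(2-4) by (simp add: pos_less_divide_eq mult.commute)
  have "0 < \<rho>1" using assms(2,3) by linarith
  note R = assms(8)[unfolded regular_reflection_solution_def Let_def problem2_solution_def]
  interpret reflection_solution \<gamma> \<rho>0 \<rho>1 u1 "xi0 \<gamma> \<rho>0 \<rho>1" \<theta> u2 P1 \<sigma> \<phi>
    by unfold_locales (use assms(1,4,6,7) R \<open>0 < \<rho>1\<close> \<open>u1 < xi0 \<gamma> \<rho>0 \<rho>1\<close> in blast)+
  show ?thesis
    unfolding C2_across_def using C2_across_contradiction by blast
qed

end
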